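(* Let $\varphi_1(t)=\frac12\varphi(t)$ be any Jacob's ladder, where $\varphi$ is the exact solution of the nonlinear integral equation $$\int_0^{\mu[x(T)]} Z^2(t)e^{-\frac{2}{x(T)}t}\,dt=\int_0^T Z^2(t)\,dt .$$ For $a\in(0,1)$ put $\tau_a=\arccos\frac a2$. Then $\varphi_1$ is an asymptotic solution (as $T\to\infty$) of the nonlinear integral equation $$\frac{\int_{x^{-1}(T+\tau_a)}^{x^{-1}(T+\pi)}\ln[1+a^2-2a\cos(x(t)-T)]\left|\zeta\left(\tfrac12+it\right)\right|^2dt}{-\int_{x^{-1}(T)}^{x^{-1}(T+\tau_a)}\ln[1+a^2-2a\cos(x(t)-T)]\left|\zeta\left(\tfrac12+it\right)\right|^2dt}=1$$ for the unknown function $x(t)=x(t;a)$; that is, for every Jacob's ladder $\varphi_1$ and every fixed $a\in(0,1)$, $$\frac{\int_{\varphi_1^{-1}(T+\tau_a)}^{\varphi_1^{-1}(T+\pi)}\ln[1+a^2-2a\cos(\varphi_1(t)-T)]\left|\zeta\left(\tfrac12+it\right)\right|^2dt}{-\int_{\varphi_1^{-1}(T)}^{\varphi_1^{-1}(T+\tau_a)}\ln[1+a^2-2a\cos(\varphi_1(t)-T)]\left|\zeta\left(\tfrac12+it\right)\right|^2dt}=1+\mathcal{O}\left(\frac{\ln\ln T}{\ln T}\right),\qquad T\to\infty .$$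
   Context: $\zeta$ is the Riemann zeta-function and $Z(t)=e^{i\vartheta(t)}\zeta\left(\frac12+it\right)$, where $\vartheta(t)=-\frac t2\ln\pi+\mathrm{Im}\ln\Gamma\left(\frac14+i\frac t2\right)$; thus $Z$ is real-valued and $Z^2(t)=|\zeta(\frac12+it)|^2$ for real $t$. Jacob's ladder: let $\mu\in C^\infty([y_0,\infty))$ be an admissible function, i.e. monotonically increasing to $+\infty$ with $\mu(y)\ge 7y\ln y$. For each such $\mu$, the function $y=\varphi(T)=\varphi_\mu(T)$, defined for all sufficiently large $T$, is the solution $x(T)=\varphi(T)$ of the nonlinear integral equation $\int_0^{\mu[x(T)]} Z^2(t)e^{-\frac{2}{x(T)}t}\,dt=\int_0^T Z^2(t)\,dt$. Both $\varphi$ and $\varphi_1=\frac12\varphi$ are called Jacob's ladders; there are infinitely many of them (one for each admissible $\mu$). For $T\ge T_0[\varphi_1]$ (a sufficiently large constant depending on the ladder), $\varphi_1$ is increasing and $\varphi_1^{-1}$ denotes its inverse function. *)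

theory Defs
  imports "HOL-Complex_Analysis.Complex_Analysis" "HOL-Library.Landau_Symbols"
begin

text \<open>
  The Riemann zeta function is the holomorphic continuation of its Dirichlet series to the plane
  punctured at 1. The value at 1 carries no information.
\<close>

definition riemann_zeta :: "complex \<Rightarrow> complex" where
  "riemann_zeta s = (THE w. \<exists>f. f holomorphic_on (- {1}) \<and>
     (\<forall>z. Re z > 1 \<longrightarrow> f z = (\<Sum>n. 1 / of_nat (Suc n) powr z)) \<and> w = f s)"

definition zeta_crit :: "real \<Rightarrow> complex" where
  "zeta_crit t = riemann_zeta (Complex (1 / 2) t)"

text \<open>
  \<open>ln_Gamma\<close> is the branch of the logarithm of the Gamma function that is holomorphic off the
  nonpositive real axis and real on the positive real axis.
\<close>

definition RS_theta :: "real \<Rightarrow> real" where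
  "RS_theta t = - (t / 2) * ln pi + Im (ln_Gamma (Complex (1 / 4) (t / 2)))"

text \<open>
  The product below is real by the functional equation of the zeta function; \<open>Re\<close> only
  turns it into an element of type \<open>real\<close>.
\<close>

definition hardy_Z :: "real \<Rightarrow> real" where
  "hardy_Z t = Re (exp (\<i> * of_real (RS_theta t)) * zeta_crit t)"

text \<open>
  Infinite differentiability on a set, with derivatives taken within the set (hence one-sided at
  the end point of a half-line); \<open>D n\<close> is the \<open>n\<close>-th derivative.
\<close>

definition C_infinity_on :: "real set \<Rightarrow> (real \<Rightarrow> real) \<Rightarrow> bool" where
  "C_infinity_on S f \<longleftrightarrow> (\<exists>D :: nat \<Rightarrow> real \<Rightarrow> real. D 0 = f \<and>
     (\<forall>n. \<forall>y\<in>S. (D n has_real_derivative D (Suc n) y) (at y within S)))"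

definition admissible :: "real \<Rightarrow> (real \<Rightarrow> real) \<Rightarrow> bool" where
  "admissible y0 \<mu> \<longleftrightarrow> y0 > 0 \<and> C_infinity_on {y0..} \<mu> \<and> mono_on {y0..} \<mu> \<and>
     filterlim \<mu> at_top at_top \<and> (\<forall>y\<ge>y0. \<mu> y \<ge> 7 * y * ln y)"

text \<open>
  \<open>jacob_solution y0 \<mu> T0 \<phi>\<close>: on the half-line \<open>T \<ge> T0\<close>, \<open>\<phi>\<close> takes values in the domain
  \<open>{y0..}\<close> of \<open>\<mu>\<close> and solves the nonlinear integral equation. The left-hand side of that
  equation is strictly increasing in the unknown wherever it is positive, so \<open>\<phi>\<close> is determined by
  \<open>\<mu>\<close> and is strictly increasing on \<open>{T0..}\<close>.
\<close>

definition jacob_solution :: "real \<Rightarrow> (real \<Rightarrow> real) \<Rightarrow> real \<Rightarrow> (real \<Rightarrow> real) \<Rightarrow> bool" where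
  "jacob_solution y0 \<mu> T0 \<phi> \<longleftrightarrow> T0 > 0 \<and> (\<forall>T\<ge>T0. \<phi> T \<ge> y0 \<and>
     integral {0..\<mu> (\<phi> T)} (\<lambda>t. (hardy_Z t)\<^sup>2 * exp (- (2 / \<phi> T) * t)) =
     integral {0..T} (\<lambda>t. (hardy_Z t)\<^sup>2))"

definition log_zeta_integral :: "real \<Rightarrow> (real \<Rightarrow> real) \<Rightarrow> real \<Rightarrow> real \<Rightarrow> real \<Rightarrow> real" where
  "log_zeta_integral a x T u v =
     integral {u..v} (\<lambda>t. ln (1 + a\<^sup>2 - 2 * a * cos (x t - T)) * (norm (zeta_crit t))\<^sup>2)"

end

(*
  Write w = Z^2 = |zeta(1/2 + it)|^2, G(T) = int_0^T w and
  F(y) = int_0^{mu(y)} w(t) exp(-2t/y) dt, so that F(phi(T)) = G(T). Substituting y = phi_1(t) turns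
  the integrals of the theorem into Stieltjes integrals of h(y - T), h(x) = ln(1 + a^2 - 2 a cos x),
  against dF(2y) over windows in [T, T + pi]. On such a window F is linear up to a relative error
  O(ln T / T): by mu(y) >= 7 y ln y only t = O(T ln T) matters, up to O(T^-4), and for these t the
  weight (2t/y^2) exp(-2t/y) is nearly independent of y. So the integral over [alpha, beta] is
  P(T) int_alpha^beta h up to that relative error, with the same P(T) for both windows, and the theorem
  follows, with the stronger error term O(ln T / T), from int_0^pi h = 0. The asymptotics of P(T),
  that is the mean value theorem for zeta, play no role.

  About zeta one needs: its continuation and the reality of Z (Riemann's theta function proof), a
  polynomial bound on the critical line, and the divergence of int w, without which phi would be
  bounded. The last two come from the alternating series (1 - 2^(1-s)) zeta(s): if int w converged,
  then delta int_0^oo eta(1/2 + it) exp(-delta t) dt would tend to 0 with delta by the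
  Cauchy-Schwarz inequality, but computed term by term it tends to 1.
*)

theory Submission
  imports Defs "HOL-Probability.Characteristic_Functions" "HOL-Probability.Sinc_Integral"
    "HOL-Real_Asymp.Real_Asymp"
begin

section \<open>The functional equation of the theta function\<close>

text \<open>The ladder is rigid because F is a smoothed form of G: the weight exp(-2t/y) averages w
  over a range of order y ln y, so increments of F over bounded steps in y are nearly linear however
  irregular w is locally. But mu(y) moves with y as well, at a speed with no upper bound. Cutting
  every integral at the common point 7 Y ln Y, with Y = 2T, removes this motion and leaves a tail of
  order Y^-4 in each increment.

  Such a tail is an additive error, while the theorem compares quantities of size P(T), for which
  the crude bound P(T) >= const / Y^2 is proved, from t in [0, 1] alone. Freezing h on about Y
  pieces of the window costs a relative error 1/Y and collects tails of total size Y * Y^-4, which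
  is O(P(T) / Y). Hence the constant 7 pays for the quadratic growth of w, for the weak lower bound
  and for the partition together. The partition is the substitute for a Stieltjes calculus: it
  compares increments of F and differentiates only the weight.\<close>

lemma cosine_coefficients_zero:
  fixes d :: "real \<Rightarrow> real"
  assumes cont: "continuous_on {0..1} d"
    and sym: "\<And>u. u \<in> {0..1} \<Longrightarrow> d (1 - u) = d u"
    and orth: "\<And>k::nat. integral {0..1} (\<lambda>u. d u * cos (2 * pi * real k * u)) = 0"
    and u: "u \<in> {0..1}"
  shows "d u = 0"
proof -
  have orth': "integral {0..1} (\<lambda>u. d u * cos (2 * pi * of_int k * u)) = 0" for k :: int
  proof (cases "k \<ge> 0")
    case True
    then show ?thesis using orth[of "nat k"] by simp
  next
    case False
    have "cos (2 * pi * of_int k * u) = cos (2 * pi * real (nat (- k)) * u)" for u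
    proof -
      have "2 * pi * of_int k * u = - (2 * pi * real (nat (- k)) * u)" using False by simp
      then show ?thesis by (simp only: cos_minus)
    qed
    then show ?thesis using orth[of "nat (-k)"] by simp
  qed
  \<comment> \<open>The identity 2 cos(kx) cos x = cos((k+1)x) + cos((k-1)x) trades a power of cos(2
    pi u) for a shift of k. The shift downwards leaves the natural numbers, hence the extension to
    integers in \<open>orth'\<close>.\<close>
  have powers: "integral {0..1} (\<lambda>u. d u * cos (2 * pi * of_int k * u) * cos (2 * pi * u) ^ j) = 0"
    for k :: int and j
  proof (induction j arbitrary: k)
    case 0
    then show ?case using orth'[of k] by simp
  next
    case (Suc j)
    have eq: "d u * cos (2 * pi * of_int k * u) * cos (2 * pi * u) ^ Suc j =
       (1/2) * (d u * cos (2 * pi * of_int (k+1) * u) * cos (2 * pi * u) ^ j +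
              d u * cos (2 * pi * of_int (k-1) * u) * cos (2 * pi * u) ^ j)" for u
    proof -
      have "cos (2 * pi * of_int (k+1) * u) + cos (2 * pi * of_int (k-1) * u)
          = 2 * cos (2 * pi * of_int k * u) * cos (2 * pi * u)"
        by (simp add: algebra_simps cos_add cos_diff)
      then show ?thesis
        by (simp only: distrib_left[symmetric] distrib_right[symmetric]) simp
    qed
    have int: "(\<lambda>u. d u * cos (2 * pi * of_int l * u) * cos (2 * pi * u) ^ j) integrable_on {0..1}" for l :: int
      by (intro integrable_continuous_real continuous_intros cont)
    show ?case
      unfolding eq by (simp only: integral_mult_right integral_add[OF int int] Suc.IH) simp
  qed
  have poly: "integral {0..1} (\<lambda>u. d u * p (cos (2 * pi * u))) = 0" if pf: "real_polynomial_function p" for p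
  proof -
    obtain a n where p: "p = (\<lambda>x. \<Sum>i\<le>n. a i * x ^ i)"
      using pf unfolding real_polynomial_function_iff_sum by blast
    have eq: "d u * p (cos (2 * pi * u)) = (\<Sum>i\<le>n. a i * (d u * cos (2 * pi * of_int 0 * u) * cos (2 * pi * u) ^ i))" for u
      by (simp add: p sum_distrib_left algebra_simps)
    show ?thesis
      unfolding eq
      by (subst integral_sum) (auto intro!: integrable_continuous_real continuous_intros cont
            simp del: of_int_0 simp add: powers)
  qed
  \<comment> \<open>By the symmetry about 1/2, d is a function D of cos(2 pi u). Polynomials
    approximate D uniformly on [-1, 1], and d is orthogonal to every polynomial in cos(2 pi
    u).\<close>
  define D where "D = (\<lambda>v. d (arccos v / (2 * pi)))"
  have "continuous_on {-1..1} D"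
    unfolding D_def
  proof (rule continuous_on_compose2[OF cont])
    show "continuous_on {-1..1} (\<lambda>v. arccos v / (2 * pi))"
      by (auto intro!: continuous_intros)
    show "(\<lambda>v. arccos v / (2 * pi)) ` {-1..1} \<subseteq> {0..1}"
    proof (rule image_subsetI)
      fix x :: real assume "x \<in> {-1..1}"
      then have "0 \<le> arccos x" "arccos x \<le> 2 * pi"
        using arccos_lbound[of x] arccos_ubound[of x] pi_gt_zero by auto
      then show "arccos x / (2 * pi) \<in> {0..1}" by simp
    qed
  qed
  have D: "D (cos (2 * pi * u)) = d u" if "u \<in> {0..1}" for u
  proof (cases "u \<le> 1/2")
    case True
    then show ?thesis using that by (simp add: D_def arccos_cos)
  next
    case False
    have "cos (2 * pi * u) = cos (2 * pi * (1 - u))"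
      using cos_2pi_minus[of "2 * pi * u"] by (simp add: algebra_simps)
    then have "D (cos (2 * pi * u)) = d (1 - u)"
      using False that by (simp add: D_def arccos_cos)
    then show ?thesis using sym that by simp
  qed
  have "compact (d ` {0..1})" using cont compact_Icc by (rule compact_continuous_image)
  then obtain M where M: "\<And>u. u \<in> {0..1} \<Longrightarrow> \<bar>d u\<bar> \<le> M"
    using compact_imp_bounded bounded_iff by (metis imageI real_norm_def)
  \<comment> \<open>Orthogonality allows a polynomial p close to D to be subtracted from one of the
    two factors d, so the square integral is at most M e.\<close>
  have int2: "\<bar>integral {0..1} (\<lambda>u. d u * d u)\<bar> \<le> M * e" if e: "e > 0" for e
  proof -
    obtain p where p: "real_polynomial_function p" "\<And>v. v \<in> {-1..1} \<Longrightarrow> \<bar>D v - p v\<bar> < e"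
      using Stone_Weierstrass_real_polynomial_function[OF compact_Icc \<open>continuous_on {-1..1} D\<close> e] by blast
    have cp: "continuous_on {0..1} (\<lambda>u. p (cos (2 * pi * u)))"
      using p(1) by (auto simp: real_polynomial_function_iff_sum intro!: continuous_intros)
    have "integral {0..1} (\<lambda>u. d u * d u) = integral {0..1} (\<lambda>u. d u * (d u - p (cos (2 * pi * u))))"
    proof -
      have "integral {0..1} (\<lambda>u. d u * (d u - p (cos (2 * pi * u)))) =
         integral {0..1} (\<lambda>u. d u * d u) - integral {0..1} (\<lambda>u. d u * p (cos (2 * pi * u)))"
        unfolding right_diff_distrib
        by (intro integral_diff integrable_continuous_real continuous_intros cont cp)
      then show ?thesis using poly[OF p(1)] by simp
    qed
    moreover have "norm (integral {0..1} (\<lambda>u. d u * (d u - p (cos (2 * pi * u))))) \<le> (M * e) * (1 - 0)"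
    proof (rule integral_bound)
      show "continuous_on {0..1} (\<lambda>u. d u * (d u - p (cos (2 * pi * u))))"
        by (intro continuous_intros cont cp)
      fix u :: real assume "u \<in> {0..1}"
      then have "\<bar>d u\<bar> * \<bar>d u - p (cos (2 * pi * u))\<bar> \<le> M * e"
        using M[of u] p(2)[of "cos (2 * pi * u)"] D[of u] by (intro mult_mono) auto
      then show "norm (d u * (d u - p (cos (2 * pi * u)))) \<le> M * e" by (simp add: abs_mult)
    qed auto
    ultimately show ?thesis by simp
  qed
  have "integral {0..1} (\<lambda>u. d u * d u) = 0"
  proof (rule ccontr)
    assume *: "integral {0..1} (\<lambda>u. d u * d u) \<noteq> 0" (is "?I \<noteq> 0")
    have "M \<ge> 0" using M[of 0] by auto
    have "\<bar>?I\<bar> \<le> M * (\<bar>?I\<bar> / (2 * (M + 1)))"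
      using * \<open>M \<ge> 0\<close> by (intro int2) auto
    also have "\<dots> = \<bar>?I\<bar> * (M / (2 * (M + 1)))" by simp
    also have "\<dots> < \<bar>?I\<bar> * 1"
      using * \<open>M \<ge> 0\<close> by (intro mult_strict_left_mono) (auto simp: field_simps)
    finally show False by simp
  qed
  then have "\<forall>u\<in>{0..1}. d u * d u = 0"
    by (subst (asm) integral_eq_0_iff) (auto intro!: continuous_intros cont)
  then show ?thesis using u by auto
qed

text \<open>The substitution v -> c v with c = sqrt(2 pi x) produces the standard normal density,
  whose characteristic function is exp(-s^2/2); evenness halves the value. A limit over natural N is
  what the sum over unit intervals in \<open>theta_functional_equation\<close> delivers.\<close>

lemma gauss_cosine_transform:
  fixes x t :: real
  assumes x: "x > 0"
  shows "((\<lambda>N. integral {0..real N} (\<lambda>v. exp (- pi * x * v\<^sup>2) * cos (2 * pi * t * v))) \<longlonglongrightarrow>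
           exp (- pi * t\<^sup>2 / x) / (2 * sqrt x))"
proof -
  define f where "f = (\<lambda>v. exp (- pi * x * v\<^sup>2) * cos (2 * pi * t * v))"
  define c where "c = sqrt (2 * pi * x)"
  have c: "c > 0" "c\<^sup>2 = 2 * pi * x" using x by (auto simp: c_def)
  define s where "s = 2 * pi * t / c"
  have int1: "integrable std_normal_distribution (\<lambda>v. iexp (s * v))"
    by (rule prob_space.integrable_iexp[OF prob_space_normal_density]) auto
  have "char std_normal_distribution s = complex_of_real (exp (- s\<^sup>2 / 2))"
    by (simp add: char_std_normal_distribution)
  then have "Re (LINT v|std_normal_distribution. iexp (s * v)) = exp (- s\<^sup>2 / 2)"
    unfolding char_def by (simp only: Re_complex_of_real)
  then have lint1: "(LINT v|std_normal_distribution. Re (iexp (s * v))) = exp (- s\<^sup>2 / 2)"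
    using integral_Re[OF int1] by simp
  have int2: "integrable std_normal_distribution (\<lambda>v. Re (iexp (s * v)))"
    using int1 by (rule integrable_Re)
  have int3: "integrable lborel (\<lambda>v. std_normal_density v * cos (s * v))"
    using int2 by (subst (asm) integrable_density) (auto simp: Re_exp)
  have lint3: "(LINT v|lborel. std_normal_density v * cos (s * v)) = exp (- s\<^sup>2 / 2)"
    using lint1 by (subst (asm) integral_density) (auto simp: Re_exp)
  have feq: "f v = sqrt (2 * pi) * (std_normal_density (0 + c * v) * cos (s * (0 + c * v)))" for v
    using c by (simp add: f_def std_normal_density_def s_def power_mult_distrib field_simps)
  have intf: "integrable lborel f"
    unfolding feq using c lborel_integrable_real_affine[OF int3, of c 0]
    by (intro integrable_mult_right) auto
  have lintf: "(LINT v|lborel. f v) = exp (- pi * t\<^sup>2 / x) / sqrt x"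
  proof -
    have "exp (- s\<^sup>2 / 2) = c * (LINT v|lborel. (std_normal_density (0 + c * v) * cos (s * (0 + c * v))))"
      using lborel_integral_real_affine[of c "\<lambda>v. std_normal_density v * cos (s * v)" 0] c lint3 by simp
    moreover have "(LINT v|lborel. f v) = sqrt (2 * pi) * (LINT v|lborel. (std_normal_density (0 + c * v) * cos (s * (0 + c * v))))"
      unfolding feq by (rule integral_mult_right_zero)
    ultimately have "(LINT v|lborel. f v) = sqrt (2 * pi) / c * exp (- s\<^sup>2 / 2)"
      using c by (simp add: field_simps)
    moreover have "- s\<^sup>2 / 2 = - pi * t\<^sup>2 / x"
      using c x by (simp add: s_def power_divide power_mult_distrib field_simps power2_eq_square)
    moreover have "sqrt (2 * pi) / c = 1 / sqrt x"
      using x by (simp add: c_def real_sqrt_mult)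
    ultimately show ?thesis by simp
  qed
  have even: "f (- v) = f v" for v by (simp add: f_def)
  have cf: "continuous_on A f" for A unfolding f_def by (intro continuous_intros)
  have half: "integral {0..real N} f = integral {- real N..real N} f / 2" for N
  proof -
    have "integral {- real N..real N} f = integral {- real N..0} f + integral {0..real N} f"
      by (rule Henstock_Kurzweil_Integration.integral_combine[symmetric])
         (auto intro!: integrable_continuous_real cf)
    moreover have "integral {- real N..0} f = integral {0..real N} f"
      using Henstock_Kurzweil_Integration.integral_reflect_real[of "real N" 0 f] even by simp
    ultimately show ?thesis by simp
  qed
  have "(\<lambda>N. LINT v|lborel. indicator {- real N..real N} v *\<^sub>R f v) \<longlonglongrightarrow> (LINT v|lborel. f v)"
  proof (rule integral_dominated_convergence[where w = "\<lambda>v. \<bar>f v\<bar>"])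
    show "integrable lborel (\<lambda>v. \<bar>f v\<bar>)" using intf by simp
    show "AE v in lborel. (\<lambda>N. indicator {- real N..real N} v *\<^sub>R f v) \<longlonglongrightarrow> f v"
    proof (rule AE_I2)
      fix v :: real
      have "\<forall>\<^sub>F N in sequentially. indicator {- real N..real N} v *\<^sub>R f v = f v"
      proof -
        obtain N0 :: nat where "\<bar>v\<bar> \<le> real N0" using real_arch_simple by blast
        then have "\<forall>N\<ge>N0. indicator {- real N..real N} v *\<^sub>R f v = f v"
          by (auto simp: indicator_def)
        then show ?thesis by (auto simp: eventually_sequentially)
      qed
      then show "(\<lambda>N. indicator {- real N..real N} v *\<^sub>R f v) \<longlonglongrightarrow> f v"
        by (rule tendsto_eventually)
    qed
  qed (use intf in \<open>auto simp: indicator_def intro!: AE_I2 borel_measurable_integrable\<close>)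
  moreover have "(LINT v|lborel. indicator {- real N..real N} v *\<^sub>R f v) = integral {- real N..real N} f" for N
    using borel_integrable_atLeastAtMost'[OF cf, of "- real N" "real N"]
    by (simp add: set_borel_integral_eq_integral(2)[symmetric] set_lebesgue_integral_def)
  ultimately have "(\<lambda>N. integral {- real N..real N} f / 2) \<longlonglongrightarrow> (LINT v|lborel. f v) / 2"
    by (intro tendsto_intros) auto
  then show ?thesis
    unfolding lintf half[symmetric] by (simp add: f_def mult.commute)
qed

text \<open>Jacobi's theta function, the sum of exp(-pi n^2 x) over all integers n, is
  \<open>1 + 2 * theta_tail x\<close>. Without the term n = 0 the sum decays at infinity, so it has
  a Mellin transform.\<close>

definition theta_tail :: "real \<Rightarrow> real" where
  "theta_tail x = (\<Sum>n. exp (- pi * (real (Suc n))\<^sup>2 * x))"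

text \<open>The Weierstrass test. Multiplication by the bounded function c preserves uniform
  convergence; c is a cosine when Fourier coefficients are computed, and 0 when only continuity of
  the sum is wanted.\<close>

lemma uniform_series_Icc:
  fixes a :: "nat \<Rightarrow> real \<Rightarrow> real"
  assumes cont: "\<And>n. continuous_on {p..q} (a n)"
    and bound: "\<And>n u. u \<in> {p..q} \<Longrightarrow> \<bar>a n u\<bar> \<le> M n" and M: "summable M"
    and c: "continuous_on {p..q} c"
  shows "continuous_on {p..q} (\<lambda>u. \<Sum>n. a n u)"
    and "(\<lambda>n. integral {p..q} (\<lambda>u. a n u * c u)) sums integral {p..q} (\<lambda>u. (\<Sum>n. a n u) * c u)"
proof -
  have unif: "uniform_limit {p..q} (\<lambda>n u. \<Sum>i<n. a i u) (\<lambda>u. \<Sum>i. a i u) sequentially"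
    using bound M by (intro Weierstrass_m_test) auto
  show cont': "continuous_on {p..q} (\<lambda>u. \<Sum>n. a n u)"
    by (rule uniform_limit_theorem[OF _ unif]) (auto intro!: always_eventually continuous_on_sum cont)
  have "compact (c ` {p..q})" using c compact_Icc by (rule compact_continuous_image)
  then have bc: "bounded (c ` {p..q})" by (rule compact_imp_bounded)
  have "compact ((\<lambda>u. \<Sum>n. a n u) ` {p..q})" using cont' compact_Icc by (rule compact_continuous_image)
  then have ba: "bounded ((\<lambda>u. \<Sum>n. a n u) ` {p..q})" by (rule compact_imp_bounded)
  have unif': "uniform_limit {p..q} (\<lambda>n u. (\<Sum>i<n. a i u) * c u) (\<lambda>u. (\<Sum>i. a i u) * c u) sequentially"
    by (rule bounded_bilinear.bounded_uniform_limit[OF bounded_bilinear_mult unif uniform_limit_const bc ba])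
  show "(\<lambda>n. integral {p..q} (\<lambda>u. a n u * c u)) sums integral {p..q} (\<lambda>u. (\<Sum>n. a n u) * c u)"
  proof (rule uniform_limit_integral[OF unif'])
    fix I J
    assume I: "\<And>n. ((\<lambda>u. (\<Sum>i<n. a i u) * c u) has_integral I n) {p..q}"
      and J: "((\<lambda>u. (\<Sum>i. a i u) * c u) has_integral J) {p..q}" and lim: "I \<longlonglongrightarrow> J"
    have "I n = (\<Sum>i<n. integral {p..q} (\<lambda>u. a i u * c u))" for n
    proof -
      have "I n = integral {p..q} (\<lambda>u. (\<Sum>i<n. a i u) * c u)"
        using I[of n] by (simp add: integral_unique)
      also have "\<dots> = integral {p..q} (\<lambda>u. \<Sum>i<n. a i u * c u)"
        by (simp add: sum_distrib_right)
      also have "\<dots> = (\<Sum>i<n. integral {p..q} (\<lambda>u. a i u * c u))"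
        by (intro integral_sum) (auto intro!: integrable_continuous_real continuous_intros cont c)
      finally show ?thesis .
    qed
    then have "I = (\<lambda>n. \<Sum>i<n. integral {p..q} (\<lambda>u. a i u * c u))" by (rule ext)
    then show ?thesis using lim J unfolding sums_def by (simp add: integral_unique)
  qed (auto intro!: continuous_intros cont c)
qed

text \<open>From n <= n^2 <= v^2: the geometric majorant holds at integers and, just as well, at all
  points to the right of n, which the periodised Gaussian requires.\<close>

lemma gauss_term_le:
  assumes "x > 0" "real n \<le> v"
  shows "exp (- pi * x * v\<^sup>2) \<le> exp (- pi * x) ^ n"
proof -
  have "real n \<le> (real n)\<^sup>2"
    by (metis le_square of_nat_le_iff of_nat_mult power2_eq_square)
  also have "\<dots> \<le> v\<^sup>2" using assms by (intro power_mono) auto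
  finally have "- pi * x * v\<^sup>2 \<le> real n * (- pi * x)"
    using assms by (simp add: mult_left_mono)
  then show ?thesis by (simp add: exp_of_nat_mult[symmetric] del: exp_of_nat_mult)
qed

lemma summable_gauss_bound: "x > 0 \<Longrightarrow> summable (\<lambda>n. exp (- pi * x) ^ n)"
  by (rule summable_geometric) auto

lemma summable_theta_tail: "x > 0 \<Longrightarrow> summable (\<lambda>n. exp (- pi * (real (Suc n))\<^sup>2 * x))"
  by (rule summable_comparison_test'[OF summable_gauss_bound[of x], of 0])
     (use gauss_term_le[of x _ "real (Suc _)"] in \<open>auto simp: mult_ac\<close>)

lemma integral_cos_period:
  "integral {0..1} (\<lambda>u. cos (2 * pi * of_int j * u)) = (if j = 0 then 1 else 0)"
proof (cases "j = 0")
  case False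
  define F where "F = (\<lambda>u. sin (2 * pi * of_int j * u) / (2 * pi * of_int j))"
  have "((\<lambda>u. cos (2 * pi * of_int j * u)) has_integral (F 1 - F 0)) {0..1}"
    by (rule fundamental_theorem_of_calculus)
       (use False in \<open>auto simp: F_def has_real_derivative_iff_has_vector_derivative[symmetric]
           intro!: derivative_eq_intros\<close>)
  moreover have "F 1 = 0" using sin_integer_2pi[of "of_int j"] by (simp add: F_def)
  ultimately show ?thesis using False by (simp add: F_def integral_unique)
qed simp

lemma integral_cos_cos_period:
  fixes k m :: nat assumes "k > 0"
  shows "integral {0..1} (\<lambda>u. 2 * cos (2 * pi * real k * u) * cos (2 * pi * real m * u)) = (if k = m then 1 else 0)"
proof -
  have eq: "2 * cos (2 * pi * real k * u) * cos (2 * pi * real m * u) =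
      cos (2 * pi * of_int (int k - int m) * u) + cos (2 * pi * of_int (int k + int m) * u)" for u
    by (simp add: algebra_simps cos_add cos_diff)
  show ?thesis
    unfolding eq
    by (subst integral_add)
       (use assms in \<open>auto intro!: integrable_continuous_real continuous_intros
             simp del: of_int_diff of_int_add simp add: integral_cos_period\<close>)
qed

text \<open>Poisson summation for the Gaussian. The periodisation \<open>g\<close> and the cosine
  series \<open>h\<close> are continuous on [0, 1], symmetric about 1/2 and have the same cosine
  coefficients, so \<open>cosine_coefficients_zero\<close> makes them equal; the point u = 0 gives
  the claim.\<close>

theorem theta_functional_equation:
  assumes x: "x > 0"
  shows "1 + 2 * theta_tail x = (1 + 2 * theta_tail (1 / x)) / sqrt x"
proof -
  define f where "f = (\<lambda>v. exp (- pi * x * v\<^sup>2))"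
  have cf: "continuous_on A f" for A unfolding f_def by (intro continuous_intros)
  \<comment> \<open>f is even, so f(n + 1 - u) = f(u - (n + 1)): the two summands together run over
    u + m for all integers m.\<close>
  define a where "a = (\<lambda>n u. f (real n + u) + f (real n + 1 - u))"
  define M where "M = (\<lambda>n. 2 * exp (- pi * x) ^ n)"
  have ca: "continuous_on {0..1} (a n)" for n
    unfolding a_def f_def by (intro continuous_intros)
  have aM: "\<bar>a n u\<bar> \<le> M n" if "u \<in> {0..1}" for n u
  proof -
    have "f (real n + u) \<le> exp (- pi * x) ^ n" "f (real n + 1 - u) \<le> exp (- pi * x) ^ n"
      unfolding f_def by (rule gauss_term_le; use x that in simp)+
    moreover have "f (real n + u) > 0" "f (real n + 1 - u) > 0" by (auto simp: f_def)
    ultimately show ?thesis by (simp add: a_def M_def)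
  qed
  have sM: "summable M" unfolding M_def using x by (intro summable_mult summable_gauss_bound)
  define e where "e = (\<lambda>k. exp (- pi * (real (Suc k))\<^sup>2 * (1/x)))"
  have se: "summable e" unfolding e_def using x by (intro summable_theta_tail) auto
  define b where "b = (\<lambda>k u. e k * (2 * cos (2 * pi * real (Suc k) * u)))"
  have cb: "continuous_on {0..1} (b n)" for n
    unfolding b_def by (intro continuous_intros)
  have bM: "\<bar>b k u\<bar> \<le> 2 * e k" for k u
  proof -
    have "\<bar>cos (2 * pi * real (Suc k) * u)\<bar> \<le> 1" by simp
    then have "e k * \<bar>cos (2 * pi * real (Suc k) * u)\<bar> \<le> e k * 1"
      by (intro mult_left_mono) (auto simp: e_def)
    moreover have "e k > 0" by (simp add: e_def)
    ultimately show ?thesis by (simp add: b_def abs_mult)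
  qed
  have se2: "summable (\<lambda>k. 2 * e k)" using se by (rule summable_mult)
  define g where "g = (\<lambda>u. \<Sum>n. a n u)"
  define h where "h = (\<lambda>u. (1 + (\<Sum>k. b k u)) / sqrt x)"
  have cg: "continuous_on {0..1} g"
    unfolding g_def by (rule uniform_series_Icc(1)[OF ca aM sM continuous_on_const[of _ 0]])
  have cB: "continuous_on {0..1} (\<lambda>u. \<Sum>k. b k u)"
    by (rule uniform_series_Icc(1)[OF cb bM se2 continuous_on_const[of _ 0]])
  then have ch: "continuous_on {0..1} h"
    unfolding h_def using x by (intro continuous_intros) auto
  \<comment> \<open>Periodicity of the cosine unfolds the periodisation. Both summands of
    \<open>a n\<close> contribute the integral of f times the cosine over [n, n + 1], so the series
    adds up to twice the integral over the half-line.\<close>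
  have gk: "integral {0..1} (\<lambda>u. g u * cos (2 * pi * real k * u)) = exp (- pi * (real k)\<^sup>2 / x) / sqrt x" for k
  proof -
    define c where "c = (\<lambda>u. cos (2 * pi * real k * u))"
    have cc: "continuous_on A c" for A unfolding c_def by (intro continuous_intros)
    have per: "c (real n + u) = c u" for n u
    proof -
      have "2 * pi * real k * (real n + u) = 2 * pi * real k * u + real (2 * k * n) * pi"
        by (simp add: algebra_simps)
      then show ?thesis unfolding c_def by (simp add: cos_add cos_npi del: of_nat_mult)
    qed
    have per': "c (real n + 1 - u) = c u" for n u
      using per[of "Suc n" "-u"] by (simp add: c_def algebra_simps)
    have i1: "((\<lambda>u. f (real n + u) * c u) has_integral integral {real n..real n + 1} (\<lambda>v. f v * c v)) {0..1}" for n
    proof -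
      have "((\<lambda>v. f v * c v) has_integral integral {real n..real n + 1} (\<lambda>v. f v * c v)) (cbox (real n) (real n + 1))"
        by (auto intro!: integrable_integral integrable_continuous_real continuous_intros cf cc)
      from has_integral_affinity[OF this, of 1 "real n"] show ?thesis
        by (simp add: per add.commute[of _ "real n"] image_affinity_atLeastAtMost)
    qed
    have i2: "((\<lambda>u. f (real n + 1 - u) * c u) has_integral integral {real n..real n + 1} (\<lambda>v. f v * c v)) {0..1}" for n
    proof -
      have "((\<lambda>v. f v * c v) has_integral integral {real n..real n + 1} (\<lambda>v. f v * c v)) (cbox (real n) (real n + 1))"
        by (auto intro!: integrable_integral integrable_continuous_real continuous_intros cf cc)
      from has_integral_affinity[OF this, of "-1" "real n + 1"] show ?thesis
        using per' by (simp add: algebra_simps)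
    qed
    have ia: "integral {0..1} (\<lambda>u. a n u * c u) = 2 * integral {real n..real n + 1} (\<lambda>v. f v * c v)" for n
      using has_integral_add[OF i1[of n] i2[of n]] by (simp add: a_def distrib_right integral_unique)
    have partial: "(\<Sum>n<N. integral {real n..real n + 1} (\<lambda>v. f v * c v)) = integral {0..real N} (\<lambda>v. f v * c v)" for N
    proof (induction N)
      case (Suc N)
      have "integral {0..real N} (\<lambda>v. f v * c v) + integral {real N..real N + 1} (\<lambda>v. f v * c v) = integral {0..real N + 1} (\<lambda>v. f v * c v)"
        by (rule Henstock_Kurzweil_Integration.integral_combine)
           (auto intro!: integrable_continuous_real continuous_intros cf cc)
      then show ?case using Suc by (simp add: add.commute)
    qed simp
    have "(\<lambda>n. integral {0..1} (\<lambda>u. a n u * c u)) sums integral {0..1} (\<lambda>u. g u * c u)"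
      unfolding g_def by (rule uniform_series_Icc(2)[OF ca aM sM cc])
    then have "(\<lambda>N. 2 * integral {0..real N} (\<lambda>v. f v * c v)) \<longlonglongrightarrow> integral {0..1} (\<lambda>u. g u * c u)"
      unfolding sums_def ia by (simp add: sum_distrib_left[symmetric] partial)
    moreover have "(\<lambda>N. 2 * integral {0..real N} (\<lambda>v. f v * c v)) \<longlonglongrightarrow> 2 * (exp (- pi * (real k)\<^sup>2 / x) / (2 * sqrt x))"
      unfolding f_def c_def by (intro tendsto_mult_left gauss_cosine_transform x)
    ultimately have "integral {0..1} (\<lambda>u. g u * c u) = 2 * (exp (- pi * (real k)\<^sup>2 / x) / (2 * sqrt x))"
      by (rule LIMSEQ_unique)
    then show ?thesis by (simp add: c_def)
  qed
  have hk: "integral {0..1} (\<lambda>u. h u * cos (2 * pi * real m * u)) = exp (- pi * (real m)\<^sup>2 / x) / sqrt x" for m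
  proof -
    define c where "c = (\<lambda>u. cos (2 * pi * real m * u))"
    have cc: "continuous_on A c" for A unfolding c_def by (intro continuous_intros)
    have ib: "integral {0..1} (\<lambda>u. b k u * c u) = (if Suc k = m then e k else 0)" for k
    proof -
      have "integral {0..1} (\<lambda>u. b k u * c u) = e k * integral {0..1} (\<lambda>u. 2 * cos (2 * pi * real (Suc k) * u) * cos (2 * pi * real m * u))"
        unfolding b_def c_def by (subst integral_mult_right[symmetric]) (simp add: mult_ac)
      then show ?thesis by (subst (asm) integral_cos_cos_period) auto
    qed
    have "(\<lambda>k. integral {0..1} (\<lambda>u. b k u * c u)) sums integral {0..1} (\<lambda>u. (\<Sum>k. b k u) * c u)"
      by (rule uniform_series_Icc(2)[OF cb bM se2 cc])
    then have *: "(\<lambda>k. if Suc k = m then e k else 0) sums integral {0..1} (\<lambda>u. (\<Sum>k. b k u) * c u)"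
      unfolding ib .
    have "integral {0..1} (\<lambda>u. (\<Sum>k. b k u) * c u) = (if m = 0 then 0 else e (m - 1))"
    proof (cases m)
      case 0
      then show ?thesis using * by (simp add: sums_0 sums_unique2)
    next
      case (Suc m')
      then have "(\<lambda>k. if k = m' then e k else 0) sums integral {0..1} (\<lambda>u. (\<Sum>k. b k u) * c u)"
        using * by simp
      then show ?thesis using sums_single[of m' e] Suc sums_unique2 by auto
    qed
    moreover have "integral {0..1} c = (if m = 0 then 1 else 0)"
      using integral_cos_period[of "int m"] by (simp add: c_def)
    moreover have "integral {0..1} (\<lambda>u. h u * c u) = (integral {0..1} c + integral {0..1} (\<lambda>u. (\<Sum>k. b k u) * c u)) / sqrt x"
    proof -
      have "integral {0..1} (\<lambda>u. h u * c u) = integral {0..1} (\<lambda>u. (c u + (\<Sum>k. b k u) * c u) / sqrt x)"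
        by (simp add: h_def algebra_simps add_divide_distrib)
      also have "\<dots> = integral {0..1} (\<lambda>u. c u + (\<Sum>k. b k u) * c u) / sqrt x"
        by (rule integral_divide)
      also have "integral {0..1} (\<lambda>u. c u + (\<Sum>k. b k u) * c u) = integral {0..1} c + integral {0..1} (\<lambda>u. (\<Sum>k. b k u) * c u)"
        by (intro integral_add integrable_continuous_real continuous_intros cc cB)
      finally show ?thesis .
    qed
    ultimately have "integral {0..1} (\<lambda>u. h u * c u) = exp (- pi * (real m)\<^sup>2 / x) / sqrt x"
      by (cases m) (auto simp: e_def)
    then show ?thesis by (simp add: c_def)
  qed
  have "g 0 - h 0 = 0"
  proof (rule cosine_coefficients_zero[where d = "\<lambda>u. g u - h u"])
    show "continuous_on {0..1} (\<lambda>u. g u - h u)" by (intro continuous_intros cg ch)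
    fix u :: real assume u: "u \<in> {0..1}"
    have "g (1 - u) = g u" by (simp add: g_def a_def algebra_simps)
    moreover have "b k (1 - u) = b k u" for k
    proof -
      have "2 * pi * real (Suc k) * (1 - u) = real (2 * Suc k) * pi - 2 * pi * real (Suc k) * u"
        by (simp add: algebra_simps)
      then show ?thesis unfolding b_def by (simp add: cos_diff cos_npi sin_npi del: of_nat_mult of_nat_Suc)
    qed
    ultimately show "g (1 - u) - h (1 - u) = g u - h u" by (simp add: h_def)
  next
    fix k :: nat
    have "integral {0..1} (\<lambda>u. g u * cos (2 * pi * real k * u) - h u * cos (2 * pi * real k * u)) = 0"
      by (subst integral_diff) (auto intro!: integrable_continuous_real continuous_intros cg ch simp: gk hk)
    then show "integral {0..1} (\<lambda>u. (g u - h u) * cos (2 * pi * real k * u)) = 0"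
      by (simp add: left_diff_distrib)
  qed auto
  \<comment> \<open>At u = 0 the n-th term is F n + F (Suc n): the value F 0 = 1 occurs once and
    every later one twice.\<close>
  moreover have "g 0 = 1 + 2 * theta_tail x"
  proof -
    define F where "F = (\<lambda>n. exp (- pi * (real n)\<^sup>2 * x))"
    have F: "summable (\<lambda>n. F (Suc n))" unfolding F_def using summable_theta_tail[OF x] .
    then have "summable F" by (subst (asm) summable_Suc_iff)
    have "g 0 = (\<Sum>n. F n + F (Suc n))"
      unfolding g_def a_def f_def F_def by (intro suminf_cong) (simp add: mult_ac)
    also have "\<dots> = (\<Sum>n. F n) + (\<Sum>n. F (Suc n))"
      using \<open>summable F\<close> F by (rule suminf_add[symmetric])
    also have "(\<Sum>n. F n) = F 0 + (\<Sum>n. F (Suc n))"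
      using suminf_split_head[OF \<open>summable F\<close>] by simp
    finally show ?thesis unfolding theta_tail_def F_def by simp
  qed
  moreover have "h 0 = (1 + 2 * theta_tail (1/x)) / sqrt x"
  proof -
    have "(\<Sum>k. b k 0) = (\<Sum>k. 2 * e k)" by (simp add: b_def mult_ac)
    also have "\<dots> = 2 * (\<Sum>k. e k)" using se by (rule suminf_mult)
    finally show ?thesis by (simp add: h_def theta_tail_def e_def)
  qed
  ultimately show ?thesis by simp
qed

section \<open>The Mellin transform of the theta function\<close>

lemma theta_tail_continuous: "continuous_on {0<..} theta_tail"
proof -
  have "continuous_on {p..q} theta_tail" if "p > 0" for p q :: real
    unfolding theta_tail_def
  proof (rule uniform_series_Icc(1)[where M = "\<lambda>n. exp (- pi * (real (Suc n))\<^sup>2 * p)" and c = "\<lambda>_. 0"])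
    show "summable (\<lambda>n. exp (- pi * (real (Suc n))\<^sup>2 * p))" by (rule summable_theta_tail[OF that])
  qed (use that in \<open>auto intro!: continuous_intros mult_left_mono\<close>)
  then have "isCont theta_tail x" if "x > 0" for x
    using that by (intro continuous_on_interior[of "{x/2..2*x}"]) (auto simp: interior_atLeastAtMost_real)
  then show ?thesis by (auto intro: continuous_at_imp_continuous_on)
qed

lemma theta_tail_nonneg: "x > 0 \<Longrightarrow> theta_tail x \<ge> 0"
  unfolding theta_tail_def by (rule suminf_nonneg[OF summable_theta_tail]) auto

text \<open>The decay exp(-x) at x = exp u beats exp(-m u) for every m, since exp x >= x^m / m!.
  Decay faster than any exponential in u is what makes the half-line Mellin integral entire.\<close>

lemma theta_tail_rapid_decay: "\<exists>C. \<forall>u\<ge>0. \<bar>theta_tail (exp u)\<bar> \<le> C * exp (- real m * u)"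
proof -
  define q where "q = exp (- pi)"
  have q: "0 < q" "q < 1" by (auto simp: q_def)
  have bound: "theta_tail x \<le> exp (- x) / (1 - q)" if x: "x \<ge> 1" for x
  proof -
    have "exp (- pi * (real (Suc n))\<^sup>2 * x) \<le> exp (- x) * q ^ n" for n
    proof -
      have "exp (- pi * (real (Suc n))\<^sup>2 * x) \<le> exp (- pi * x) ^ Suc n"
        using gauss_term_le[of x "Suc n" "real (Suc n)"] x by (simp add: mult_ac)
      also have "\<dots> = exp (- pi * x) * exp (- pi * x) ^ n" by simp
      also have "\<dots> \<le> exp (- x) * q ^ n"
      proof (intro mult_mono power_mono)
        show "exp (- pi * x) \<le> exp (- x)" using x pi_ge_two by simp
        show "exp (- pi * x) \<le> q" using x by (simp add: q_def)
      qed (use q in auto)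
      finally show ?thesis .
    qed
    moreover have "summable (\<lambda>n. exp (- x) * q ^ n)" using q by (intro summable_mult summable_geometric) auto
    ultimately have "theta_tail x \<le> (\<Sum>n. exp (- x) * q ^ n)"
      unfolding theta_tail_def using x by (intro suminf_le summable_theta_tail) auto
    also have "\<dots> = exp (- x) / (1 - q)"
      using q by (subst suminf_mult) (auto intro!: summable_geometric simp: suminf_geometric)
    finally show ?thesis .
  qed
  have "\<bar>theta_tail (exp u)\<bar> \<le> (fact m / (1 - q)) * exp (- real m * u)" if "u \<ge> 0" for u :: real
  proof -
    have "exp u ^ m / fact m \<le> exp (exp u)"
    proof -
      have s: "summable (\<lambda>n. exp u ^ n / fact n)"
        using summable_exp[of "exp u"] by (simp add: divide_inverse mult_ac)
      have "exp u ^ m / fact m = (\<Sum>n\<in>{m}. exp u ^ n / fact n)" by simp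
      also have "\<dots> \<le> (\<Sum>n. exp u ^ n / fact n)" by (rule sum_le_suminf[OF s]) auto
      also have "\<dots> = exp (exp u)" by (simp add: exp_def divide_inverse mult_ac)
      finally show ?thesis .
    qed
    then have "exp (- exp u) \<le> fact m * exp (- real m * u)"
      by (simp add: exp_minus field_simps exp_of_nat_mult exp_of_nat2_mult)
    then have "exp (- exp u) / (1 - q) \<le> fact m * exp (- real m * u) / (1 - q)"
      using q by (intro divide_right_mono) auto
    then show ?thesis
      using bound[of "exp u"] theta_tail_nonneg[of "exp u"] that by simp
  qed
  then show ?thesis by blast
qed

text \<open>Euler's integral after t = exp u, transformed separately for real and imaginary part. In
  the variable u the inversion x -> 1/x of the theta function becomes the reflection u -> -u, and
  scaling becomes translation.\<close>

lemma Gamma_exp_integral: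
  assumes z: "Re z > 0"
  shows "has_bochner_integral lborel (\<lambda>u. exp (of_real u * z - of_real (exp u))) (Gamma z)"
proof -
  define F where "F = (\<lambda>t. complex_of_real t powr (z - 1) / of_real (exp t))"
  define E where "E = (\<lambda>u. exp (of_real u * z - of_real (exp u)))"
  have aF: "F absolutely_integrable_on {0<..}"
    unfolding F_def using z by (rule absolutely_integrable_Gamma_integral')
  have iF: "(F has_integral Gamma z) {0<..}"
    unfolding F_def using z by (rule Gamma_integral_complex')
  have EF: "of_real \<bar>exp u\<bar> * F (exp u) = E u" for u
  proof -
    have "of_real (exp u) powr (z - 1) = exp ((z - 1) * of_real u)"
      by (simp add: powr_def Ln_of_real)
    moreover have "exp (of_real u) * exp ((z - 1) * of_real u) = exp (z * of_real u)"
      by (simp add: exp_add[symmetric] algebra_simps)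
    ultimately show ?thesis
            using \<open>exp (of_real u) * exp ((z - 1) * of_real u) = exp (z * of_real u)\<close>
      by (simp add: F_def E_def exp_of_real[symmetric] exp_diff mult.commute)
  qed
  have mE: "E \<in> borel_measurable borel"
    unfolding E_def by (intro borel_measurable_continuous_onI continuous_intros)
  have part: "integrable lborel (\<lambda>u. L (E u)) \<and> (LINT u|lborel. L (E u)) = L (Gamma z)"
    if L: "L = Re \<or> L = Im" for L
  proof -
    have bl: "bounded_linear L" using L bounded_linear_Re bounded_linear_Im by auto
    have ab: "(\<lambda>t. L (F t)) absolutely_integrable_on {0<..}"
      using absolutely_integrable_linear[OF aF bl] by (simp add: o_def)
    have "integral {0<..} (\<lambda>t. L (F t)) = L (Gamma z)"
      using has_integral_linear[OF iF bl] by (simp add: o_def integral_unique)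
    moreover have "(\<lambda>u. \<bar>exp u\<bar> * L (F (exp u))) absolutely_integrable_on UNIV \<and>
          integral UNIV (\<lambda>u. \<bar>exp u\<bar> * L (F (exp u))) = L (Gamma z) \<longleftrightarrow>
          (\<lambda>t. L (F t)) absolutely_integrable_on (exp ` UNIV) \<and> integral (exp ` UNIV) (\<lambda>t. L (F t)) = L (Gamma z)"
      by (rule has_absolute_integral_change_of_variables_1') (auto intro!: derivative_eq_intros injI)
    moreover have "range exp = {0::real<..}"
      using exp_ln by (auto simp: image_iff) (metis exp_ln)
    ultimately have *: "(\<lambda>u. \<bar>exp u\<bar> * L (F (exp u))) absolutely_integrable_on UNIV"
        "integral UNIV (\<lambda>u. \<bar>exp u\<bar> * L (F (exp u))) = L (Gamma z)"
      using ab by auto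
    moreover have eq: "\<bar>exp u\<bar> * L (F (exp u)) = L (E u)" for u
      using L by (auto simp: EF[symmetric])
    ultimately have **: "integrable lebesgue (\<lambda>u. L (E u))" "integral UNIV (\<lambda>u. L (E u)) = L (Gamma z)"
      by (auto simp: set_integrable_def)
    have mL: "(\<lambda>u. L (E u)) \<in> borel_measurable lborel"
      using mE L by auto
    have i: "integrable lborel (\<lambda>u. L (E u))"
      using **(1) integrable_completion[OF mL] by simp
    then have "(LINT u|lborel. L (E u)) = integral UNIV (\<lambda>u. L (E u))"
      using has_integral_integral_lborel[OF i] by (simp add: integral_unique)
    then show ?thesis using i ** by simp
  qed
  have "integrable lborel E"
  proof -
    have "integrable lborel (\<lambda>u. complex_of_real (Re (E u)) + \<i> * complex_of_real (Im (E u)))"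
      using part[of Re] part[of Im]
      by (intro Bochner_Integration.integrable_add integrable_mult_right integrable_of_real) auto
    then show ?thesis by (simp add: complex_eq[symmetric])
  qed
  moreover have "integral\<^sup>L lborel E = Gamma z"
    using part[of Re] part[of Im] integral_Re[OF calculation] integral_Im[OF calculation]
    by (auto intro: complex_eqI)
  ultimately show ?thesis unfolding E_def by (simp add: has_bochner_integral_iff)
qed

lemma Gamma_exp_integral_scaled:
  assumes z: "Re z > 0" and c: "c > 0"
  shows "has_bochner_integral lborel (\<lambda>u. of_real (exp (- c * exp u)) * exp (of_real u * z)) (exp (- z * of_real (ln c)) * Gamma z)"
proof -
  have "has_bochner_integral lborel (\<lambda>u. exp (of_real (ln c + 1 * u) * z - of_real (exp (ln c + 1 * u)))) (Gamma z /\<^sub>R \<bar>1\<bar>)"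
    using Gamma_exp_integral[OF z] by (rule iffD1[OF lborel_has_bochner_integral_real_affine_iff, rotated]) auto
  then have "has_bochner_integral lborel (\<lambda>u. exp (of_real (ln c + u) * z - of_real (exp (ln c + u)))) (Gamma z)"
    by simp
  then have "has_bochner_integral lborel (\<lambda>u. exp (- z * of_real (ln c)) * exp (of_real (ln c + u) * z - of_real (exp (ln c + u)))) (exp (- z * of_real (ln c)) * Gamma z)"
    by (rule has_bochner_integral_mult_right)
  moreover have "exp (- z * of_real (ln c)) * exp (of_real (ln c + u) * z - of_real (exp (ln c + u))) = of_real (exp (- c * exp u)) * exp (of_real u * z)" for u
  proof -
    have "exp (ln c + u) = c * exp u" using c by (simp add: exp_add)
    then have "exp (- z * of_real (ln c)) * exp (of_real (ln c + u) * z - of_real (exp (ln c + u)))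
        = exp (- z * of_real (ln c) + (of_real (ln c + u) * z - of_real (c * exp u)))"
      by (simp only: exp_add)
    also have "- z * of_real (ln c) + (of_real (ln c + u) * z - of_real (c * exp u)) = of_real (- c * exp u) + of_real u * z"
      by (simp add: algebra_simps)
    finally show ?thesis by (simp only: exp_add exp_of_real)
  qed
  ultimately show ?thesis by simp
qed

text \<open>Termwise integration of the theta series gives pi^-z Gamma(z) times the Dirichlet series
  at 2z. The norm of each term is the same integrand at Re z, so the integrals of the norms add up
  to a multiple of the series of n^(-2 Re z); this is the origin of the bound 1/2. Writing the
  factor as \<open>rGamma\<close> keeps the right-hand side meaningful for continuation.\<close>

lemma theta_tail_Mellin:
  assumes z: "Re z > 1/2"
  shows "integrable lborel (\<lambda>u. of_real (theta_tail (exp u)) * exp (of_real u * z))"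
    and "(\<lambda>n. of_nat (Suc n) powr (- 2 * z)) sums
          (of_real pi powr z * rGamma z * (LINT u|lborel. of_real (theta_tail (exp u)) * exp (of_real u * z)))"
proof -
  define c where "c = (\<lambda>n. pi * (real (Suc n))\<^sup>2)"
  have c: "c n > 0" for n by (simp add: c_def)
  define f where "f = (\<lambda>n u. of_real (exp (- c n * exp u)) * exp (of_real u * z))"
  have f: "has_bochner_integral lborel (f n) (exp (- z * of_real (ln (c n))) * Gamma z)" for n
    unfolding f_def using z by (intro Gamma_exp_integral_scaled c) auto
  have powr: "exp (- w * of_real (ln (c n))) = of_real pi powr (- w) * of_nat (Suc n) powr (- 2 * w)" for n and w :: complex
  proof -
    have "ln (c n) = ln pi + 2 * ln (real (Suc n))"
      by (simp add: c_def ln_mult ln_realpow del: of_nat_Suc)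
    moreover have "of_nat (Suc n) powr (- 2 * w) = exp (- 2 * w * of_real (ln (real (Suc n))))"
      using Ln_of_real[of "real (Suc n)"] by (simp add: powr_def del: of_nat_Suc)
    moreover have "of_real pi powr (- w) = exp (- w * of_real (ln pi))"
      by (simp add: powr_def Ln_of_real)
    ultimately show ?thesis by (simp add: exp_add[symmetric] algebra_simps)
  qed
  have norm_f: "norm (f n u) = Re (of_real (exp (- c n * exp u)) * exp (of_real u * of_real (Re z)))" for n u
    by (simp add: f_def norm_mult norm_exp_eq_Re Re_exp)
  have intnorm: "(LINT u|lborel. norm (f n u)) = Re (exp (- of_real (Re z) * of_real (ln (c n))) * Gamma (of_real (Re z)))" for n
  proof -
    have "has_bochner_integral lborel (\<lambda>u. complex_of_real (exp (- c n * exp u)) * exp (of_real u * of_real (Re z)))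
       (exp (- of_real (Re z) * of_real (ln (c n))) * Gamma (of_real (Re z)))"
      using z by (intro Gamma_exp_integral_scaled c) auto
    then show ?thesis unfolding norm_f
      by (subst integral_Re) (auto simp: has_bochner_integral_iff)
  qed
  have sN: "summable (\<lambda>n. real (Suc n) powr (- 2 * Re z))"
  proof -
    have "summable (\<lambda>n. real n powr (- 2 * Re z))" using z by (subst summable_real_powr_iff) auto
    then show ?thesis by (subst summable_Suc_iff)
  qed
  have intnorm': "(LINT u|lborel. norm (f n u)) = Re (of_real pi powr (- of_real (Re z)) * Gamma (of_real (Re z))) * real (Suc n) powr (- 2 * Re z)" for n
  proof -
    have 1: "of_nat (Suc n) powr (- 2 * complex_of_real (Re z)) = of_real (real (Suc n) powr (- 2 * Re z))"
      using powr_of_real[of "real (Suc n)" "- 2 * Re z"] by simp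
    have 2: "complex_of_real pi powr (- complex_of_real (Re z)) = of_real (pi powr (- Re z))"
      using powr_of_real[of pi "- Re z"] by simp
    show ?thesis
      unfolding intnorm powr 1 2 Gamma_complex_of_real of_real_mult[symmetric] Re_complex_of_real by simp
  qed
  have s1: "summable (\<lambda>n. LINT u|lborel. norm (f n u))"
    unfolding intnorm' by (rule summable_mult[OF sN])
  have s2: "AE u in lborel. summable (\<lambda>n. norm (f n u))"
  proof (rule AE_I2)
    fix u :: real
    have "summable (\<lambda>n. exp (- pi * (real (Suc n))\<^sup>2 * exp u) * exp (u * Re z))"
      by (intro summable_mult2 summable_theta_tail) auto
    then show "summable (\<lambda>n. norm (f n u))"
      by (simp add: f_def norm_mult norm_exp_eq_Re c_def)
  qed
  have fi: "integrable lborel (f n)" for n using f by (simp add: has_bochner_integral_iff)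
  have sumf: "(\<Sum>n. f n u) = of_real (theta_tail (exp u)) * exp (of_real u * z)" for u
  proof -
    have "(\<lambda>n. exp (- pi * (real (Suc n))\<^sup>2 * exp u)) sums theta_tail (exp u)"
      unfolding theta_tail_def by (intro summable_sums summable_theta_tail) auto
    then have "(\<lambda>n. complex_of_real (exp (- pi * (real (Suc n))\<^sup>2 * exp u)) * exp (of_real u * z)) sums (of_real (theta_tail (exp u)) * exp (of_real u * z))"
      by (intro sums_mult2 sums_of_real)
    then show ?thesis unfolding f_def c_def by (simp add: sums_unique[symmetric])
  qed
  show "integrable lborel (\<lambda>u. of_real (theta_tail (exp u)) * exp (of_real u * z))"
    using integrable_suminf[OF fi s2 s1] by (simp add: sumf)
  have "(\<lambda>n. integral\<^sup>L lborel (f n)) sums (LINT u|lborel. (\<Sum>n. f n u))"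
    by (rule sums_integral[OF fi s2 s1])
  then have "(\<lambda>n. exp (- z * of_real (ln (c n))) * Gamma z) sums (LINT u|lborel. of_real (theta_tail (exp u)) * exp (of_real u * z))"
    using f by (simp add: sumf has_bochner_integral_iff)
  then have "(\<lambda>n. (of_real pi powr z * rGamma z) * (exp (- z * of_real (ln (c n))) * Gamma z)) sums ((of_real pi powr z * rGamma z) * (LINT u|lborel. of_real (theta_tail (exp u)) * exp (of_real u * z)))"
    by (rule sums_mult)
  moreover have "(of_real pi powr z * rGamma z) * (exp (- z * of_real (ln (c n))) * Gamma z) = of_nat (Suc n) powr (- 2 * z)" for n
  proof -
    have "z \<notin> \<int>\<^sub>\<le>\<^sub>0" using z by (auto elim!: nonpos_Ints_cases)
    then have "rGamma z * Gamma z = 1" by (simp add: rGamma_inverse_Gamma Gamma_eq_zero_iff)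
    moreover have "of_real pi powr z * of_real pi powr (- z) = (1::complex)"
      by (simp add: powr_minus)
    ultimately show ?thesis unfolding powr by (simp add: algebra_simps)
  qed
  ultimately show "(\<lambda>n. of_nat (Suc n) powr (- 2 * z)) sums
      (of_real pi powr z * rGamma z * (LINT u|lborel. of_real (theta_tail (exp u)) * exp (of_real u * z)))"
    by simp
qed

section \<open>Exponential integrals over the half-line\<close>

lemma set_integral_Ioi_eq_Ici:
  fixes f :: "real \<Rightarrow> complex"
  shows "(LBINT x:{a<..}. f x) = (LBINT x:{a..}. f x)"
  unfolding set_lebesgue_integral_def
  by (rule integral_discrete_difference[of "{a}"]) (auto simp: indicator_def)

lemma set_integrable_exp_minus: "set_integrable lborel {0..} (\<lambda>u::real. exp (- u))"
  and set_integral_exp_minus: "(LBINT u:{0::real..}. exp (- u)) = 1"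
proof -
  have "has_bochner_integral lborel (\<lambda>u::real. indicator {0..} u *\<^sub>R exp (- u)) 1"
    using has_bochner_integral_I0i_power_exp_m'[of 0] by (simp add: mult.commute)
  then show "set_integrable lborel {0..} (\<lambda>u::real. exp (- u))" "(LBINT u:{0::real..}. exp (- u)) = 1"
    by (auto simp: set_integrable_def set_lebesgue_integral_def has_bochner_integral_iff)
qed

lemma Laplace_exp:
  assumes w: "Re w > 0"
  shows "set_integrable lborel {0..} (\<lambda>u. exp (- of_real u * w))"
    and "(LBINT u:{0..}. exp (- of_real u * w)) = 1 / w"
proof -
  have "w \<noteq> 0" using w by auto
  have meas: "set_borel_measurable lborel {0..} (\<lambda>u. exp (- of_real u * w))"
    unfolding set_borel_measurable_def measurable_lborel2
    by (intro borel_measurable_continuous_on_indicator continuous_intros) auto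
  have "set_integrable lborel {0<..} (\<lambda>x. exp (- (x * Re w)))"
    using w by (rule integrable_I0i_exp_mscale)
  then have "set_integrable lborel {0..} (\<lambda>x. exp (- (x * Re w)))"
    unfolding set_integrable_def
    by (rule integrable_discrete_difference[of "{0}", THEN iffD1, rotated -1]) (auto simp: indicator_def)
  then show int: "set_integrable lborel {0..} (\<lambda>u. exp (- of_real u * w))"
    by (rule set_integrable_bound) (use meas in \<open>auto simp: norm_exp_eq_Re\<close>)
  have "((\<lambda>b. LBINT u:{0..b}. exp (- of_real u * w)) \<longlongrightarrow> (LBINT u:{0..}. exp (- of_real u * w))) at_top"
    by (rule tendsto_set_lebesgue_integral_at_top) (use int in auto)
  moreover have "((\<lambda>b. LBINT u:{0..b}. exp (- of_real u * w)) \<longlongrightarrow> 1 / w) at_top"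
  proof -
    have "(LBINT u:{0..b}. exp (- of_real u * w)) = (1 - exp (- of_real b * w)) / w" if "b \<ge> 0" for b
    proof -
      have "((\<lambda>u. exp (- of_real u * w)) has_integral (- exp (- of_real b * w) / w - (- exp (- of_real 0 * w) / w))) {0..b}"
        using that \<open>w \<noteq> 0\<close>
        by (intro fundamental_theorem_of_calculus)
           (auto intro!: derivative_eq_intros has_vector_derivative_real_field simp: field_simps)
      moreover have "(LBINT u:{0..b}. exp (- of_real u * w)) = integral {0..b} (\<lambda>u. exp (- of_real u * w))"
        by (intro set_borel_integral_eq_integral(2) set_integrable_subset[OF int]) auto
      ultimately show ?thesis by (simp add: integral_unique diff_divide_distrib)
    qed
    then have ev: "\<forall>\<^sub>F b in at_top. (1 - exp (- of_real b * w)) / w = (LBINT u:{0..b}. exp (- of_real u * w))"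
      by (auto simp: eventually_at_top_linorder intro!: exI[of _ 0])
    have "((\<lambda>b. exp (- (b * Re w))) \<longlongrightarrow> 0) at_top"
      using w by real_asymp
    then have "((\<lambda>b. exp (- of_real b * w)) \<longlongrightarrow> 0) at_top"
      by (subst tendsto_norm_zero_iff[symmetric]) (simp add: norm_exp_eq_Re)
    then have "((\<lambda>b. (1 - exp (- of_real b * w)) / w) \<longlongrightarrow> (1 - 0) / w) at_top"
      using \<open>w \<noteq> 0\<close> by (intro tendsto_intros) auto
    then show ?thesis using ev by (simp add: tendsto_cong)
  qed
  ultimately show "(LBINT u:{0..}. exp (- of_real u * w)) = 1 / w"
    by (rule tendsto_unique[rotated]) auto
qed

text \<open>The integrals over [0, n] are holomorphic by differentiation under the integral sign,
  and they converge locally uniformly in z because the decay of k outruns any exponential growth of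
  exp(uz).\<close>

lemma rapidly_decaying_exp_integral:
  fixes k :: "real \<Rightarrow> real" and z :: complex
  assumes cont: "continuous_on {0..} k"
    and bound: "\<And>m::nat. \<exists>C. \<forall>u\<ge>0. \<bar>k u\<bar> \<le> C * exp (- real m * u)"
  shows "set_integrable lborel {0..} (\<lambda>u. of_real (k u) * exp (of_real u * z))"
    and "(\<lambda>z. LBINT u:{0..}. complex_of_real (k u) * exp (of_real u * z)) holomorphic_on UNIV"
proof -
  define h where "h = (\<lambda>z u. complex_of_real (k u) * exp (of_real u * z))"
  \<comment> \<open>An m with m >= R + 2 leaves exp(-2u) on the half-plane Re z <= R. One factor
    exp(-u) serves as integrable majorant, the other bounds the part beyond n by exp(-n).\<close>
  have bnd: "\<exists>C\<ge>0. \<forall>u\<ge>0. \<forall>z. Re z \<le> R \<longrightarrow> norm (h z u) \<le> C * exp (- 2 * u)" for R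
  proof -
    obtain m :: nat where m: "R + 2 \<le> real m" using real_arch_simple by blast
    obtain C where C: "\<forall>u\<ge>0. \<bar>k u\<bar> \<le> C * exp (- real m * u)" using bound by blast
    have "C \<ge> 0" using C[rule_format, of 0] by simp
    have "norm (h z u) \<le> C * exp (- 2 * u)" if "u \<ge> 0" "Re z \<le> R" for u z
    proof -
      have "norm (h z u) = \<bar>k u\<bar> * exp (u * Re z)" by (simp add: h_def norm_mult norm_exp_eq_Re)
      also have "\<dots> \<le> (C * exp (- real m * u)) * exp (u * Re z)"
        using C that by (intro mult_right_mono) auto
      also have "\<dots> = C * exp (u * (Re z - real m))" by (simp add: exp_add[symmetric] algebra_simps)
      also have "\<dots> \<le> C * exp (- 2 * u)"
      proof -
        have "u * (Re z - real m) \<le> u * (- 2)" using that m by (intro mult_left_mono) auto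
        then show ?thesis using \<open>C \<ge> 0\<close> by (intro mult_left_mono) auto
      qed
      finally show ?thesis .
    qed
    then show ?thesis using \<open>C \<ge> 0\<close> by blast
  qed
  have ch: "continuous_on {0..} (h z)" for z
    unfolding h_def by (intro continuous_intros cont)
  have inth: "set_integrable lborel {0..} (h z)" for z
  proof -
    obtain C where C: "C \<ge> 0" "\<forall>u\<ge>0. \<forall>w. Re w \<le> Re z \<longrightarrow> norm (h w u) \<le> C * exp (- 2 * u)" using bnd by blast
    have "set_integrable lborel {0..} (\<lambda>u. C * exp (- u))"
      using set_integrable_exp_minus by (rule set_integrable_mult_right)
    then show ?thesis
    proof (rule set_integrable_bound)
      show "set_borel_measurable lborel {0..} (h z)"
        unfolding set_borel_measurable_def measurable_lborel2
        by (intro borel_measurable_continuous_on_indicator ch) auto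
      show "AE u\<in>{0..} in lborel. norm (h z u) \<le> norm (C * exp (- u))"
      proof (intro AE_I2 impI)
        fix u :: real assume u: "u \<in> {0..}"
        then have "norm (h z u) \<le> C * exp (- 2 * u)" using C by auto
        also have "\<dots> \<le> C * exp (- u)" using C(1) u by (intro mult_left_mono) auto
        finally show "norm (h z u) \<le> norm (C * exp (- u))" using C(1) by simp
      qed
    qed
  qed
  then show "set_integrable lborel {0..} (\<lambda>u. of_real (k u) * exp (of_real u * z))"
    unfolding h_def .
  have "(\<lambda>z. LBINT u:{0..}. h z u) holomorphic_on UNIV"
  proof (rule holomorphic_uniform_sequence[where f = "\<lambda>n z. integral (cbox 0 (real n)) (h z)"])
    fix n :: nat
    have ck: "continuous_on {0..real n} k" using cont by (rule continuous_on_subset) auto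
    show "(\<lambda>z. integral (cbox 0 (real n)) (h z)) holomorphic_on UNIV"
    proof (rule leibniz_rule_holomorphic[where fx = "\<lambda>z u. of_real (k u) * (exp (of_real u * z) * of_real u)"])
      show "((\<lambda>z. h z t) has_field_derivative of_real (k t) * (exp (of_real t * z) * of_real t)) (at z within UNIV)" for z t
        unfolding h_def by (auto intro!: derivative_eq_intros)
      show "h z integrable_on cbox 0 (real n)" for z
        using continuous_on_subset[OF ch[of z], of "{0..real n}"] by (auto intro!: integrable_continuous_real)
      have "continuous_on (UNIV \<times> {0..real n}) (\<lambda>x::complex \<times> real. k (snd x))"
        by (rule continuous_on_compose2[OF ck]) (auto intro!: continuous_intros)
      then show "continuous_on (UNIV \<times> cbox 0 (real n)) (\<lambda>(z, u). complex_of_real (k u) * (exp (of_real u * z) * of_real u))"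
        unfolding split_def by (auto intro!: continuous_intros)
    qed auto
  next
    fix x :: complex
    obtain C where C: "C \<ge> 0" "\<forall>u\<ge>0. \<forall>w. Re w \<le> norm x + 1 \<longrightarrow> norm (h w u) \<le> C * exp (- 2 * u)" using bnd by blast
    have est: "dist (integral (cbox 0 (real n)) (h z)) (LBINT u:{0..}. h z u) \<le> C * exp (- real n)"
      if "z \<in> cball x 1" for z n
    proof -
      have "Re z \<le> norm x + 1"
      proof -
        have "Re z \<le> norm z" by (rule complex_Re_le_cmod)
        also have "norm z \<le> norm x + norm (z - x)" by (rule norm_triangle_sub)
        finally show ?thesis using that by (auto simp: dist_norm norm_minus_commute)
      qed
      then have Cz: "norm (h z u) \<le> C * exp (- 2 * u)" if "u \<ge> 0" for u using C that by blast
      have i1: "set_integrable lborel {0..real n} (h z)" and i2: "set_integrable lborel {real n<..} (h z)"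
        by (rule set_integrable_subset[OF inth]; auto)+
      have "{0..} = {0..real n} \<union> {real n<..}" by auto
      then have "(LBINT u:{0..}. h z u) = (LBINT u:{0..real n}. h z u) + (LBINT u:{real n<..}. h z u)"
        using set_integral_Un[OF _ i1 i2] by fastforce
      moreover have "(LBINT u:{0..real n}. h z u) = integral (cbox 0 (real n)) (h z)"
        using set_borel_integral_eq_integral(2)[OF i1] by simp
      moreover have "norm (LBINT u:{real n<..}. h z u) \<le> C * exp (- real n)"
      proof -
        have "norm (LBINT u:{real n<..}. h z u) \<le> (LINT u|lborel. norm (indicator {real n<..} u *\<^sub>R h z u))"
          unfolding set_lebesgue_integral_def by (rule integral_norm_bound)
        also have "\<dots> \<le> (LINT u|lborel. (C * exp (- real n)) * (indicator {0..} u *\<^sub>R exp (- u)))"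
        proof (rule integral_mono)
          show "integrable lborel (\<lambda>u. norm (indicator {real n<..} u *\<^sub>R h z u))"
            using i2 unfolding set_integrable_def by (rule integrable_norm)
          show "integrable lborel (\<lambda>u. (C * exp (- real n)) * (indicator {0..} u *\<^sub>R exp (- u)))"
            using set_integrable_exp_minus unfolding set_integrable_def by (rule integrable_mult_right)
          fix u :: real
          show "norm (indicator {real n<..} u *\<^sub>R h z u) \<le> (C * exp (- real n)) * (indicator {0..} u *\<^sub>R exp (- u))"
          proof (cases "u > real n")
            case True
            then have "norm (h z u) \<le> C * exp (- 2 * u)" by (intro Cz) auto
            also have "\<dots> \<le> C * (exp (- real n) * exp (- u))"
              using C(1) True by (intro mult_left_mono) (auto simp: exp_add[symmetric])
            finally show ?thesis using True by (auto simp: indicator_def)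
          qed (use C(1) in \<open>auto simp: indicator_def\<close>)
        qed
        also have "\<dots> = C * exp (- real n)"
          using set_integral_exp_minus by (simp add: set_lebesgue_integral_def)
        finally show ?thesis .
      qed
      ultimately show ?thesis by (simp add: dist_norm)
    qed
    have lim: "(\<lambda>n. C * exp (- real n)) \<longlonglongrightarrow> 0" by real_asymp
    have "uniform_limit (cball x 1) (\<lambda>n z. integral (cbox 0 (real n)) (h z)) (\<lambda>z. LBINT u:{0..}. h z u) sequentially"
    proof (rule uniform_limitI)
      fix e :: real assume "e > 0"
      then have "\<forall>\<^sub>F n in sequentially. C * exp (- real n) < e" using lim by (rule order_tendstoD(2)[rotated])
      then show "\<forall>\<^sub>F n in sequentially. \<forall>z\<in>cball x 1. dist (integral (cbox 0 (real n)) (h z)) (LBINT u:{0..}. h z u) < e"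
        by eventually_elim (blast intro: le_less_trans[OF est])
    qed
    then show "\<exists>d>0. cball x d \<subseteq> UNIV \<and> uniform_limit (cball x d) (\<lambda>n z. integral (cbox 0 (real n)) (h z)) (\<lambda>z. LBINT u:{0..}. h z u) sequentially"
      by (intro exI[of _ 1]) auto
  qed auto
  then show "(\<lambda>z. LBINT u:{0..}. complex_of_real (k u) * exp (of_real u * z)) holomorphic_on UNIV"
    unfolding h_def .
qed

text \<open>The part of the Mellin transform with x >= 1. The theta tail is used only where it
  decays, so this part exists for every complex z.\<close>

definition theta_Mellin :: "complex \<Rightarrow> complex" where
  "theta_Mellin z = (LBINT u:{0..}. of_real (theta_tail (exp u)) * exp (of_real u * z))"

lemma theta_tail_exp_continuous: "continuous_on A (\<lambda>u. theta_tail (exp u))"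
  by (rule continuous_on_compose2[OF theta_tail_continuous]) (auto intro!: continuous_intros)

lemma theta_Mellin_integrable:
  "set_integrable lborel {0..} (\<lambda>u. complex_of_real (theta_tail (exp u)) * exp (of_real u * z))"
  by (rule rapidly_decaying_exp_integral(1)[OF theta_tail_exp_continuous theta_tail_rapid_decay])

lemma theta_Mellin_holomorphic: "theta_Mellin holomorphic_on A"
proof -
  have "theta_Mellin holomorphic_on UNIV"
    unfolding theta_Mellin_def
    by (rule rapidly_decaying_exp_integral(2)[OF theta_tail_exp_continuous theta_tail_rapid_decay])
  then show ?thesis by (rule holomorphic_on_subset) auto
qed

text \<open>The theta tail is real. On the critical line, where cnj s = 1 - s, conjugation therefore
  swaps the two \<open>theta_Mellin\<close> terms of zeta.\<close>

lemma theta_Mellin_cnj: "cnj (theta_Mellin z) = theta_Mellin (cnj z)"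
proof -
  define f where "f = (\<lambda>u. indicator {0..} u *\<^sub>R (complex_of_real (theta_tail (exp u)) * exp (of_real u * z)))"
  have "cnj (integral\<^sup>L lborel f) = (LINT u|lborel. cnj (f u))" by simp
  also have "\<dots> = (LINT u|lborel. indicator {0..} u *\<^sub>R (of_real (theta_tail (exp u)) * exp (of_real u * cnj z)))"
    by (intro Bochner_Integration.integral_cong) (auto simp: f_def exp_cnj)
  finally show ?thesis by (simp add: theta_Mellin_def set_lebesgue_integral_def f_def)
qed

text \<open>Riemann's symmetric splitting of the Mellin transform: the theta functional equation folds the
  half-line \<open>u < 0\<close> onto \<open>u > 0\<close>.\<close>

lemma theta_Mellin_split:
  assumes z: "Re z > 1/2"
  shows "(LINT u|lborel. of_real (theta_tail (exp u)) * exp (of_real u * z)) =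
     theta_Mellin z + theta_Mellin (1/2 - z) + (1 / (2 * z - 1) - 1 / (2 * z))"
proof -
  define h where "h = (\<lambda>z u. complex_of_real (theta_tail (exp u)) * exp (of_real u * z))"
  have int: "integrable lborel (h z)" unfolding h_def using z by (rule theta_tail_Mellin)
  have si: "set_integrable lborel A (h z)" if "A \<in> sets borel" for A
    unfolding set_integrable_def using int that by (intro integrable_mult_indicator) auto
  have "(LINT u|lborel. h z u) = (LBINT u:({0..} \<union> {..<0}). h z u)"
  proof -
    have "({0..} \<union> {..<0}) = (UNIV :: real set)" by auto
    then show ?thesis by (simp add: set_lebesgue_integral_def)
  qed
  also have "\<dots> = (LBINT u:{0..}. h z u) + (LBINT u:{..<0}. h z u)"
    by (intro set_integral_Un si) auto
  also have "(LBINT u:{..<0}. h z u) = (LBINT u:{0<..}. h z (- u))"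
    by (subst set_integral_reflect) (auto intro!: arg_cong2[where f = "set_lebesgue_integral lborel"])
  also have "\<dots> = (LBINT u:{0..}. h z (- u))" by (rule set_integral_Ioi_eq_Ici)
  also have "\<dots> = (LBINT u:{0..}. h (1/2 - z) u + (1/2) * (exp (- of_real u * (z - 1/2)) - exp (- of_real u * z)))"
  proof -
    \<comment> \<open>In the functional equation at exp(-u) the factor exp(u/2) turns z into 1/2 -
      z. The remainder (exp(u/2) - 1)/2, which comes from the constant term of the theta function,
      produces the two rational terms.\<close>
    have "h z (- u) = h (1/2 - z) u + (1/2) * (exp (- of_real u * (z - 1/2)) - exp (- of_real u * z))" for u
    proof -
      have "1 + 2 * theta_tail (exp (- u)) = (1 + 2 * theta_tail (exp u)) * exp (u / 2)"
      proof -
        have "sqrt (exp (- u)) = exp (- (u / 2))"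
        proof (rule real_sqrt_unique)
          show "(exp (- (u / 2)))\<^sup>2 = exp (- u)" by (simp add: power2_eq_square exp_add[symmetric])
        qed auto
        moreover have "1 / exp (- u) = exp u" by (metis exp_minus inverse_eq_divide minus_minus)
        ultimately show ?thesis
          using theta_functional_equation[of "exp (- u)"] exp_minus[of "u / 2"]
          by (simp only: exp_gt_zero divide_inverse inverse_inverse_eq)
      qed
      then have "theta_tail (exp (- u)) = theta_tail (exp u) * exp (u/2) + (exp (u/2) - 1) / 2"
        by (simp add: field_simps)
      then have "h z (- u) = of_real (theta_tail (exp u) * exp (u/2) + (exp (u/2) - 1) / 2) * exp (- of_real u * z)"
        by (simp add: h_def)
      also have "\<dots> = of_real (theta_tail (exp u)) * (exp (of_real (u/2)) * exp (- of_real u * z))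
          + (1/2) * (exp (of_real (u/2)) * exp (- of_real u * z) - exp (- of_real u * z))"
        by (simp only: of_real_add of_real_mult of_real_diff of_real_divide exp_of_real[symmetric])
           (simp add: field_simps)
      also have "exp (of_real (u/2)) * exp (- of_real u * z) = exp (of_real u * (1/2 - z))"
        by (simp add: exp_add[symmetric] algebra_simps)
      also have "of_real u * (1/2 - z) = - of_real u * (z - 1/2)" by (simp add: algebra_simps)
      finally show ?thesis by (simp add: h_def algebra_simps)
    qed
    then show ?thesis by simp
  qed
  also have "\<dots> = (LBINT u:{0..}. h (1/2 - z) u) + (1/2) * (1 / (z - 1/2) - 1 / z)"
  proof -
    have i1: "set_integrable lborel {0..} (\<lambda>u. exp (- of_real u * (z - 1/2)))"
      and v1: "(LBINT u:{0..}. exp (- of_real u * (z - 1/2))) = 1 / (z - 1/2)"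
      using z by (intro Laplace_exp; simp)+
    have i2: "set_integrable lborel {0..} (\<lambda>u. exp (- of_real u * z))"
      and v2: "(LBINT u:{0..}. exp (- of_real u * z)) = 1 / z"
      using z by (intro Laplace_exp; simp)+
    have i3: "set_integrable lborel {0..} (h (1/2 - z))"
      unfolding h_def by (rule theta_Mellin_integrable)
    have i4: "set_integrable lborel {0..} (\<lambda>u. (1/2) * (exp (- of_real u * (z - 1/2)) - exp (- of_real u * z)))"
      by (intro set_integrable_mult_right set_integral_diff(1) i1 i2)
    have "(LBINT u:{0..}. h (1/2 - z) u + (1/2) * (exp (- of_real u * (z - 1/2)) - exp (- of_real u * z))) =
       (LBINT u:{0..}. h (1/2 - z) u) + (LBINT u:{0..}. (1/2) * (exp (- of_real u * (z - 1/2)) - exp (- of_real u * z)))"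
      by (rule set_integral_add(2)[OF i3 i4])
    also have "(LBINT u:{0..}. (1/2) * (exp (- of_real u * (z - 1/2)) - exp (- of_real u * z))) =
        (1/2) * (1 / (z - 1/2) - 1 / z)"
      unfolding set_integral_diff(2)[OF i1 i2, symmetric] v1[symmetric] v2[symmetric]
      by (rule set_integral_mult_right)
    finally show ?thesis .
  qed
  also have "(1/2) * (1 / (z - 1/2) - 1 / z) = 1 / (2 * z - 1) - 1 / (2 * z)"
  proof -
    have "z \<noteq> 0" "2 * z \<noteq> 1" using z by (auto simp: complex_eq_iff)
    moreover from this have "z * 2 \<noteq> 1" "z - 1/2 \<noteq> 0" by (auto simp: mult.commute)
    ultimately show ?thesis by (simp add: field_simps)
  qed
  finally show ?thesis by (simp add: h_def theta_Mellin_def algebra_simps)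
qed

section \<open>The zeta function on the critical line\<close>

text \<open>Riemann's formula for zeta(s). The term -\<open>rGamma (s / 2)\<close> / s is written as
  -\<open>rGamma (s / 2 + 1)\<close> / 2, which removes the apparent singularity at 0 and leaves
  only the pole at 1.\<close>

definition zeta_ext :: "complex \<Rightarrow> complex" where
  "zeta_ext s = of_real pi powr (s / 2) *
     (rGamma (s / 2) * (theta_Mellin (s / 2) + theta_Mellin ((1 - s) / 2) + 1 / (s - 1)) - rGamma (s / 2 + 1) / 2)"

lemma zeta_ext_holomorphic: "zeta_ext holomorphic_on - {1}"
proof -
  have "(theta_Mellin \<circ> (\<lambda>s. s / 2)) holomorphic_on - {1}"
       "(theta_Mellin \<circ> (\<lambda>s. (1 - s) / 2)) holomorphic_on - {1}"
    by (intro holomorphic_on_compose theta_Mellin_holomorphic holomorphic_intros; simp)+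
  then show ?thesis
    unfolding zeta_ext_def o_def by (intro holomorphic_intros) auto
qed

lemma zeta_ext_eq:
  assumes "s \<noteq> 0"
  shows "zeta_ext s = of_real pi powr (s / 2) * rGamma (s / 2) *
     (theta_Mellin (s / 2) + theta_Mellin ((1 - s) / 2) + (1 / (s - 1) - 1 / s))"
proof -
  have "rGamma (s / 2 + 1) = rGamma (s / 2) * (2 / s)"
    using rGamma_plus1[of "s / 2"] assms by (simp add: field_simps)
  then show ?thesis unfolding zeta_ext_def by (simp add: algebra_simps)
qed

lemma zeta_ext_sums:
  assumes s: "Re s > 1"
  shows "(\<lambda>n. 1 / of_nat (Suc n) powr s) sums zeta_ext s"
proof -
  have "(\<lambda>n. of_nat (Suc n) powr (- 2 * (s/2))) sums (of_real pi powr (s/2) * rGamma (s/2) *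
      (LINT u|lborel. of_real (theta_tail (exp u)) * exp (of_real u * (s/2))))"
    using s by (intro theta_tail_Mellin) auto
  moreover have "(LINT u|lborel. of_real (theta_tail (exp u)) * exp (of_real u * (s/2))) =
     theta_Mellin (s / 2) + theta_Mellin ((1 - s) / 2) + (1 / (s - 1) - 1 / s)"
    using theta_Mellin_split[of "s/2"] s by (simp add: diff_divide_distrib)
  moreover have "s \<noteq> 0" using s by auto
  ultimately show ?thesis by (simp add: zeta_ext_eq powr_minus_divide)
qed

text \<open>The punctured plane is connected, so the identity theorem makes the continuation
  described by \<open>riemann_zeta\<close> unique there. At 1 the description leaves the value
  free.\<close>

lemma riemann_zeta_eq_ext:
  assumes "s \<noteq> 1"
  shows "riemann_zeta s = zeta_ext s"
  unfolding riemann_zeta_def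
proof (rule the_equality)
  show "\<exists>f. f holomorphic_on - {1} \<and> (\<forall>z. 1 < Re z \<longrightarrow> f z = (\<Sum>n. 1 / of_nat (Suc n) powr z)) \<and> zeta_ext s = f s"
    by (intro exI[of _ zeta_ext]) (auto simp: zeta_ext_holomorphic sums_unique[OF zeta_ext_sums])
next
  fix w assume "\<exists>f. f holomorphic_on - {1} \<and> (\<forall>z. 1 < Re z \<longrightarrow> f z = (\<Sum>n. 1 / of_nat (Suc n) powr z)) \<and> w = f s"
  then obtain f where f: "f holomorphic_on - {1}" "\<And>z. 1 < Re z \<Longrightarrow> f z = (\<Sum>n. 1 / of_nat (Suc n) powr z)" "w = f s"
    by blast
  have "f s = zeta_ext s"
  proof (rule analytic_continuation_open[of "{z. Re z > 1}" "- {1}" f zeta_ext])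
    show "open {z. Re z > 1}" by (rule open_halfspace_Re_gt)
    show "{z. Re z > 1} \<noteq> {}" by (auto intro: exI[of _ 2])
    show "connected (- {1::complex})" by (rule connected_punctured_universe) simp
    show "f z = zeta_ext z" if "z \<in> {z. Re z > 1}" for z
      using that f(2) sums_unique[OF zeta_ext_sums] by auto
  qed (use assms f zeta_ext_holomorphic in auto)
  then show "w = zeta_ext s" using f(3) by simp
qed

section \<open>Reality of Hardy's function, continuity and zeros on the critical line\<close>

lemma zeta_crit_eq_ext: "zeta_crit t = zeta_ext (Complex (1/2) t)"
  unfolding zeta_crit_def by (rule riemann_zeta_eq_ext) (auto simp: complex_eq_iff)

text \<open>On the critical line the bracket \<open>R\<close> of Riemann's formula equals its own
  conjugate, and the argument of the factor pi^(s/2) / Gamma(s/2) is exactly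
  -\<open>RS_theta t\<close>. The rotated zeta value is thus real, and taking \<open>Re\<close> in
  \<open>hardy_Z\<close> loses nothing.\<close>

lemma hardy_Z_squared: "(hardy_Z t)\<^sup>2 = (norm (zeta_crit t))\<^sup>2"
proof -
  define s where "s = Complex (1/2) t"
  define w where "w = Complex (1/4) (t/2)"
  have w: "w = s / 2" by (simp add: w_def s_def complex_eq_iff)
  have "s \<noteq> 0" by (simp add: s_def complex_eq_iff)
  have wpos: "w \<notin> \<int>\<^sub>\<le>\<^sub>0" by (auto simp: w_def complex_eq_iff elim!: nonpos_Ints_cases)
  define R where "R = theta_Mellin (s / 2) + theta_Mellin ((1 - s) / 2) + (1 / (s - 1) - 1 / s)"
  have cs: "cnj s = 1 - s" by (simp add: s_def complex_eq_iff)
  have "cnj R = theta_Mellin ((1 - s) / 2) + theta_Mellin (s / 2) + (1 / (cnj s - 1) - 1 / cnj s)"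
    by (simp add: R_def theta_Mellin_cnj cs)
  also have "1 / (cnj s - 1) - 1 / cnj s = 1 / (s - 1) - 1 / s"
  proof -
    have "1 / (1 - s) = - (1 / (s - 1))" by (metis minus_diff_eq minus_divide_right)
    then show ?thesis by (simp add: cs)
  qed
  finally have "cnj R = R" by (simp add: R_def add.commute)
  then have R: "Im R = 0" by (simp add: complex_eq_iff)
  define \<theta> where "\<theta> = RS_theta t"
  have lnG: "exp (ln_Gamma w) = Gamma w" using wpos by (simp add: Gamma_complex_altdef)
  have "exp (\<i> * of_real \<theta>) * (of_real pi powr w * rGamma w) = of_real (pi powr (1/4) * exp (- Re (ln_Gamma w)))"
  proof -
    have "rGamma w = exp (- ln_Gamma w)" using lnG by (simp add: rGamma_inverse_Gamma exp_minus)
    moreover have "of_real pi powr w = exp (w * of_real (ln pi))" by (simp add: powr_def Ln_of_real)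
    ultimately have "exp (\<i> * of_real \<theta>) * (of_real pi powr w * rGamma w) = exp (\<i> * of_real \<theta> + w * of_real (ln pi) - ln_Gamma w)"
      by (simp add: exp_add exp_diff exp_minus field_simps)
    also have "\<i> * of_real \<theta> + w * of_real (ln pi) - ln_Gamma w = of_real (ln pi / 4 - Re (ln_Gamma w))"
      by (simp add: complex_eq_iff \<theta>_def RS_theta_def w_def algebra_simps)
    also have "exp \<dots> = of_real (exp (ln pi / 4 - Re (ln_Gamma w)))" by (rule exp_of_real)
    also have "exp (ln pi / 4 - Re (ln_Gamma w)) = pi powr (1/4) * exp (- Re (ln_Gamma w))"
      by (simp add: powr_def exp_add[symmetric] exp_diff exp_minus field_simps)
    finally show ?thesis .
  qed
  then have "exp (\<i> * of_real \<theta>) * zeta_crit t = of_real (pi powr (1/4) * exp (- Re (ln_Gamma w))) * R"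
    using zeta_ext_eq[OF \<open>s \<noteq> 0\<close>] unfolding zeta_crit_eq_ext s_def[symmetric] R_def w by (simp add: mult.assoc)
  then have Im0: "Im (exp (\<i> * of_real \<theta>) * zeta_crit t) = 0" using R by simp
  have "(hardy_Z t)\<^sup>2 = (norm (exp (\<i> * of_real \<theta>) * zeta_crit t))\<^sup>2"
    unfolding hardy_Z_def \<theta>_def[symmetric] cmod_power2 using Im0 by simp
  also have "\<dots> = (norm (zeta_crit t))\<^sup>2" by (simp add: norm_mult)
  finally show ?thesis .
qed

lemma zeta_crit_continuous: "continuous_on A zeta_crit"
proof -
  have "continuous_on A (\<lambda>t. zeta_ext (Complex (1/2) t))"
    by (rule continuous_on_compose2[OF holomorphic_on_imp_continuous_on[OF zeta_ext_holomorphic]])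
       (auto simp: complex_eq_iff intro!: continuous_intros)
  then show ?thesis by (simp add: zeta_crit_eq_ext)
qed

lemma zeta_ext_2_nonzero: "zeta_ext 2 \<noteq> 0"
proof -
  have "(\<lambda>n. 1 / complex_of_nat (Suc n) powr 2) sums zeta_ext 2" by (rule zeta_ext_sums) simp
  then have "(\<lambda>n. Re (1 / complex_of_nat (Suc n) powr 2)) sums Re (zeta_ext 2)" by (rule sums_Re)
  moreover have "Re (1 / complex_of_nat (Suc n) powr 2) = 1 / (real (Suc n))\<^sup>2" for n
  proof -
    have "complex_of_nat (Suc n) powr 2 = of_real ((real (Suc n))\<^sup>2)"
      using powr_of_real[of "real (Suc n)" 2] by (simp add: powr_numeral del: of_nat_Suc)
    then have "1 / complex_of_nat (Suc n) powr 2 = of_real (1 / (real (Suc n))\<^sup>2)"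
      by (simp only: of_real_divide of_real_1)
    then show ?thesis by (simp only: Re_complex_of_real)
  qed
  ultimately have *: "(\<lambda>n. 1 / (real (Suc n))\<^sup>2) sums Re (zeta_ext 2)" by simp
  then have "0 < Re (zeta_ext 2)"
    using suminf_pos[OF sums_summable[OF *]] sums_unique[OF *] by simp
  then show ?thesis by auto
qed

text \<open>Zeros filling an interval accumulate inside the domain of \<open>zeta_ext\<close> and
  would force it to vanish at 2. This is what makes G, and with it the ladder, strictly
  increasing.\<close>

lemma zeta_crit_not_locally_zero:
  assumes "p < q" shows "\<exists>t\<in>{p<..<q}. zeta_crit t \<noteq> 0"
proof (rule ccontr)
  assume "\<not> ?thesis"
  then have z: "zeta_crit t = 0" if "t \<in> {p<..<q}" for t using that by blast
  define m where "m = (p + q) / 2"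
  define U where "U = Complex (1/2) ` {p<..<q}"
  have "zeta_ext 2 = 0"
  proof (rule analytic_continuation[OF zeta_ext_holomorphic, of U "Complex (1/2) m"])
    show "connected (- {1::complex})" by (rule connected_punctured_universe) simp
    show "Complex (1/2) m islimpt U"
    proof -
      have "m islimpt {p<..<q}" using assms by (auto simp: m_def islimpt_greaterThanLessThan1 intro!: interior_limit_point interior_open)
      then have "\<exists>x'\<in>{p<..<q}. x' \<noteq> m \<and> dist x' m < e" if "e > 0" for e using that by (auto simp: islimpt_approachable)
      then show ?thesis
        unfolding islimpt_approachable U_def
        by (fastforce simp: dist_norm cmod_def complex_eq_iff)
    qed
    show "zeta_ext z = 0" if "z \<in> U" for z using that z by (auto simp: U_def zeta_crit_eq_ext)
    show "U \<subseteq> - {1}" by (auto simp: U_def complex_eq_iff)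
  qed (auto simp: complex_eq_iff)
  then show False using zeta_ext_2_nonzero by simp
qed

section \<open>The alternating zeta series\<close>

text \<open>Two neighbouring terms of the alternating series, taken together: the difference gains a
  factor of order |s|/n, so the paired series converges absolutely for Re s > 0.\<close>

definition eta_term :: "nat \<Rightarrow> complex \<Rightarrow> complex" where
  "eta_term k s = of_nat (2 * k + 1) powr (- s) - of_nat (2 * k + 2) powr (- s)"

text \<open>The mean value inequality on a real segment of length 1. It serves wherever two
  consecutive terms of an alternating series are compared: for \<open>z powr (- s)\<close> itself
  and for its Laplace transforms in \<open>eta_crit_Laplace\<close>.\<close>

lemma unit_step_bound:
  fixes f f' :: "complex \<Rightarrow> complex"
  assumes deriv: "\<And>x. x \<in> {a..a+1} \<Longrightarrow> (f has_field_derivative f' (of_real x)) (at (of_real x))"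
    and bound: "\<And>x. x \<in> {a..a+1} \<Longrightarrow> norm (f' (of_real x)) \<le> B"
  shows "norm (f (of_real a) - f (of_real (a + 1))) \<le> B"
proof -
  have seg: "closed_segment (complex_of_real a) (of_real (a + 1)) = of_real ` {a..a+1}"
    by (simp only: closed_segment_of_real) (simp add: closed_segment_eq_real_ivl)
  have "norm (f (of_real a) - f (of_real (a + 1))) \<le> B * norm (complex_of_real a - of_real (a + 1))"
  proof (rule field_differentiable_bound[where S = "closed_segment (of_real a) (of_real (a + 1))" and f' = f'])
    show "(f has_field_derivative f' z) (at z within closed_segment (of_real a) (of_real (a + 1)))"
      if "z \<in> closed_segment (complex_of_real a) (of_real (a + 1))" for z
      using that deriv unfolding seg by (auto intro: has_field_derivative_at_within)
    show "norm (f' z) \<le> B" if "z \<in> closed_segment (complex_of_real a) (of_real (a + 1))" for z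
      using that bound unfolding seg by auto
  qed auto
  then show ?thesis by simp
qed

lemma eta_term_bound:
  assumes "Re s \<ge> 0"
  shows "norm (eta_term k s) \<le> norm s * real (2 * k + 1) powr (- Re s - 1)"
proof -
  have "norm (of_real (real (2 * k + 1)) powr (- s) - of_real (real (2 * k + 1) + 1) powr (- s)) \<le> norm s * real (2 * k + 1) powr (- Re s - 1)"
  proof (rule unit_step_bound[where f' = "\<lambda>z. (- s) * z powr (- s - 1)"])
    fix x assume x: "x \<in> {real (2 * k + 1)..real (2 * k + 1) + 1}"
    then have x1: "x \<ge> 1" by simp
    then have "complex_of_real x \<notin> \<real>\<^sub>\<le>\<^sub>0" by (simp add: complex_nonpos_Reals_iff)
    then show "((\<lambda>z. z powr (- s)) has_field_derivative (- s) * of_real x powr (- s - 1)) (at (of_real x))"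
      by (rule has_field_derivative_powr)
    have "norm (complex_of_real x powr (- s - 1)) = x powr (- Re s - 1)"
      using x1 by (subst norm_powr_real_powr) auto
    also have "\<dots> \<le> real (2 * k + 1) powr (- Re s - 1)"
      using x assms by (intro powr_mono2') auto
    finally show "norm ((- s) * of_real x powr (- s - 1)) \<le> norm s * real (2 * k + 1) powr (- Re s - 1)"
      by (simp add: norm_mult mult_left_mono)
  qed
  then show ?thesis by (simp add: eta_term_def add.commute)
qed

lemma summable_odd_powr: "r > 0 \<Longrightarrow> summable (\<lambda>k. real (2 * k + 1) powr (- r - 1))"
proof -
  assume r: "r > 0"
  have "summable (\<lambda>k. real k powr (- r - 1))" using r by (subst summable_real_powr_iff) auto
  then have "summable (\<lambda>k. real (Suc k) powr (- r - 1))" by (subst summable_Suc_iff)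
  then show ?thesis
  proof (rule summable_comparison_test'[where N = 0])
    show "norm (real (2 * k + 1) powr (- r - 1)) \<le> real (Suc k) powr (- r - 1)" for k
      using r by (simp add: powr_mono2')
  qed
qed

definition eta :: "complex \<Rightarrow> complex" where
  "eta s = (\<Sum>k. eta_term k s)"

lemma eta_sums: "Re s > 0 \<Longrightarrow> (\<lambda>k. eta_term k s) sums eta s"
  unfolding eta_def
  by (intro summable_sums summable_comparison_test'[OF summable_mult[OF summable_odd_powr[of "Re s"], of "norm s"], of 0])
     (use eta_term_bound in auto)

lemma eta_norm_le:
  assumes "Re s > 0"
  shows "norm (eta s) \<le> norm s * (\<Sum>k. real (2 * k + 1) powr (- Re s - 1))"
proof -
  have sm: "summable (\<lambda>k. norm s * real (2 * k + 1) powr (- Re s - 1))"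
    using assms by (intro summable_mult summable_odd_powr)
  have "norm (eta s) \<le> (\<Sum>k. norm s * real (2 * k + 1) powr (- Re s - 1))"
    unfolding eta_def using assms by (intro norm_suminf_le[OF _ sm] eta_term_bound less_imp_le)
  also have "\<dots> = norm s * (\<Sum>k. real (2 * k + 1) powr (- Re s - 1))"
    using assms by (intro suminf_mult summable_odd_powr)
  finally show ?thesis .
qed

lemma eta_holomorphic: "eta holomorphic_on {s. Re s > 0}"
proof (rule holomorphic_uniform_sequence[where f = "\<lambda>n s. \<Sum>k<n. eta_term k s"])
  show "open {s. 0 < Re s}" by (rule open_halfspace_Re_gt)
  show "(\<lambda>s. \<Sum>k<n. eta_term k s) holomorphic_on {s. 0 < Re s}" for n
    unfolding eta_term_def by (intro holomorphic_intros)
next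
  fix x assume "x \<in> {s. 0 < Re s}"
  define d where "d = Re x / 2"
  have d: "d > 0" using \<open>x \<in> _\<close> by (simp add: d_def)
  have ball: "Re z \<ge> d" "norm z \<le> norm x + d" if "z \<in> cball x d" for z
  proof -
    have "norm (x - z) \<le> d" using that by (simp add: dist_norm)
    moreover have "\<bar>Re (x - z)\<bar> \<le> norm (x - z)" by (rule abs_Re_le_cmod)
    ultimately show "Re z \<ge> d" by (simp add: d_def)
    have "norm z \<le> norm x + norm (z - x)" by (rule norm_triangle_sub)
    then show "norm z \<le> norm x + d" using \<open>norm (x - z) \<le> d\<close> by (simp add: norm_minus_commute)
  qed
  have "uniform_limit (cball x d) (\<lambda>n s. \<Sum>k<n. eta_term k s) eta sequentially"
    unfolding eta_def
  proof (rule Weierstrass_m_test[where M = "\<lambda>k. (norm x + d) * real (2 * k + 1) powr (- d - 1)"])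
    show "summable (\<lambda>k. (norm x + d) * real (2 * k + 1) powr (- d - 1))"
      using d by (intro summable_mult summable_odd_powr)
    fix k z assume z: "z \<in> cball x d"
    have "norm (eta_term k z) \<le> norm z * real (2 * k + 1) powr (- Re z - 1)"
      using ball[OF z] d by (intro eta_term_bound) auto
    also have "\<dots> \<le> (norm x + d) * real (2 * k + 1) powr (- d - 1)"
      using ball[OF z] d by (intro mult_mono powr_mono) auto
    finally show "norm (eta_term k z) \<le> (norm x + d) * real (2 * k + 1) powr (- d - 1)" .
  qed
  moreover have "cball x d \<subseteq> {s. 0 < Re s}" using ball d by fastforce
  ultimately show "\<exists>d>0. cball x d \<subseteq> {s. 0 < Re s} \<and> uniform_limit (cball x d) (\<lambda>n s. \<Sum>k<n. eta_term k s) eta sequentially"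
    using d by blast
qed

lemma eta_eq_zeta_Re_gt_1:
  assumes s: "Re s > 1"
  shows "eta s = (1 - 2 powr (1 - s)) * zeta_ext s"
proof -
  define f where "f = (\<lambda>n. of_nat (Suc n) powr (- s))"
  have f: "f sums zeta_ext s"
    using zeta_ext_sums[OF s] unfolding f_def by (simp add: powr_minus_divide)
  have "(\<lambda>n. sum f {n * 2..<n * 2 + 2}) sums zeta_ext s"
    by (rule sums_group[OF f]) auto
  moreover have "sum f {n * 2..<n * 2 + 2} = f (2 * n) + f (2 * n + 1)" for n
  proof -
    have "{n * 2..<n * 2 + 2} = {2 * n, 2 * n + 1}" by auto
    then show ?thesis by simp
  qed
  ultimately have 1: "(\<lambda>n. f (2 * n) + f (2 * n + 1)) sums zeta_ext s" by simp
  \<comment> \<open>f n is the term of the integer n + 1, so the odd indices carry the even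
    integers; subtracting these terms twice makes the series alternate.\<close>
  have f2: "f (2 * n + 1) = 2 powr (- s) * f n" for n
  proof -
    have "of_nat (Suc (2 * n + 1)) = complex_of_real 2 * of_real (real (Suc n))" by simp
    moreover have "(complex_of_real 2 * of_real (real (Suc n))) powr (- s) = of_real 2 powr (- s) * of_real (real (Suc n)) powr (- s)"
      by (rule powr_times_real_left) auto
    ultimately show ?thesis unfolding f_def by simp
  qed
  have "(\<lambda>n. 2 * 2 powr (- s) * f n) sums (2 * 2 powr (- s) * zeta_ext s)"
    by (intro sums_mult f)
  have "f (2 * n) + f (2 * n + 1) - 2 * 2 powr (- s) * f n = f (2 * n) - f (2 * n + 1)" for n
    using f2[of n] by (simp add: algebra_simps)
  with sums_diff[OF 1 \<open>(\<lambda>n. 2 * 2 powr (- s) * f n) sums _\<close>]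
  have "(\<lambda>n. f (2 * n) - f (2 * n + 1)) sums (zeta_ext s - 2 * 2 powr (- s) * zeta_ext s)"
    by (simp only:)
  moreover have "f (2 * n) - f (2 * n + 1) = eta_term n s" for n
    by (simp add: f_def eta_term_def add.commute)
  ultimately have "eta s = zeta_ext s - 2 * 2 powr (- s) * zeta_ext s"
    using eta_sums[of s] s sums_unique2 by auto
  moreover have "2 powr (1 - s) = 2 * 2 powr (- s)"
    by (simp add: powr_diff powr_minus_divide)
  ultimately show ?thesis by (simp add: algebra_simps)
qed

lemma eta_eq_zeta:
  assumes s: "Re s > 0" "s \<noteq> 1"
  shows "eta s = (1 - 2 powr (1 - s)) * zeta_ext s"
proof (rule analytic_continuation_open[of "{z. Re z > 1}" "{z. Re z > 0} - {1}" eta "\<lambda>s. (1 - 2 powr (1 - s)) * zeta_ext s"])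
  show "open {z. Re z > 1}" by (rule open_halfspace_Re_gt)
  show "{z. Re z > 1} \<noteq> {}" by (auto intro: exI[of _ 2])
  show "open ({z. Re z > 0} - {1})" by (intro open_delete open_halfspace_Re_gt)
  show "connected ({z. Re z > 0} - {1})"
    by (intro connected_open_delete convex_connected convex_halfspace_Re_gt open_halfspace_Re_gt) simp
  show "eta holomorphic_on {z. Re z > 0} - {1}"
    by (rule holomorphic_on_subset[OF eta_holomorphic]) auto
  show "(\<lambda>s. (1 - 2 powr (1 - s)) * zeta_ext s) holomorphic_on {z. Re z > 0} - {1}"
    by (intro holomorphic_intros holomorphic_on_subset[OF zeta_ext_holomorphic]) auto
  show "eta z = (1 - 2 powr (1 - z)) * zeta_ext z" if "z \<in> {z. Re z > 1}" for z
    using that by (intro eta_eq_zeta_Re_gt_1) auto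
qed (use s in auto)

text \<open>On the critical line the subtracted power has norm sqrt 2, so the factor stays between
  sqrt 2 - 1 and sqrt 2 + 1. The lower bound carries growth estimates from eta to zeta, the upper
  one carries bounded mean square from zeta to eta.\<close>

lemma eta_factor_crit:
  defines "F \<equiv> \<lambda>t. 1 - 2 powr (1 - Complex (1/2) t)"
  shows "1/4 \<le> norm (F t)" "norm (F t) \<le> 3" "eta (Complex (1/2) t) = F t * zeta_crit t"
proof -
  have "norm (2 powr (1 - Complex (1/2) t)) = 2 powr (1/2)"
    by (subst norm_powr_real_powr) auto
  then have n: "norm (2 powr (1 - Complex (1/2) t)) = sqrt 2" by (simp add: powr_half_sqrt)
  have "(5/4)\<^sup>2 \<le> (2::real)" by (simp add: power2_eq_square)
  then have "5/4 \<le> sqrt 2" by (rule real_le_rsqrt)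
  moreover have "sqrt 2 \<le> 2" by (rule real_le_lsqrt) auto
  moreover have "norm (F t) \<ge> norm (2 powr (1 - Complex (1/2) t)) - norm (1::complex)"
    unfolding F_def by (subst norm_minus_commute) (rule norm_triangle_ineq2)
  moreover have "norm (F t) \<le> norm (1::complex) + norm (2 powr (1 - Complex (1/2) t))"
    unfolding F_def by (rule norm_triangle_ineq4)
  ultimately show "1/4 \<le> norm (F t)" "norm (F t) \<le> 3" using n by auto
  show "eta (Complex (1/2) t) = F t * zeta_crit t"
    unfolding F_def zeta_crit_eq_ext by (rule eta_eq_zeta) (auto simp: complex_eq_iff)
qed

text \<open>The paired eta series is at most |s| times a sum depending only on Re s. This polynomial
  bound is the growth estimate that \<open>F_tail\<close> plays off against the exponential
  weight.\<close>

lemma zeta_crit_linear_bound: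
  obtains C where "C > 0" "\<And>t. t \<ge> 0 \<Longrightarrow> norm (zeta_crit t) \<le> C * (1 + t)"
proof -
  define S where "S = (\<Sum>k. real (2 * k + 1) powr (- (1/2) - 1))"
  have "S \<ge> 0" unfolding S_def by (intro suminf_nonneg summable_odd_powr) auto
  have "norm (zeta_crit t) \<le> (4 * S + 1) * (1 + t)" if "t \<ge> 0" for t
  proof -
    have "(1/4) * norm (zeta_crit t) \<le> norm (eta (Complex (1/2) t))"
      unfolding eta_factor_crit(3) norm_mult by (intro mult_right_mono eta_factor_crit) auto
    also have "\<dots> \<le> norm (Complex (1/2) t) * S"
      using eta_norm_le[of "Complex (1/2) t"] by (simp add: S_def)
    also have "\<dots> \<le> (1 + t) * S"
    proof -
      have "norm (Complex (1/2) t) \<le> \<bar>1/2\<bar> + \<bar>t\<bar>" using cmod_le[of "Complex (1/2) t"] by simp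
      then show ?thesis using that \<open>S \<ge> 0\<close> by (intro mult_right_mono) auto
    qed
    finally show ?thesis using that by (simp add: algebra_simps)
  qed
  then show ?thesis using \<open>S \<ge> 0\<close> by (intro that[of "4 * S + 1"]) auto
qed

section \<open>Divergence of the mean square\<close>

lemma eta_crit_continuous: "continuous_on A (\<lambda>t. eta (Complex (1/2) t))"
  by (rule continuous_on_compose2[OF holomorphic_on_imp_continuous_on[OF eta_holomorphic]])
     (auto intro!: continuous_intros)

text \<open>Since n^(-it) = exp(-it ln n), damping by exp(-\<delta> t) makes each term a multiple of
  exp(-t (\<delta> + i ln n)), the integrand of \<open>Laplace_exp\<close>.\<close>

lemma eta_term_crit:
  "eta_term k (Complex (1/2) t) * exp (- of_real t * of_real \<delta>) =
     of_real (real (2 * k + 1) powr (-1/2)) * exp (- of_real t * Complex \<delta> (ln (real (2 * k + 1)))) -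
     of_real (real (2 * k + 2) powr (-1/2)) * exp (- of_real t * Complex \<delta> (ln (real (2 * k + 2))))"
proof -
  have "of_nat n powr (- Complex (1/2) t) * exp (- of_real t * of_real \<delta>) =
     of_real (real n powr (-1/2)) * exp (- of_real t * Complex \<delta> (ln (real n)))" if "n > 0" for n
  proof -
    have "of_nat n powr (- Complex (1/2) t) = exp (- Complex (1/2) t * of_real (ln (real n)))"
      using that Ln_of_nat[of n] by (simp add: powr_def)
    moreover have "real n powr (-1/2) = exp (- (1/2) * ln (real n))" using that by (simp add: powr_def)
    moreover have "- Complex (1/2) t * of_real (ln (real n)) + (- of_real t * of_real \<delta>) =
        of_real (- (1/2) * ln (real n)) + (- of_real t * Complex \<delta> (ln (real n)))"
      by (simp add: complex_eq_iff algebra_simps)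
    ultimately show ?thesis by (simp only: exp_add[symmetric] exp_of_real[symmetric])
  qed
  from this[of "2 * k + 1"] this[of "2 * k + 2"] show ?thesis
    by (simp only: eta_term_def left_diff_distrib)
qed

text \<open>Term by term, the Laplace transform of the alternating zeta series on the critical line is
  \<open>1/\<delta>\<close> from \<open>n = 1\<close> plus a remainder that stays bounded as \<open>\<delta> \<rightarrow> 0\<close>.\<close>

lemma eta_crit_Laplace:
  obtains K where "K \<ge> 0"
    "\<And>\<delta>. \<delta> > 0 \<Longrightarrow> set_integrable lborel {0..} (\<lambda>t. eta (Complex (1/2) t) * exp (- of_real t * of_real \<delta>))"
    "\<And>\<delta>. \<delta> > 0 \<Longrightarrow> norm ((LBINT t:{0..}. eta (Complex (1/2) t) * exp (- of_real t * of_real \<delta>)) - 1 / of_real \<delta>) \<le> K"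
proof -
  define b where "b = (\<lambda>k. real (2 * k + 1) powr (- (1/2) - 1))"
  have sb: "summable b" unfolding b_def by (rule summable_odd_powr) simp
  define K where "K = (\<Sum>k. 2 * b k)"
  have s2b: "summable (\<lambda>k. 2 * b k)" using sb by (rule summable_mult)
  have "K \<ge> 0" unfolding K_def by (rule suminf_nonneg[OF s2b]) (simp add: b_def)
  moreover have main: "set_integrable lborel {0..} (\<lambda>t. eta (Complex (1/2) t) * exp (- of_real t * of_real \<delta>)) \<and>
      norm ((LBINT t:{0..}. eta (Complex (1/2) t) * exp (- of_real t * of_real \<delta>)) - 1 / of_real \<delta>) \<le> K" if \<delta>: "\<delta> > 0" for \<delta>
  proof -
    define g where "g = (\<lambda>k t. eta_term k (Complex (1/2) t) * exp (- of_real t * of_real \<delta>))"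
    \<comment> \<open>p(n) is the Laplace transform of n^(-1/2 - it) at \<delta>. It is set up as a
      function of a complex variable so that consecutive values can be compared through its
      derivative.\<close>
    define p where "p = (\<lambda>z. z powr (-1/2) / (of_real \<delta> + \<i> * Ln z))"
    define v where "v = (\<lambda>k. p (of_real (real (2 * k + 1))) - p (of_real (real (2 * k + 1) + 1)))"
    have pval: "of_real (x powr (-1/2)) * (1 / Complex \<delta> (ln x)) = p (of_real x)" if "x > 0" for x
    proof -
      have "complex_of_real x powr (-1/2) = of_real (x powr (-1/2))"
        using powr_of_real[of x "-1/2"] that by simp
      moreover have "of_real \<delta> + \<i> * Ln (of_real x) = Complex \<delta> (ln x)"
        using that by (simp add: Ln_of_real complex_eq_iff)
      ultimately show ?thesis by (simp add: p_def)
    qed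
    have L: "set_integrable lborel {0..} (\<lambda>t. of_real (x powr (-1/2)) * exp (- of_real t * Complex \<delta> (ln x)))"
      "(LBINT t:{0..}. of_real (x powr (-1/2)) * exp (- of_real t * Complex \<delta> (ln x))) = p (of_real x)" if "x > 0" for x
    proof -
      show "set_integrable lborel {0..} (\<lambda>t. of_real (x powr (-1/2)) * exp (- of_real t * Complex \<delta> (ln x)))"
        using \<delta> by (intro set_integrable_mult_right Laplace_exp(1)) simp
      show "(LBINT t:{0..}. of_real (x powr (-1/2)) * exp (- of_real t * Complex \<delta> (ln x))) = p (of_real x)"
        unfolding set_integral_mult_right pval[OF that, symmetric] using \<delta> by (subst Laplace_exp(2)) auto
    qed
    have gi: "set_integrable lborel {0..} (g k)" and gv: "(LBINT t:{0..}. g k t) = v k" for k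
    proof -
      have 1: "real (2 * k + 1) + 1 = real (2 * k + 2)" by simp
      note L1 = L[of "real (2 * k + 1)"] and L2 = L[of "real (2 * k + 2)"]
      show "set_integrable lborel {0..} (g k)"
        unfolding g_def eta_term_crit by (intro set_integral_diff(1) L1 L2) auto
      show "(LBINT t:{0..}. g k t) = v k"
        unfolding g_def eta_term_crit v_def 1
        by (subst set_integral_diff(2)) (use L1 L2 in auto)
    qed
    \<comment> \<open>Half of the damping absorbs the factor 1 + t. The constant blows up as
      \<delta> -> 0, which is harmless: this bound only justifies integration term by term.\<close>
    have gb: "norm (g k t) \<le> ((1 + 2 / \<delta>) * exp (- (t * (\<delta> / 2)))) * b k" if "t \<ge> 0" for k t
    proof -
      have "norm (eta_term k (Complex (1/2) t)) \<le> norm (Complex (1/2) t) * b k"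
        using eta_term_bound[of "Complex (1/2) t" k] by (simp add: b_def)
      also have "\<dots> \<le> (1 + t) * b k"
        using cmod_le[of "Complex (1/2) t"] that by (intro mult_right_mono) (auto simp: b_def)
      finally have 1: "norm (eta_term k (Complex (1/2) t)) \<le> (1 + t) * b k" .
      have "1 + t \<le> (1 + 2 / \<delta>) * (1 + t * (\<delta> / 2))"
        using \<delta> that by (simp add: field_simps)
      also have "\<dots> \<le> (1 + 2 / \<delta>) * exp (t * (\<delta> / 2))"
        using \<delta> exp_ge_add_one_self[of "t * (\<delta> / 2)"] by (intro mult_left_mono) auto
      finally have 2: "1 + t \<le> (1 + 2 / \<delta>) * exp (t * (\<delta> / 2))" .
      have "norm (g k t) = norm (eta_term k (Complex (1/2) t)) * exp (- (t * \<delta>))"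
        by (simp add: g_def norm_mult norm_exp_eq_Re)
      also have "\<dots> \<le> ((1 + t) * b k) * exp (- (t * \<delta>))" using 1 by (intro mult_right_mono) auto
      also have "\<dots> \<le> (((1 + 2 / \<delta>) * exp (t * (\<delta> / 2))) * b k) * exp (- (t * \<delta>))"
        using 2 by (intro mult_right_mono) (auto simp: b_def)
      also have "\<dots> = (1 + 2 / \<delta>) * (exp (t * (\<delta> / 2)) * exp (- (t * \<delta>))) * b k" by simp
      also have "exp (t * (\<delta> / 2)) * exp (- (t * \<delta>)) = exp (- (t * (\<delta> / 2)))"
        by (simp add: exp_add[symmetric])
      finally show ?thesis by (simp add: mult.assoc)
    qed
    have dom: "integrable lborel (\<lambda>t. indicator {0..} t *\<^sub>R ((1 + 2 / \<delta>) * exp (- (t * (\<delta> / 2)))))"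
    proof -
      have "set_integrable lborel {0<..} (\<lambda>x. exp (- (x * (\<delta> / 2))))"
        using \<delta> by (intro integrable_I0i_exp_mscale) auto
      then have "set_integrable lborel {0..} (\<lambda>x. exp (- (x * (\<delta> / 2))))"
        unfolding set_integrable_def
        by (rule integrable_discrete_difference[of "{0}", THEN iffD1, rotated -1]) (auto simp: indicator_def)
      then have "set_integrable lborel {0..} (\<lambda>x. (1 + 2 / \<delta>) * exp (- (x * (\<delta> / 2))))"
        by (rule set_integrable_mult_right)
      then show ?thesis unfolding set_integrable_def .
    qed
    define f where "f = (\<lambda>k t. indicator {0..} t *\<^sub>R g k t)"
    have fi: "integrable lborel (f k)" for k using gi unfolding set_integrable_def f_def .
    have fb: "norm (f k t) \<le> (indicator {0..} t *\<^sub>R ((1 + 2 / \<delta>) * exp (- (t * (\<delta> / 2))))) * b k" for k t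
      using gb[of t k] by (auto simp: f_def indicator_def)
    have s1: "AE t in lborel. summable (\<lambda>k. norm (f k t))"
      by (intro AE_I2 summable_comparison_test'[OF summable_mult[OF sb], of 0]) (use fb in auto)
    have s2: "summable (\<lambda>k. LINT t|lborel. norm (f k t))"
    proof (rule summable_comparison_test'[OF summable_mult[OF sb], of 0])
      fix k :: nat
      have "(LINT t|lborel. norm (f k t)) \<le> (LINT t|lborel. (indicator {0..} t *\<^sub>R ((1 + 2 / \<delta>) * exp (- (t * (\<delta> / 2))))) * b k)"
        using fi dom fb by (intro integral_mono integrable_norm integrable_mult_left) auto
      also have "\<dots> = (LINT t|lborel. indicator {0..} t *\<^sub>R ((1 + 2 / \<delta>) * exp (- (t * (\<delta> / 2))))) * b k"
        by (rule integral_mult_left_zero)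
      finally show "norm (LINT t|lborel. norm (f k t)) \<le> (LINT t|lborel. indicator {0..} t *\<^sub>R ((1 + 2 / \<delta>) * exp (- (t * (\<delta> / 2))))) * b k"
        by simp
    qed
    have fsum: "(\<Sum>k. f k t) = indicator {0..} t *\<^sub>R (eta (Complex (1/2) t) * exp (- of_real t * of_real \<delta>))" for t
    proof -
      have "(\<lambda>k. g k t) sums (eta (Complex (1/2) t) * exp (- of_real t * of_real \<delta>))"
        unfolding g_def by (intro sums_mult2 eta_sums) simp
      then have "(\<lambda>k. f k t) sums (indicator {0..} t *\<^sub>R (eta (Complex (1/2) t) * exp (- of_real t * of_real \<delta>)))"
        unfolding f_def by (rule sums_scaleR_right)
      then show ?thesis by (simp add: sums_unique[symmetric])
    qed
    define I where "I = (LBINT t:{0..}. eta (Complex (1/2) t) * exp (- of_real t * of_real \<delta>))"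
    have int: "set_integrable lborel {0..} (\<lambda>t. eta (Complex (1/2) t) * exp (- of_real t * of_real \<delta>))"
      using integrable_suminf[OF fi s1 s2] unfolding fsum set_integrable_def .
    have "(\<lambda>k. integral\<^sup>L lborel (f k)) sums (LINT t|lborel. (\<Sum>k. f k t))"
      by (rule sums_integral[OF fi s1 s2])
    moreover have "integral\<^sup>L lborel (f k) = v k" for k
      using gv[of k] unfolding f_def set_lebesgue_integral_def .
    ultimately have v: "v sums I" unfolding fsum I_def set_lebesgue_integral_def by simp
    have "(\<lambda>k. if k = 0 then 1 / complex_of_real \<delta> else 0) sums (1 / of_real \<delta>)"
      using sums_single[of 0 "\<lambda>_. 1 / complex_of_real \<delta>"] by simp
    from sums_diff[OF v this] have v': "(\<lambda>k. v k - (if k = 0 then 1 / of_real \<delta> else 0)) sums (I - 1 / of_real \<delta>)" .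
    \<comment> \<open>For k = 0 the main term 1/\<delta> = p(1) cancels and -p(2) is left, bounded
      because ln 2 >= 1/2. For k >= 1 all arguments are at least 3, so ln x >= 1 keeps the
      denominators away from 0 uniformly in \<delta>.\<close>
    have vb: "norm (v k - (if k = 0 then 1 / of_real \<delta> else 0)) \<le> 2 * b k" for k
    proof (cases "k = 0")
      case True
      have "p 1 = 1 / of_real \<delta>" by (simp add: p_def)
      then have "v 0 - 1 / of_real \<delta> = - p 2"
        by (simp add: v_def)
      moreover have "norm (p 2) \<le> 2"
      proof -
        have "p 2 = of_real (2 powr (-1/2)) * (1 / Complex \<delta> (ln 2))" using pval[of 2] by simp
        then have "norm (p 2) = 2 powr (-1/2) / norm (Complex \<delta> (ln 2))" by (simp add: norm_mult norm_divide)
        also have "\<dots> \<le> 1 / (1/2)"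
        proof (rule frac_le)
          show "2 powr (-1/2) \<le> (1::real)" using powr_mono[of "-1/2" 0 "2::real"] by simp
          have "1/2 \<le> ln (2::real)" using ln_2_less_1 ln2_ge_two_thirds by simp
          also have "\<dots> \<le> norm (Complex \<delta> (ln 2))" using abs_Im_le_cmod[of "Complex \<delta> (ln 2)"] by simp
          finally show "1/2 \<le> norm (Complex \<delta> (ln 2))" .
        qed auto
        finally show ?thesis by simp
      qed
      ultimately show ?thesis using True by (simp add: b_def)
    next
      case False
      have "norm (v k) \<le> 2 * b k"
        unfolding v_def
      proof (rule unit_step_bound[where f' = "\<lambda>z. ((-1/2) * z powr (-1/2 - 1)) / (of_real \<delta> + \<i> * Ln z) - z powr (-1/2) * (\<i> * (1 / z)) / (of_real \<delta> + \<i> * Ln z)\<^sup>2"])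
        fix x assume x: "x \<in> {real (2 * k + 1)..real (2 * k + 1) + 1}"
        define D where "D = of_real \<delta> + \<i> * Ln (complex_of_real x)"
        have x3: "x \<ge> 3" using x False by auto
        have D: "D = Complex \<delta> (ln x)" unfolding D_def using x3 by (simp add: Ln_of_real complex_eq_iff)
        have "1 \<le> ln x"
        proof -
          have "exp 1 \<le> x" using x3 exp_le by linarith
          then show ?thesis using x3 by (subst ln_ge_iff) auto
        qed
        also have "\<dots> \<le> norm D" using abs_Im_le_cmod[of D] by (simp add: D)
        finally have D1: "norm D \<ge> 1" .
        then have D0: "D \<noteq> 0" by auto
        have nonpos: "complex_of_real x \<notin> \<real>\<^sub>\<le>\<^sub>0" using x3 by (simp add: complex_nonpos_Reals_iff)
        show "(p has_field_derivative ((-1/2) * of_real x powr (-1/2 - 1)) / (of_real \<delta> + \<i> * Ln (of_real x)) - of_real x powr (-1/2) * (\<i> * (1 / of_real x)) / (of_real \<delta> + \<i> * Ln (of_real x))\<^sup>2) (at (of_real x))"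
          unfolding p_def
        proof (rule DERIV_cong)
          show "((\<lambda>z. z powr (-1/2) / (of_real \<delta> + \<i> * Ln z)) has_field_derivative
             ((-1/2) * of_real x powr (-1/2 - 1) * D - of_real x powr (-1/2) * (\<i> * (1 / of_real x))) / (D * D)) (at (of_real x))"
            unfolding D_def
          proof (rule DERIV_divide)
              show "((\<lambda>z. z powr (-1/2)) has_field_derivative (-1/2) * of_real x powr (-1/2 - 1)) (at (complex_of_real x))"
                by (rule has_field_derivative_powr[OF nonpos])
              have "(Ln has_field_derivative 1 / of_real x) (at (complex_of_real x))"
                using has_field_derivative_Ln[OF nonpos] by (simp add: divide_inverse)
              then have "((\<lambda>z. of_real \<delta> + \<i> * Ln z) has_field_derivative 0 + \<i> * (1 / of_real x)) (at (complex_of_real x))"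
                by (intro DERIV_add DERIV_const DERIV_cmult)
              then show "((\<lambda>z. of_real \<delta> + \<i> * Ln z) has_field_derivative \<i> * (1 / of_real x)) (at (complex_of_real x))"
                by simp
              show "of_real \<delta> + \<i> * Ln (complex_of_real x) \<noteq> 0" using D0 by (simp add: D_def)
            qed
          show "((-1/2) * of_real x powr (-1/2 - 1) * D - of_real x powr (-1/2) * (\<i> * (1 / of_real x))) / (D * D) =
             ((-1/2) * of_real x powr (-1/2 - 1)) / (of_real \<delta> + \<i> * Ln (of_real x)) - of_real x powr (-1/2) * (\<i> * (1 / of_real x)) / (of_real \<delta> + \<i> * Ln (of_real x))\<^sup>2"
            unfolding D_def[symmetric] using D0 by (simp add: diff_divide_distrib power2_eq_square)
        qed
        have n1: "norm (complex_of_real x powr (-1/2 - 1)) = x powr (- (1/2) - 1)"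
          using x3 by (subst norm_powr_real_powr) auto
        have n2: "norm (complex_of_real x powr (-1/2) * (\<i> * (1 / of_real x))) = x powr (- (1/2) - 1)"
        proof -
          have "norm (complex_of_real x powr (-1/2)) = x powr (- (1/2))"
            using x3 by (subst norm_powr_real_powr) auto
          moreover have "norm (\<i> * (1 / complex_of_real x)) = 1 / x" using x3 by (simp add: norm_mult norm_divide)
          moreover have "x powr (- (1/2)) * (1 / x) = x powr (- (1/2) - 1)" using x3 powr_diff[of x "- (1/2)" 1] by simp
          ultimately show ?thesis by (simp only: norm_mult)
        qed
        have "norm (((-1/2) * of_real x powr (-1/2 - 1)) / D - of_real x powr (-1/2) * (\<i> * (1 / of_real x)) / D\<^sup>2)
           \<le> norm (((-1/2) * of_real x powr (-1/2 - 1)) / D) + norm (of_real x powr (-1/2) * (\<i> * (1 / of_real x)) / D\<^sup>2)"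
          by (rule norm_triangle_ineq4)
        also have "\<dots> = (1/2) * x powr (- (1/2) - 1) / norm D + x powr (- (1/2) - 1) / (norm D)\<^sup>2"
        proof -
          have "norm ((-1/2) * complex_of_real x powr (-1/2 - 1)) = (1/2) * x powr (- (1/2) - 1)"
            unfolding norm_mult n1 by simp
          then show ?thesis by (simp only: norm_divide norm_power n2)
        qed
        also have "\<dots> \<le> (1/2) * x powr (- (1/2) - 1) / 1 + x powr (- (1/2) - 1) / 1"
          using D1 by (intro add_mono frac_le one_le_power) auto
        also have "\<dots> \<le> 2 * x powr (- (1/2) - 1)" by simp
        also have "\<dots> \<le> 2 * b k"
          unfolding b_def using x by (intro mult_left_mono powr_mono2') auto
        finally show "norm ((-1/2) * of_real x powr (-1/2 - 1) / (of_real \<delta> + \<i> * Ln (of_real x)) - of_real x powr (-1/2) * (\<i> * (1 / of_real x)) / (of_real \<delta> + \<i> * Ln (of_real x))\<^sup>2) \<le> 2 * b k"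
          unfolding D_def .
      qed
      then show ?thesis using False by simp
    qed
    have "norm (I - 1 / of_real \<delta>) \<le> K"
      unfolding sums_unique[OF v'] K_def by (rule norm_suminf_le[OF vb s2b])
    then show ?thesis using int by (simp add: I_def)
  qed
  ultimately show ?thesis using that by blast
qed

lemma integral_exp_minus_le:
  fixes c T :: real
  assumes "c > 0" "T \<ge> 0"
  shows "integral {0..T} (\<lambda>t. exp (- (t * c))) \<le> 1 / c"
proof -
  define F where "F = (\<lambda>t. - exp (- (t * c)) / c)"
  have "((\<lambda>t. exp (- (t * c))) has_integral (F T - F 0)) {0..T}"
    unfolding F_def using assms
    by (intro fundamental_theorem_of_calculus[where f = "\<lambda>t::real. - exp (- (t * c)) / c"])
      (auto intro!: derivative_eq_intros simp: has_real_derivative_iff_has_vector_derivative[symmetric])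
  then have "integral {0..T} (\<lambda>t. exp (- (t * c))) = F T - F 0" by (rule integral_unique)
  also have "\<dots> \<le> 1 / c" using assms by (simp add: F_def field_simps)
  finally show ?thesis .
qed

theorem zeta_crit_mean_square_unbounded:
  "\<exists>T\<ge>0. integral {0..T} (\<lambda>t. (norm (zeta_crit t))\<^sup>2) > A"
proof (rule ccontr)
  assume "\<not> ?thesis"
  then have bd: "integral {0..T} (\<lambda>t. (norm (zeta_crit t))\<^sup>2) \<le> A" if "T \<ge> 0" for T using that by force
  have "A \<ge> 0" using bd[of 0] by simp
  define e where "e = (\<lambda>t. eta (Complex (1/2) t))"
  define B where "B = 9 * A"
  have "B \<ge> 0" using \<open>A \<ge> 0\<close> by (simp add: B_def)
  have ce: "continuous_on S e" for S unfolding e_def by (rule eta_crit_continuous)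
  have eB: "integral {0..T} (\<lambda>t. (norm (e t))\<^sup>2) \<le> B" if "T \<ge> 0" for T
  proof -
    have "integral {0..T} (\<lambda>t. (norm (e t))\<^sup>2) \<le> integral {0..T} (\<lambda>t. 9 * (norm (zeta_crit t))\<^sup>2)"
    proof (rule integral_le)
      fix t
      have "norm (e t) \<le> 3 * norm (zeta_crit t)"
        unfolding e_def eta_factor_crit(3) norm_mult by (intro mult_right_mono eta_factor_crit) auto
      then have "(norm (e t))\<^sup>2 \<le> (3 * norm (zeta_crit t))\<^sup>2" by (intro power_mono) auto
      then show "(norm (e t))\<^sup>2 \<le> 9 * (norm (zeta_crit t))\<^sup>2" by (simp add: power_mult_distrib)
    qed (auto intro!: integrable_continuous_real continuous_intros ce zeta_crit_continuous)
    also have "\<dots> \<le> B" using bd[OF that] by (simp add: B_def)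
    finally show ?thesis .
  qed
  obtain K where K: "K \<ge> 0"
    "\<And>\<delta>. \<delta> > 0 \<Longrightarrow> set_integrable lborel {0..} (\<lambda>t. e t * exp (- of_real t * of_real \<delta>))"
    "\<And>\<delta>. \<delta> > 0 \<Longrightarrow> norm ((LBINT t:{0..}. e t * exp (- of_real t * of_real \<delta>)) - 1 / of_real \<delta>) \<le> K"
    using eta_crit_Laplace unfolding e_def by blast
  define \<delta> where "\<delta> = 1 / (4 * (K + B + 1))"
  have \<delta>: "\<delta> > 0" using K(1) \<open>B \<ge> 0\<close> by (simp add: \<delta>_def)
  define I where "I = (LBINT t:{0..}. e t * exp (- of_real t * of_real \<delta>))"
  \<comment> \<open>M B <= 1 keeps the first term of \<open>trunc\<close> below 1/(2 \<delta>), and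
    the second is (B + 1)/4 for any \<delta>. As 1/\<delta> = 4 (K + B + 1), the other half of
    1/\<delta> exceeds (B + 1)/4 + K.\<close>
  define M where "M = 1 / (B + 1)"
  have M: "M > 0" using \<open>B \<ge> 0\<close> by (simp add: M_def)
  have trunc: "norm (LBINT t:{0..T}. e t * exp (- of_real t * of_real \<delta>)) \<le> M * B / (2 * \<delta>) + 1 / (4 * M)" if "T \<ge> 0" for T
  proof -
    have "(LBINT t:{0..T}. e t * exp (- of_real t * of_real \<delta>)) = integral {0..T} (\<lambda>t. e t * exp (- of_real t * of_real \<delta>))"
      by (intro set_borel_integral_eq_integral(2) set_integrable_subset[OF K(2)[OF \<delta>]]) auto
    also have "norm \<dots> \<le> integral {0..T} (\<lambda>t. M / (2 * \<delta>) * (norm (e t))\<^sup>2 + \<delta> / (2 * M) * exp (- (t * (2 * \<delta>))))"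
    proof (rule integral_norm_bound_integral)
      fix t
      define x y where "x = norm (e t)" and "y = exp (- (t * \<delta>))"
      \<comment> \<open>The Cauchy-Schwarz inequality in pointwise weighted form: expanding this
        square bounds the product x y by separate multiples of x^2 and y^2.\<close>
      have "0 \<le> (M * x - \<delta> * y)\<^sup>2 / (2 * M * \<delta>)" using M \<delta> by simp
      also have "\<dots> = M / (2 * \<delta>) * x\<^sup>2 + \<delta> / (2 * M) * y\<^sup>2 - x * y"
        using M \<delta> by (simp add: power2_eq_square field_simps)
      finally have "x * y \<le> M / (2 * \<delta>) * x\<^sup>2 + \<delta> / (2 * M) * y\<^sup>2" by simp
      moreover have "y\<^sup>2 = exp (- (t * (2 * \<delta>)))"
        by (simp add: y_def power2_eq_square exp_add[symmetric])
      moreover have "norm (e t * exp (- of_real t * of_real \<delta>)) = x * y"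
        by (simp add: x_def y_def norm_mult norm_exp_eq_Re)
      ultimately show "norm (e t * exp (- of_real t * of_real \<delta>)) \<le> M / (2 * \<delta>) * (norm (e t))\<^sup>2 + \<delta> / (2 * M) * exp (- (t * (2 * \<delta>)))"
        by (simp add: x_def)
    qed (use M \<delta> in \<open>auto intro!: integrable_continuous_real continuous_intros ce\<close>)
    also have "\<dots> = M / (2 * \<delta>) * integral {0..T} (\<lambda>t. (norm (e t))\<^sup>2) + \<delta> / (2 * M) * integral {0..T} (\<lambda>t. exp (- (t * (2 * \<delta>))))"
      by (subst integral_add) (use M \<delta> in \<open>auto intro!: integrable_continuous_real continuous_intros ce\<close>)
    also have "\<dots> \<le> M / (2 * \<delta>) * B + \<delta> / (2 * M) * (1 / (2 * \<delta>))"
      using M \<delta> that by (intro add_mono mult_left_mono eB integral_exp_minus_le) auto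
    also have "\<dots> = M * B / (2 * \<delta>) + 1 / (4 * M)" using M \<delta> by (simp add: field_simps)
    finally show ?thesis .
  qed
  have "((\<lambda>b. LBINT t:{0..b}. e t * exp (- of_real t * of_real \<delta>)) \<longlongrightarrow> I) at_top"
    unfolding I_def by (rule tendsto_set_lebesgue_integral_at_top) (use K(2)[OF \<delta>] in auto)
  then have "((\<lambda>b. norm (LBINT t:{0..b}. e t * exp (- of_real t * of_real \<delta>))) \<longlongrightarrow> norm I) at_top"
    by (rule tendsto_norm)
  then have I1: "norm I \<le> M * B / (2 * \<delta>) + 1 / (4 * M)"
  proof (rule tendsto_upperbound)
    show "\<forall>\<^sub>F b in at_top. norm (LBINT t:{0..b}. e t * exp (- of_real t * of_real \<delta>)) \<le> M * B / (2 * \<delta>) + 1 / (4 * M)"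
      using eventually_ge_at_top[of 0] by eventually_elim (rule trunc)
  qed simp
  have "1 / \<delta> = norm (1 / complex_of_real \<delta>)" using \<delta> by (simp add: norm_divide)
  also have "\<dots> \<le> norm I + norm (I - 1 / of_real \<delta>)"
    by (metis norm_minus_commute norm_triangle_sub)
  also have "\<dots> \<le> (M * B / (2 * \<delta>) + 1 / (4 * M)) + K" using I1 K(3)[OF \<delta>] by (simp add: I_def)
  also have "M * B \<le> 1" using \<open>B \<ge> 0\<close> by (simp add: M_def)
  then have "M * B / (2 * \<delta>) + 1 / (4 * M) + K \<le> 1 / (2 * \<delta>) + 1 / (4 * M) + K"
    using \<delta> by (simp add: divide_right_mono)
  also have "\<dots> = 2 * (K + B + 1) + (B + 1) / 4 + K" by (simp add: M_def \<delta>_def)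
  finally have "4 * (K + B + 1) \<le> 2 * (K + B + 1) + (B + 1) / 4 + K" by (simp add: \<delta>_def)
  then show False using K(1) \<open>B \<ge> 0\<close> by (simp add: field_simps)
qed

section \<open>The logarithmic kernel\<close>

lemma log_kernel_pos:
  fixes a :: real assumes "0 < a" "a < 1"
  shows "(1 - a)\<^sup>2 \<le> 1 + a\<^sup>2 - 2 * a * cos \<theta>" "1 + a\<^sup>2 - 2 * a * cos \<theta> \<le> (1 + a)\<^sup>2" "0 < 1 + a\<^sup>2 - 2 * a * cos \<theta>"
proof -
  have "a * cos \<theta> \<le> a * 1" "a * (-1) \<le> a * cos \<theta>" using assms by (intro mult_left_mono; simp)+
  then show 1: "(1 - a)\<^sup>2 \<le> 1 + a\<^sup>2 - 2 * a * cos \<theta>" "1 + a\<^sup>2 - 2 * a * cos \<theta> \<le> (1 + a)\<^sup>2"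
    by (auto simp: power2_eq_square algebra_simps)
  have "0 < (1 - a)\<^sup>2" using assms by simp
  then show "0 < 1 + a\<^sup>2 - 2 * a * cos \<theta>" using 1 by linarith
qed

lemma log_kernel_continuous:
  fixes a :: real assumes "0 < a" "a < 1"
  shows "continuous_on A (\<lambda>\<theta>. ln (1 + a\<^sup>2 - 2 * a * cos \<theta>))"
  using log_kernel_pos(3)[OF assms] by (intro continuous_intros) (auto simp: less_imp_neq[symmetric])

text \<open>The mean value property of the harmonic function \<open>ln |1 - a z|\<close> over the unit circle.\<close>

lemma integral_log_kernel:
  fixes a :: real assumes a: "0 < a" "a < 1"
  shows "integral {0..pi} (\<lambda>\<theta>. ln (1 + a\<^sup>2 - 2 * a * cos \<theta>)) = 0"
proof -
  define H where "H = (\<lambda>\<theta>. ln (1 + a\<^sup>2 - 2 * a * cos \<theta>))"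
  have cH: "continuous_on A H" for A unfolding H_def using a by (rule log_kernel_continuous)
  define J where "J = integral {0..pi} H"
  have J: "(H has_integral J) (cbox 0 pi)"
    unfolding J_def by (auto intro!: integrable_integral integrable_continuous_real cH)
  \<comment> \<open>The kernel is symmetric about pi, so the full circle, parametrised by [0, 1],
    counts the integral over [0, pi] twice.\<close>
  have "((\<lambda>x. H (2 * pi * x)) has_integral (J / (2 * pi))) {0..1/2}"
    using has_integral_affinity[OF J, of "2 * pi" 0] by (simp add: image_affinity_atLeastAtMost)
  moreover have "((\<lambda>x. H (2 * pi * x)) has_integral (J / (2 * pi))) {1/2..1}"
  proof -
    have "H (- (2 * pi * x) + 2 * pi) = H (2 * pi * x)" for x
      by (simp add: H_def cos_add)
    moreover have "(\<lambda>x. - (x / (2 * pi)) + 1) ` {0..pi} = {1/2..1}"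
      using image_affinity_atLeastAtMost[of "- (1 / (2 * pi))" 1 0 pi] pi_gt_zero
      by (simp add: not_le[THEN iffD2])
    ultimately show ?thesis
      using has_integral_affinity[OF J, of "- (2 * pi)" "2 * pi"] by simp
  qed
  ultimately have "((\<lambda>x. H (2 * pi * x)) has_integral (J / (2 * pi) + J / (2 * pi))) {0..1}"
    by (intro has_integral_combine[of 0 "1/2" 1]) auto
  moreover have "((\<lambda>x. H (2 * pi * x)) has_integral 0) {0..1}"
  proof -
    have "(\<lambda>z. Ln (1 - of_real a * z)) holomorphic_on cball 0 1"
    proof (intro holomorphic_intros)
      fix z :: complex assume "z \<in> cball 0 1"
      then have "a * norm z \<le> a * 1" using a by (intro mult_left_mono) auto
      moreover have "a * Re z \<le> a * norm z" using a by (intro mult_left_mono complex_Re_le_cmod) auto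
      ultimately have "a * Re z < 1" using a by linarith
      then have "Re (of_real a * z) < 1" by simp
      then show "1 - of_real a * z \<notin> \<real>\<^sub>\<le>\<^sub>0" by (simp add: complex_nonpos_Reals_iff)
    qed
    from Cauchy_integral_circlepath_simple[OF this, of 0]
    have "((\<lambda>z. Ln (1 - of_real a * z) / z) has_contour_integral 0) (circlepath 0 1)" by simp
    then have "((\<lambda>x. Ln (1 - of_real a * circlepath 0 1 x) / circlepath 0 1 x * vector_derivative (circlepath 0 1) (at x within {0..1})) has_integral 0) {0..1}"
      by (simp add: has_contour_integral_def)
    then have "((\<lambda>x. Ln (1 - of_real a * exp (2 * of_real pi * \<i> * of_real x)) * (2 * of_real pi * \<i>)) has_integral 0) {0..1}"
    proof (rule has_integral_eq[rotated])
      fix x :: real assume "x \<in> {0..1}"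
      then show "Ln (1 - of_real a * circlepath 0 1 x) / circlepath 0 1 x * vector_derivative (circlepath 0 1) (at x within {0..1}) =
          Ln (1 - of_real a * exp (2 * of_real pi * \<i> * of_real x)) * (2 * of_real pi * \<i>)"
      proof -
        have vd: "vector_derivative (circlepath 0 1) (at x within {0..1}) = 2 * of_real pi * \<i> * of_real 1 * exp (2 * of_real pi * \<i> * of_real x)"
          using \<open>x \<in> {0..1}\<close> by (subst vector_derivative_circlepath01) auto
        have cx: "circlepath 0 1 x = exp (2 * of_real pi * \<i> * of_real x)" by (simp add: circlepath)
        show ?thesis unfolding vd cx by simp
      qed
    qed
    \<comment> \<open>The factor 2 pi i from the parametrisation moves Re Ln into the imaginary
      part, and twice Re Ln(1 - a z) is the kernel.\<close>
    from has_integral_linear[OF this bounded_linear_Im]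
    have "((\<lambda>x. Im (Ln (1 - of_real a * exp (2 * of_real pi * \<i> * of_real x)) * (2 * of_real pi * \<i>))) has_integral 0) {0..1}"
      by (simp add: o_def)
    moreover have "Im (Ln (1 - of_real a * exp (2 * of_real pi * \<i> * of_real x)) * (2 * of_real pi * \<i>)) = pi * H (2 * pi * x)" for x
    proof -
      define z where "z = 1 - of_real a * exp (2 * of_real pi * \<i> * of_real x)"
      have "(norm z)\<^sup>2 = (1 - a * cos (2 * pi * x))\<^sup>2 + (a * sin (2 * pi * x))\<^sup>2"
        unfolding cmod_power2 z_def by (simp add: Re_exp Im_exp)
      also have "(1 - a * c)\<^sup>2 + (a * s)\<^sup>2 = 1 + a\<^sup>2 * (c\<^sup>2 + s\<^sup>2) - 2 * a * c" for c s :: real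
        by (simp add: power2_eq_square algebra_simps)
      finally have n: "(norm z)\<^sup>2 = 1 + a\<^sup>2 - 2 * a * cos (2 * pi * x)" by simp
      then have "norm z > 0" using log_kernel_pos(3)[OF a] by (metis zero_less_norm_iff norm_zero power_zero_numeral less_irrefl)
      then have "H (2 * pi * x) = 2 * ln (norm z)" unfolding H_def n[symmetric] by (simp add: ln_realpow)
      moreover have "Re (Ln z) = ln (norm z)" using \<open>norm z > 0\<close> by (intro Re_Ln) auto
      ultimately show ?thesis unfolding z_def[symmetric] by simp
    qed
    ultimately have "((\<lambda>x. pi * H (2 * pi * x)) has_integral 0) {0..1}" by (simp only:)
    from has_integral_mult_right[OF this, of "1 / pi"] show ?thesis by simp
  qed
  ultimately have "J / (2 * pi) + J / (2 * pi) = 0" by (rule has_integral_unique)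
  then show ?thesis by (simp add: J_def H_def)
qed

lemma integral_pos_if_pos_somewhere:
  fixes k :: "real \<Rightarrow> real"
  assumes "continuous_on {p..q} k" "\<And>t. t \<in> {p..q} \<Longrightarrow> k t \<ge> 0" "t0 \<in> {p<..<q}" "k t0 > 0"
  shows "integral {p..q} k > 0"
proof -
  have "integral {p..q} k \<ge> 0" using assms by (intro integral_nonneg integrable_continuous_real) auto
  moreover have "integral {p..q} k \<noteq> 0"
    using assms by (subst integral_eq_0_iff) (auto simp: less_imp_neq[symmetric] intro!: bexI[of _ t0])
  ultimately show ?thesis by simp
qed

text \<open>At \<open>arccos (a / 2)\<close> one has 2 a cos \<theta> = a^2, so the logarithm
  vanishes there and is negative before. Thus the windows of the theorem are split at the sign
  change of the kernel, and the denominator has a main term different from 0.\<close>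

lemma integral_log_kernel_neg:
  fixes a :: real assumes a: "0 < a" "a < 1"
  shows "integral {0..arccos (a / 2)} (\<lambda>\<theta>. ln (1 + a\<^sup>2 - 2 * a * cos \<theta>)) < 0"
proof -
  define \<tau> where "\<tau> = arccos (a / 2)"
  have tau: "0 < \<tau>" "\<tau> < pi" "cos \<tau> = a / 2"
    using a arccos_lt_bounded[of "a/2"] by (auto simp: \<tau>_def)
  have neg: "ln (1 + a\<^sup>2 - 2 * a * cos \<theta>) < 0" if "\<theta> \<in> {0..<\<tau>}" for \<theta>
  proof -
    have "cos \<theta> > a / 2" using cos_monotone_0_pi[of \<theta> \<tau>] that tau by auto
    then have "a * (a / 2) < a * cos \<theta>" using a by (intro mult_strict_left_mono) auto
    then show ?thesis using log_kernel_pos(3)[OF a, of \<theta>] by (simp add: power2_eq_square)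
  qed
  have "integral {0..\<tau>} (\<lambda>\<theta>. - ln (1 + a\<^sup>2 - 2 * a * cos \<theta>)) > 0"
  proof (rule integral_pos_if_pos_somewhere)
    show "continuous_on {0..\<tau>} (\<lambda>\<theta>. - ln (1 + a\<^sup>2 - 2 * a * cos \<theta>))"
      by (intro continuous_intros log_kernel_continuous a)
    show "- ln (1 + a\<^sup>2 - 2 * a * cos t) \<ge> 0" if "t \<in> {0..\<tau>}" for t
      using neg[of t] that tau by (cases "t = \<tau>") (auto simp: power2_eq_square)
    show "\<tau> / 2 \<in> {0<..<\<tau>}" using tau by simp
    show "- ln (1 + a\<^sup>2 - 2 * a * cos (\<tau> / 2)) > 0" using neg[of "\<tau>/2"] tau by simp
  qed
  then show ?thesis by (simp add: \<tau>_def)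
qed

lemma log_kernel_Lipschitz:
  fixes a :: real assumes a: "0 < a" "a < 1"
  shows "\<bar>ln (1 + a\<^sup>2 - 2 * a * cos x) - ln (1 + a\<^sup>2 - 2 * a * cos y)\<bar> \<le> (2 * a / (1 - a)\<^sup>2) * \<bar>x - y\<bar>"
proof -
  have "norm (ln (1 + a\<^sup>2 - 2 * a * cos x) - ln (1 + a\<^sup>2 - 2 * a * cos y)) \<le> (2 * a / (1 - a)\<^sup>2) * norm (x - y)"
  proof (rule field_differentiable_bound[of UNIV _ "\<lambda>z. 2 * a * sin z / (1 + a\<^sup>2 - 2 * a * cos z)"])
    fix z :: real
    show "((\<lambda>z. ln (1 + a\<^sup>2 - 2 * a * cos z)) has_field_derivative 2 * a * sin z / (1 + a\<^sup>2 - 2 * a * cos z)) (at z within UNIV)"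
      using log_kernel_pos(3)[OF a, of z] by (auto intro!: derivative_eq_intros)
    have "2 * a * \<bar>sin z\<bar> \<le> 2 * a * 1" using a by (intro mult_left_mono) auto
    then show "norm (2 * a * sin z / (1 + a\<^sup>2 - 2 * a * cos z)) \<le> 2 * a / (1 - a)\<^sup>2"
      using a log_kernel_pos[OF a, of z] by (auto simp: abs_mult intro!: frac_le)
  qed auto
  then show ?thesis by simp
qed

lemma log_kernel_bounded:
  fixes a :: real assumes a: "0 < a" "a < 1"
  shows "\<bar>ln (1 + a\<^sup>2 - 2 * a * cos x)\<bar> \<le> \<bar>ln ((1 - a)\<^sup>2)\<bar> + \<bar>ln ((1 + a)\<^sup>2)\<bar>"
proof -
  have "ln ((1 - a)\<^sup>2) \<le> ln (1 + a\<^sup>2 - 2 * a * cos x)" "ln (1 + a\<^sup>2 - 2 * a * cos x) \<le> ln ((1 + a)\<^sup>2)"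
    using a log_kernel_pos[OF a, of x] by (auto intro!: ln_mono)
  then show ?thesis by linarith
qed

section \<open>Jacob's ladders\<close>

text \<open>The interface between zeta and the ladder: \<open>w_pos\<close> gives strict
  monotonicity, \<open>w_unbounded\<close> unboundedness of the ladder, and \<open>w_bound\<close>
  control of the tail near \<open>\<mu> y\<close>.\<close>

locale ladder =
  fixes w \<mu> \<phi> :: "real \<Rightarrow> real" and y0 T0 C :: real
  assumes w_cont: "continuous_on {0..} w"
    and w_nonneg: "\<And>t. w t \<ge> 0"
    and w_bound: "\<And>t. t \<ge> 0 \<Longrightarrow> w t \<le> C * (1 + t)\<^sup>2"
    and w_pos: "\<And>p q. 0 \<le> p \<Longrightarrow> p < q \<Longrightarrow> \<exists>t\<in>{p<..<q}. w t > 0"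
    and w_unbounded: "\<And>A. \<exists>T\<ge>0. integral {0..T} w > A"
    and y0: "y0 > 0"
    and mu_mono: "mono_on {y0..} \<mu>"
    and mu_ge: "\<And>y. y \<ge> y0 \<Longrightarrow> \<mu> y \<ge> 7 * y * ln y"
    and T0: "T0 > 0"
    and phi_ge: "\<And>T. T \<ge> T0 \<Longrightarrow> \<phi> T \<ge> y0"
    and phi_eq: "\<And>T. T \<ge> T0 \<Longrightarrow>
      integral {0..\<mu> (\<phi> T)} (\<lambda>t. w t * exp (- (2 / \<phi> T) * t)) = integral {0..T} w"
begin

definition G :: "real \<Rightarrow> real" where "G T = integral {0..T} w"

definition F :: "real \<Rightarrow> real" where "F y = integral {0..\<mu> y} (\<lambda>t. w t * exp (- (2 / y) * t))"

definition inv_ladder :: "real \<Rightarrow> real" where "inv_ladder = inv_into {T0..} (\<lambda>t. \<phi> t / 2)"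

section \<open>Monotonicity, range and continuity of the ladder\<close>

lemma C_nonneg: "C \<ge> 0"
  using w_bound[of 0] w_nonneg[of 0] by simp

lemma w_cont': "0 \<le> p \<Longrightarrow> continuous_on {p..q} w"
  by (rule continuous_on_subset[OF w_cont]) auto

lemma w_exp_cont: "0 \<le> p \<Longrightarrow> continuous_on {p..q} (\<lambda>t. w t * exp (c * t))"
  by (intro continuous_intros w_cont')

lemma G_diff: "0 \<le> p \<Longrightarrow> p \<le> q \<Longrightarrow> G q - G p = integral {p..q} w"
  using Henstock_Kurzweil_Integration.integral_combine[of 0 p q w]
  by (simp add: G_def integrable_continuous_real w_cont')

lemma G_strict: "0 \<le> p \<Longrightarrow> p < q \<Longrightarrow> G p < G q"
proof -
  assume pq: "0 \<le> p" "p < q"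
  obtain t0 where "t0 \<in> {p<..<q}" "w t0 > 0" using w_pos[OF pq] by blast
  then have "integral {p..q} w > 0"
    using pq w_nonneg by (intro integral_pos_if_pos_somewhere[of p q w t0] w_cont') auto
  then show ?thesis using G_diff[of p q] pq by simp
qed

lemma G_cont: "0 \<le> q \<Longrightarrow> continuous_on {0..q} G"
  unfolding G_def by (rule indefinite_integral_continuous_1) (auto intro!: integrable_continuous_real w_cont')

lemma F_nonneg: "F y \<ge> 0"
proof (cases "\<mu> y \<ge> 0")
  case True
  then show ?thesis
    unfolding F_def using w_nonneg by (intro integral_nonneg integrable_continuous_real w_exp_cont) auto
qed (simp add: F_def)

text \<open>Over an empty or one-point interval the integral is 0. Nonpositive values of \<mu> can
  occur for small y, where the lower bound 7 y ln y is negative.\<close>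

lemma F_pos_imp: "F y > 0 \<Longrightarrow> \<mu> y > 0"
  by (rule ccontr) (cases "\<mu> y = 0", auto simp: F_def not_less)

text \<open>The upper limit can only grow, and the weight exp(-2t/y) strictly increases in y for
  each t > 0; strictness is drawn from the weight at a point where w is positive.\<close>

lemma F_strict:
  assumes "y0 \<le> y" "y < z" "\<mu> y > 0"
  shows "F y < F z"
proof -
  have yz: "0 < y" "0 < z" using assms y0 by auto
  have mu: "\<mu> y \<le> \<mu> z" using assms by (intro mono_onD[OF mu_mono]) auto
  obtain t0 where t0: "t0 \<in> {0<..<\<mu> y}" "w t0 > 0" using w_pos[of 0 "\<mu> y"] assms by auto
  have "integral {0..\<mu> y} (\<lambda>t. w t * exp (- (2 / z) * t) - w t * exp (- (2 / y) * t)) > 0"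
  proof (rule integral_pos_if_pos_somewhere[OF _ _ t0(1)])
    show "continuous_on {0..\<mu> y} (\<lambda>t. w t * exp (- (2 / z) * t) - w t * exp (- (2 / y) * t))"
      by (intro continuous_on_diff w_exp_cont) auto
    have less: "2 / z < 2 / y" using assms yz by (simp add: divide_strict_left_mono)
    show "w t * exp (- (2 / z) * t) - w t * exp (- (2 / y) * t) \<ge> 0" if "t \<in> {0..\<mu> y}" for t
    proof -
      have "(2 / z) * t \<le> (2 / y) * t" using that less by (intro mult_right_mono) auto
      then have "w t * exp (- (2 / y) * t) \<le> w t * exp (- (2 / z) * t)"
        using w_nonneg[of t] by (intro mult_left_mono) auto
      then show ?thesis by simp
    qed
    show "w t0 * exp (- (2 / z) * t0) - w t0 * exp (- (2 / y) * t0) > 0"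
    proof -
      have "(2 / z) * t0 < (2 / y) * t0" using t0 less by (intro mult_strict_right_mono) auto
      then have "w t0 * exp (- (2 / y) * t0) < w t0 * exp (- (2 / z) * t0)"
        using t0 by (intro mult_strict_left_mono) auto
      then show ?thesis by simp
    qed
  qed
  moreover have "integral {0..\<mu> y} (\<lambda>t. w t * exp (- (2 / z) * t) - w t * exp (- (2 / y) * t)) =
      integral {0..\<mu> y} (\<lambda>t. w t * exp (- (2 / z) * t)) - F y"
    unfolding F_def by (intro integral_diff integrable_continuous_real w_exp_cont order_refl)
  ultimately have "F y < integral {0..\<mu> y} (\<lambda>t. w t * exp (- (2 / z) * t))" by simp
  also have "\<dots> \<le> F z"
    unfolding F_def using mu assms w_nonneg
    by (intro integral_subset_le integrable_continuous_real w_exp_cont) auto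
  finally show ?thesis .
qed

lemma F_mono: "y0 \<le> y \<Longrightarrow> y \<le> z \<Longrightarrow> F y \<le> F z"
proof (cases "\<mu> y > 0 \<and> y < z")
  case True
  assume "y0 \<le> y" "y \<le> z"
  then show ?thesis using F_strict True by (auto intro: less_imp_le)
next
  case False
  assume "y0 \<le> y" "y \<le> z"
  then show ?thesis using False F_pos_imp[of y] F_nonneg[of z] by (cases "F y > 0") auto
qed

lemma F_phi: "T \<ge> T0 \<Longrightarrow> F (\<phi> T) = G T"
  unfolding F_def G_def by (rule phi_eq)

lemma G_pos: "T \<ge> T0 \<Longrightarrow> G T > 0"
  using G_strict[of 0 T] T0 by (simp add: G_def)

lemma phi_strict: "T0 \<le> p \<Longrightarrow> p < q \<Longrightarrow> \<phi> p < \<phi> q"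
proof (rule ccontr)
  assume "T0 \<le> p" "p < q" "\<not> \<phi> p < \<phi> q"
  then have "G q \<le> G p" using F_mono[of "\<phi> q" "\<phi> p"] F_phi phi_ge by auto
  then show False using G_strict[of p q] T0 \<open>T0 \<le> p\<close> \<open>p < q\<close> by simp
qed

text \<open>G is F composed with the ladder, so a bounded ladder would bound G; here the divergence
  of the mean square enters.\<close>

lemma phi_unbounded: "\<exists>T\<ge>T0. \<phi> T > Y"
proof (rule ccontr)
  assume "\<not> ?thesis"
  then have *: "\<phi> T \<le> max Y y0" if "T \<ge> T0" for T using that by (force simp: max_def)
  obtain T where T: "T \<ge> 0" "G T > F (max Y y0)" using w_unbounded unfolding G_def by blast
  have "G T \<le> G (max T T0)"
    using G_strict[of T "max T T0"] T by (cases "T < T0") (auto simp: max_def)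
  also have "\<dots> \<le> F (max Y y0)"
    using F_mono[of "\<phi> (max T T0)" "max Y y0"] phi_ge[of "max T T0"] *[of "max T T0"] F_phi[of "max T T0"] by simp
  finally show False using T by simp
qed

text \<open>The intermediate value theorem is applied to G, whose continuity is plain, at the level
  F y; strict monotonicity of F where it is positive then identifies the argument. Continuity of the
  ladder itself is a consequence, in \<open>phi_cont\<close>.\<close>

lemma phi_surj:
  assumes "y \<ge> \<phi> T0"
  obtains T where "T \<ge> T0" "\<phi> T = y"
proof -
  have yy: "y \<ge> y0" using assms phi_ge[of T0] by simp
  obtain T1 where T1: "T1 \<ge> T0" "\<phi> T1 > y" using phi_unbounded by blast
  have "G T0 \<le> F y" "F y \<le> G T1"
    using F_mono[of "\<phi> T0" y] F_mono[of y "\<phi> T1"] F_phi[of T0] F_phi[of T1] assms T1 phi_ge[of T0] yy by auto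
  moreover have "continuous_on {T0..T1} G"
    by (rule continuous_on_subset[OF G_cont[of T1]]) (use T0 T1 in auto)
  ultimately obtain T where T: "T0 \<le> T" "T \<le> T1" "G T = F y"
    using IVT'[of G T0 "F y" T1] T1 by blast
  have "\<phi> T = y"
  proof (rule ccontr)
    assume "\<phi> T \<noteq> y"
    have "F y > 0" "F (\<phi> T) > 0" using G_pos[of T] T F_phi[of T] by auto
    then have "\<mu> y > 0" "\<mu> (\<phi> T) > 0" using F_pos_imp by auto
    then show False
      using \<open>\<phi> T \<noteq> y\<close> F_strict[of y "\<phi> T"] F_strict[of "\<phi> T" y] yy phi_ge[of T] F_phi[of T] T
      by (cases "\<phi> T < y") auto
  qed
  then show ?thesis using that T by blast
qed

lemma inv_ladder:
  assumes "2 * y \<ge> \<phi> T0"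
  shows "inv_ladder y \<ge> T0" "\<phi> (inv_ladder y) = 2 * y"
proof -
  obtain T where "T \<ge> T0" "\<phi> T = 2 * y" using phi_surj[OF assms] by blast
  then have "y \<in> (\<lambda>t. \<phi> t / 2) ` {T0..}" by (auto intro!: image_eqI[of _ _ T])
  then have "inv_ladder y \<in> {T0..}" "\<phi> (inv_ladder y) / 2 = y"
    unfolding inv_ladder_def by (rule inv_into_into, rule f_inv_into_f)
  then show "inv_ladder y \<ge> T0" "\<phi> (inv_ladder y) = 2 * y" by auto
qed

lemma inv_ladder_mono:
  assumes "2 * y \<ge> \<phi> T0" "y \<le> z"
  shows "inv_ladder y \<le> inv_ladder z"
proof (rule ccontr)
  assume "\<not> ?thesis"
  then have "\<phi> (inv_ladder z) < \<phi> (inv_ladder y)"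
    using assms inv_ladder[of z] by (intro phi_strict) auto
  then show False using inv_ladder[of y] inv_ladder[of z] assms by simp
qed

lemma phi_mono: "T0 \<le> p \<Longrightarrow> p \<le> q \<Longrightarrow> \<phi> p \<le> \<phi> q"
  using phi_strict[of p q] by (cases "p = q") auto

text \<open>A monotone function with open image is continuous. Leaving out the end point T0 makes
  the image open.\<close>

lemma phi_cont: "continuous_on {T0<..} \<phi>"
proof (rule continuous_onI_mono)
  have "\<phi> ` {T0<..} = {\<phi> T0<..}"
  proof
    show "\<phi> ` {T0<..} \<subseteq> {\<phi> T0<..}" using phi_strict[of T0] by auto
    show "{\<phi> T0<..} \<subseteq> \<phi> ` {T0<..}"
    proof
      fix y assume y: "y \<in> {\<phi> T0<..}"
      then obtain T where T: "T \<ge> T0" "\<phi> T = y" using phi_surj[of y] by auto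
      then have "T \<noteq> T0" using y by auto
      then show "y \<in> \<phi> ` {T0<..}" using T by auto
    qed
  qed
  then show "open (\<phi> ` {T0<..})" by simp
qed (use phi_mono in auto)

text \<open>Here the integral equation does its work: the mass of w between two points of the
  inverse ladder, on which nothing is known directly, becomes an increment of the smoothed function
  F.\<close>

lemma integral_w_ladder:
  assumes "2 * y \<ge> \<phi> T0" "y \<le> z"
  shows "integral {inv_ladder y..inv_ladder z} w = F (2 * z) - F (2 * y)"
proof -
  have iy: "inv_ladder y \<ge> T0" "\<phi> (inv_ladder y) = 2 * y" "inv_ladder z \<ge> T0" "\<phi> (inv_ladder z) = 2 * z"
    using inv_ladder[of y] inv_ladder[of z] assms by auto
  have "integral {inv_ladder y..inv_ladder z} w = G (inv_ladder z) - G (inv_ladder y)"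
    using iy T0 inv_ladder_mono[OF assms] by (intro G_diff[symmetric]) auto
  then show ?thesis using F_phi[of "inv_ladder y"] F_phi[of "inv_ladder z"] iy by simp
qed

end

section \<open>Local linearity of F\<close>

lemma ln_ge_one:
  fixes x :: real assumes "x \<ge> 3" shows "ln x \<ge> 1"
proof -
  have "exp 1 \<le> x" using assms exp_le by linarith
  then show ?thesis using assms by (subst ln_ge_iff) auto
qed

lemma exp_le_1_plus_2x:
  fixes x :: real assumes "0 \<le> x" "x \<le> 1" shows "exp x \<le> 1 + 2 * x"
proof -
  have "x\<^sup>2 \<le> x" using assms by (simp add: power2_eq_square mult_left_le)
  then show ?thesis using exp_bound[of x] assms by linarith
qed

text \<open>The derivative \<open>(2t/y\<^sup>2) e\<^bsup>-2t/y\<^esup>\<close> of \<open>e\<^bsup>-2t/y\<^esup>\<close> in \<open>y\<close> hardly varies over \<open>y \<in> [Y, Y + 2\<pi>]\<close>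
  as long as \<open>t \<le> 7 Y ln Y\<close>.\<close>

lemma exp_difference_estimate:
  fixes Y t y z :: real
  assumes Y: "Y \<ge> 3" "28 * pi * ln Y / Y \<le> 1" and t: "0 \<le> t" "t \<le> 7 * Y * ln Y"
    and yz: "Y \<le> y" "y \<le> z" "z \<le> Y + 2 * pi"
  shows "\<bar>exp (- (2 / z) * t) - exp (- (2 / y) * t) - (2 * t / Y\<^sup>2 * exp (- (2 / Y) * t)) * (z - y)\<bar>
       \<le> (56 * pi * ln Y / Y) * ((2 * t / Y\<^sup>2 * exp (- (2 / Y) * t)) * (z - y))"
proof (cases "y = z")
  case False
  then have yz': "y < z" using yz by simp
  have "\<exists>\<xi>. y < \<xi> \<and> \<xi> < z \<and> exp (- (2 / z) * t) - exp (- (2 / y) * t) = (z - y) * (exp (- (2 / \<xi>) * t) * ((2 / \<xi>\<^sup>2) * t))"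
    using yz' Y yz by (intro MVT2) (auto intro!: derivative_eq_intros simp: power2_eq_square)
  then obtain \<xi> where xi: "y < \<xi>" "\<xi> < z"
    and eq: "exp (- (2 / z) * t) - exp (- (2 / y) * t) = (z - y) * (exp (- (2 / \<xi>) * t) * ((2 / \<xi>\<^sup>2) * t))" by blast
  define D where "D = 2 * t / Y\<^sup>2 * exp (- (2 / Y) * t)"
  \<comment> \<open>The derivative of the weight at \<xi> divided by the one at Y. Its first factor
    lies in [1 - 4 pi / Y, 1]; its exponent lies between 0 and 2 * (7 Y ln Y) * (2 pi / Y^2) = 28 pi
    ln Y / Y. As this is at most 1, exp x <= 1 + 2x doubles the 28 to 56.\<close>
  define \<rho> where "\<rho> = (Y / \<xi>)\<^sup>2 * exp (2 * t / Y - 2 * t / \<xi>)"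
  define \<eta> where "\<eta> = 56 * pi * ln Y / Y"
  have Yp: "Y > 0" "\<xi> > 0" "Y \<le> \<xi>" "\<xi> \<le> Y + 2 * pi" using Y xi yz by auto
  have D0: "D \<ge> 0" using t by (simp add: D_def)
  have "D * \<rho> = (2 * t / Y\<^sup>2 * (Y / \<xi>)\<^sup>2) * (exp (- (2 / Y) * t) * exp (2 * t / Y - 2 * t / \<xi>))"
    by (simp add: D_def \<rho>_def)
  also have "exp (- (2 / Y) * t) * exp (2 * t / Y - 2 * t / \<xi>) = exp (- (2 / \<xi>) * t)"
    by (simp add: exp_add[symmetric])
  also have "2 * t / Y\<^sup>2 * (Y / \<xi>)\<^sup>2 = 2 * t / \<xi>\<^sup>2" using Yp by (simp add: power_divide)
  finally have Drho: "exp (- (2 / \<xi>) * t) * ((2 / \<xi>\<^sup>2) * t) = D * \<rho>" by simp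
  have lnY: "ln Y \<ge> 1" using Y by (intro ln_ge_one) auto
  have diff: "0 \<le> 1 / Y - 1 / \<xi>" "1 / Y - 1 / \<xi> \<le> 2 * pi / Y\<^sup>2"
  proof -
    show "0 \<le> 1 / Y - 1 / \<xi>" using Yp by (simp add: frac_le)
    have "1 / Y - 1 / \<xi> = (\<xi> - Y) / (Y * \<xi>)" using Yp by (simp add: field_simps)
    also have "\<dots> \<le> 2 * pi / Y\<^sup>2" using Yp by (intro frac_le) (auto simp: power2_eq_square)
    finally show "1 / Y - 1 / \<xi> \<le> 2 * pi / Y\<^sup>2" .
  qed
  have arg: "2 * t / Y - 2 * t / \<xi> = 2 * t * (1 / Y - 1 / \<xi>)" by (simp add: algebra_simps)
  have arg0: "0 \<le> 2 * t / Y - 2 * t / \<xi>" unfolding arg using t diff by simp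
  have arg1: "2 * t / Y - 2 * t / \<xi> \<le> 28 * pi * ln Y / Y"
  proof -
    have "2 * t * (1 / Y - 1 / \<xi>) \<le> (2 * (7 * Y * ln Y)) * (2 * pi / Y\<^sup>2)"
      using t diff by (intro mult_mono) auto
    also have "\<dots> = 28 * pi * ln Y / Y" using Yp by (simp add: power2_eq_square)
    finally show ?thesis unfolding arg .
  qed
  have Yxi1: "(Y / \<xi>)\<^sup>2 \<le> 1" using Yp by (intro power_le_one) auto
  have "\<rho> \<le> 1 * exp (28 * pi * ln Y / Y)"
    unfolding \<rho>_def using Yxi1 arg1 by (intro mult_mono) auto
  also have "\<dots> \<le> 1 + 2 * (28 * pi * ln Y / Y)"
    using exp_le_1_plus_2x[of "28 * pi * ln Y / Y"] Y lnY by simp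
  finally have up: "\<rho> \<le> 1 + \<eta>" by (simp add: \<eta>_def)
  have "1 - 2 * pi / Y \<le> Y / \<xi>"
  proof -
    have "Y - 2 * pi \<le> Y" "(Y - 2 * pi) * (Y + 2 * pi) \<le> Y * Y" by (auto simp: algebra_simps)
    then have "(Y - 2 * pi) / Y \<le> Y / (Y + 2 * pi)" using Yp by (simp add: field_simps)
    also have "\<dots> \<le> Y / \<xi>" using Yp by (intro divide_left_mono) auto
    finally show ?thesis using Yp by (simp add: diff_divide_distrib)
  qed
  then have "1 - 2 * (2 * pi / Y) \<le> 1 - 2 * (1 - Y / \<xi>)" by simp
  also have "\<dots> \<le> (Y / \<xi>)\<^sup>2"
    using zero_le_power2[of "Y / \<xi> - 1"] by (simp only: power2_diff) simp
  also have "\<dots> \<le> \<rho>"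
    unfolding \<rho>_def using arg0 mult_left_mono[of 1 "exp (2 * t / Y - 2 * t / \<xi>)" "(Y / \<xi>)\<^sup>2"] by simp
  finally have "1 - 4 * pi / Y \<le> \<rho>" by simp
  moreover have "4 * pi / Y \<le> \<eta>"
  proof -
    have "4 * pi * 1 \<le> 56 * pi * ln Y" using lnY by (intro mult_mono) auto
    then show ?thesis unfolding \<eta>_def using Yp by (simp add: divide_right_mono)
  qed
  ultimately have "\<bar>\<rho> - 1\<bar> \<le> \<eta>" using up by simp
  then have "(D * (z - y)) * \<bar>\<rho> - 1\<bar> \<le> (D * (z - y)) * \<eta>"
    using D0 yz by (intro mult_left_mono) auto
  moreover have "\<bar>(z - y) * (D * \<rho>) - D * (z - y)\<bar> = (D * (z - y)) * \<bar>\<rho> - 1\<bar>"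
  proof -
    have "(z - y) * (D * \<rho>) - D * (z - y) = (D * (z - y)) * (\<rho> - 1)" by (simp add: algebra_simps)
    then show ?thesis using D0 yz by (simp add: abs_mult)
  qed
  ultimately show ?thesis
    unfolding eq Drho D_def[symmetric] \<eta>_def[symmetric] by (simp add: mult.commute)
qed simp

text \<open>Local errors on n equal steps add up to the global one; K will be the difference between
  the ladder integral and its main term as a function of the upper end point.\<close>

lemma telescoping_bound:
  fixes K :: "real \<Rightarrow> real"
  assumes "n > 0" "\<alpha> \<le> \<beta>" "K \<alpha> = 0"
    and step: "\<And>x y. \<alpha> \<le> x \<Longrightarrow> x \<le> y \<Longrightarrow> y \<le> \<beta> \<Longrightarrow> y - x = (\<beta> - \<alpha>) / real n \<Longrightarrow> \<bar>K y - K x\<bar> \<le> E"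
  shows "\<bar>K \<beta>\<bar> \<le> real n * E"
proof -
  define d where "d = (\<beta> - \<alpha>) / real n"
  have d0: "d \<ge> 0" using assms by (simp add: d_def)
  have nd: "real n * d = \<beta> - \<alpha>" using assms by (simp add: d_def)
  have "\<bar>K (\<alpha> + real j * d)\<bar> \<le> real j * E" if "j \<le> n" for j
    using that
  proof (induction j)
    case 0
    then show ?case using assms by simp
  next
    case (Suc j)
    have "real (Suc j) * d \<le> real n * d" using Suc d0 by (intro mult_right_mono) auto
    then have "\<bar>K (\<alpha> + real (Suc j) * d) - K (\<alpha> + real j * d)\<bar> \<le> E"
      using d0 nd by (intro step) (auto simp: algebra_simps d_def[symmetric])
    then show ?case using Suc by (simp add: algebra_simps)
  qed
  from this[of n] show ?thesis using nd by simp
qed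

context ladder
begin

text \<open>Beyond X = 7 Y ln Y the exponent 2t/y is at least 12t/(7Y) = 5t/(7Y) + t/Y. The first
  part absorbs the quadratic growth of w at the cost of Y^2; the second integrates to Y exp(-X/Y) =
  Y * Y^-7.\<close>

lemma F_tail:
  assumes Y: "Y \<ge> y0" "Y \<ge> 48" and y: "Y \<le> y" "y \<le> Y + 2 * pi"
  shows "0 \<le> F y - integral {0..7 * Y * ln Y} (\<lambda>t. w t * exp (- (2 / y) * t))"
    and "F y - integral {0..7 * Y * ln Y} (\<lambda>t. w t * exp (- (2 / y) * t)) \<le> 16 * C / Y ^ 4"
proof -
  define X where "X = 7 * Y * ln Y"
  define f where "f = (\<lambda>t. w t * exp (- (2 / y) * t))"
  have lnY: "ln Y \<ge> 1" using Y by (intro ln_ge_one) auto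
  have Yp: "Y > 0" using Y by simp
  have X1: "X \<ge> 1"
  proof -
    have "1 * 1 \<le> (7 * Y) * ln Y" using Y lnY by (intro mult_mono) auto
    then show ?thesis by (simp add: X_def)
  qed
  have "X \<le> 7 * y * ln y"
    unfolding X_def using Y y lnY by (intro mult_mono ln_mono) auto
  also have "\<dots> \<le> \<mu> y" using Y y by (intro mu_ge) auto
  finally have Xmu: "X \<le> \<mu> y" .
  have intf: "f integrable_on {p..q}" if "0 \<le> p" for p q
    unfolding f_def using that by (intro integrable_continuous_real w_exp_cont)
  have "integral {0..X} f + integral {X..\<mu> y} f = F y"
    unfolding F_def f_def[symmetric] using X1 Xmu
    by (intro Henstock_Kurzweil_Integration.integral_combine intf) auto
  then have eq: "F y - integral {0..7 * Y * ln Y} (\<lambda>t. w t * exp (- (2 / y) * t)) = integral {X..\<mu> y} f"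
    by (simp add: X_def f_def)
  show "0 \<le> F y - integral {0..7 * Y * ln Y} (\<lambda>t. w t * exp (- (2 / y) * t))"
    unfolding eq using X1 w_nonneg by (intro integral_nonneg intf) (auto simp: f_def)
  have ptw: "f t \<le> 16 * C * Y\<^sup>2 * exp (- (t / Y))" if t: "t \<in> {X..\<mu> y}" for t
  proof -
    have t1: "t \<ge> 1" using t X1 by simp
    \<comment> \<open>Here 48 is used: 12 pi < 48 <= Y.\<close>
    have "6 * y \<le> 7 * Y" using Y y pi_less_4 by linarith
    then have "12 / (7 * Y) \<le> 2 / y" using Yp y by (simp add: field_simps)
    then have "(12 / (7 * Y)) * t \<le> (2 / y) * t" using t1 by (intro mult_right_mono) auto
    then have "exp (- (2 / y) * t) \<le> exp (- ((12 / (7 * Y)) * t))" by simp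
    also have "(12 / (7 * Y)) * t = 5 * t / (7 * Y) + t / Y" using Yp by (simp add: field_simps)
    finally have e1: "exp (- (2 / y) * t) \<le> exp (- (5 * t / (7 * Y))) * exp (- (t / Y))"
      by (simp add: exp_add[symmetric])
    have w1: "w t \<le> 4 * C * t\<^sup>2"
    proof -
      have "(1 + t)\<^sup>2 \<le> (2 * t)\<^sup>2" using t1 by (intro power_mono) auto
      then have "C * (1 + t)\<^sup>2 \<le> C * (2 * t)\<^sup>2" using C_nonneg by (intro mult_left_mono)
      then show ?thesis using w_bound[of t] t1 by (simp add: power_mult_distrib)
    qed
    have e2: "t\<^sup>2 * exp (- (5 * t / (7 * Y))) \<le> 4 * Y\<^sup>2"
    proof -
      define u where "u = 5 * t / (7 * Y)"
      have u: "u \<ge> 0" using t1 Yp by (simp add: u_def)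
      have tu: "t = 7 * Y * u / 5" using Yp by (simp add: u_def)
      have "u\<^sup>2 / 2 \<le> exp u" using exp_lower_Taylor_quadratic[OF u] u by linarith
      then have "u\<^sup>2 * exp (- u) \<le> 2" by (simp add: exp_minus field_simps)
      then have "(49 / 25 * Y\<^sup>2) * (u\<^sup>2 * exp (- u)) \<le> (49 / 25 * Y\<^sup>2) * 2" by (intro mult_left_mono) auto
      also have "\<dots> \<le> 4 * Y\<^sup>2" by simp
      finally show ?thesis unfolding u_def[symmetric] by (simp add: tu power_mult_distrib power_divide)
    qed
    have "f t \<le> (4 * C * t\<^sup>2) * (exp (- (5 * t / (7 * Y))) * exp (- (t / Y)))"
      unfolding f_def using w1 e1 C_nonneg by (intro mult_mono) auto
    also have "\<dots> = (4 * C) * (t\<^sup>2 * exp (- (5 * t / (7 * Y)))) * exp (- (t / Y))" by simp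
    also have "\<dots> \<le> (4 * C) * (4 * Y\<^sup>2) * exp (- (t / Y))"
      using e2 C_nonneg by (intro mult_right_mono mult_left_mono) auto
    finally show ?thesis by simp
  qed
  have "integral {X..\<mu> y} f \<le> integral {X..\<mu> y} (\<lambda>t. 16 * C * Y\<^sup>2 * exp (- (t / Y)))"
    using X1 ptw Yp by (intro integral_le intf integrable_continuous_real continuous_intros) auto
  also have "\<dots> = 16 * C * Y\<^sup>2 * integral {X..\<mu> y} (\<lambda>t. exp (- (t / Y)))" by simp
  also have "integral {X..\<mu> y} (\<lambda>t. exp (- (t / Y))) \<le> Y * exp (- (X / Y))"
  proof -
    define H where "H = (\<lambda>t. - Y * exp (- (t / Y)))"
    have "((\<lambda>t. exp (- (t / Y))) has_integral (H (\<mu> y) - H X)) {X..\<mu> y}"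
      unfolding H_def using Xmu Yp
      by (intro fundamental_theorem_of_calculus[where f = "\<lambda>t. - Y * exp (- (t / Y))"])
         (auto intro!: derivative_eq_intros simp: has_real_derivative_iff_has_vector_derivative[symmetric])
    then have "integral {X..\<mu> y} (\<lambda>t. exp (- (t / Y))) = H (\<mu> y) - H X" by (rule integral_unique)
    then show ?thesis using Yp by (simp add: H_def)
  qed
  then have "16 * C * Y\<^sup>2 * integral {X..\<mu> y} (\<lambda>t. exp (- (t / Y))) \<le> 16 * C * Y\<^sup>2 * (Y * exp (- (X / Y)))"
    using C_nonneg by (intro mult_left_mono) auto
  also have "exp (- (X / Y)) = 1 / Y ^ 7"
  proof -
    have "X / Y = real 7 * ln Y" using Yp by (simp add: X_def)
    then have "exp (- (X / Y)) = inverse (exp (ln Y) ^ 7)" by (simp only: exp_minus exp_of_nat_mult)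
    then show ?thesis using Yp by (simp add: divide_inverse)
  qed
  also have "16 * C * Y\<^sup>2 * (Y * (1 / Y ^ 7)) = 16 * C / Y ^ 4" using Yp by (simp add: field_simps eval_nat_numeral)
  finally show "F y - integral {0..7 * Y * ln Y} (\<lambda>t. w t * exp (- (2 / y) * t)) \<le> 16 * C / Y ^ 4"
    unfolding eq .
qed

text \<open>The derivative at y = Y of the integral of w(t) exp(-2t/y) over [0, 7 Y ln Y], with the
  upper limit held fixed. The factor P(T) is twice its value at Y = 2T.\<close>

definition F_slope :: "real \<Rightarrow> real" where
  "F_slope Y = integral {0..7 * Y * ln Y} (\<lambda>t. (2 * t / Y\<^sup>2) * (w t * exp (- (2 / Y) * t)))"

text \<open>For t in [0, 1] the weight is at least exp(-2), and this range alone yields the order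
  Y^-2. That is enough against the total tail Y * Y^-4.\<close>

lemma F_slope_lower: "\<exists>\<kappa>>0. \<forall>Y\<ge>3. F_slope Y \<ge> \<kappa> / Y\<^sup>2"
proof -
  define k where "k = integral {0..1} (\<lambda>t. t * w t)"
  obtain t0 where "t0 \<in> {0<..<1}" "w t0 > 0" using w_pos[of 0 1] by auto
  then have k: "k > 0"
    unfolding k_def using w_nonneg by (intro integral_pos_if_pos_somewhere[of 0 1 _ t0] continuous_intros w_cont') auto
  have "F_slope Y \<ge> (2 * exp (- 2) * k) / Y\<^sup>2" if Y: "Y \<ge> 3" for Y
  proof -
    have lnY: "ln Y \<ge> 1" using Y by (intro ln_ge_one) auto
    have "1 * 1 \<le> (7 * Y) * ln Y" using Y lnY by (intro mult_mono) auto
    then have X1: "7 * Y * ln Y \<ge> 1" by simp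
    have cont: "continuous_on {p..q} (\<lambda>t. (2 * t / Y\<^sup>2) * (w t * exp (- (2 / Y) * t)))" if "0 \<le> p" for p q
      using that Y by (intro continuous_intros w_cont') auto
    have "(2 * exp (- 2) * k) / Y\<^sup>2 = integral {0..1} (\<lambda>t. (2 * exp (- 2) / Y\<^sup>2) * (t * w t))"
      by (simp add: k_def)
    also have "\<dots> \<le> integral {0..1} (\<lambda>t. (2 * t / Y\<^sup>2) * (w t * exp (- (2 / Y) * t)))"
    proof (rule integral_le)
      fix t :: real assume t: "t \<in> {0..1}"
      have "(2 / Y) * t \<le> 1 * 1" using t Y by (intro mult_mono) auto
      then have "exp (- 2) \<le> exp (- (2 / Y) * t)" by simp
      then have "(2 * t / Y\<^sup>2 * w t) * exp (- 2) \<le> (2 * t / Y\<^sup>2 * w t) * exp (- (2 / Y) * t)"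
        using t w_nonneg[of t] by (intro mult_left_mono) auto
      then show "(2 * exp (- 2) / Y\<^sup>2) * (t * w t) \<le> (2 * t / Y\<^sup>2) * (w t * exp (- (2 / Y) * t))"
        by (simp add: mult_ac)
    qed (use Y in \<open>auto intro!: integrable_continuous_real continuous_intros w_cont'\<close>)
    also have "\<dots> \<le> F_slope Y"
      unfolding F_slope_def using X1 w_nonneg
      by (intro integral_subset_le integrable_continuous_real cont) auto
    finally show ?thesis .
  qed
  then show ?thesis using k by (intro exI[of _ "2 * exp (- 2) * k"]) auto
qed

text \<open>With the upper limit frozen, the pointwise estimate for the weight integrates against w
  >= 0 to a relative error. The two tails discarded lie in the same interval [0, 16 C / Y^4], so
  their difference costs only one such term.\<close>

lemma F_increment:
  assumes Y: "Y \<ge> y0" "Y \<ge> 48" "28 * pi * ln Y / Y \<le> 1"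
    and yz: "Y \<le> y" "y \<le> z" "z \<le> Y + 2 * pi"
  shows "\<bar>F z - F y - F_slope Y * (z - y)\<bar> \<le> (56 * pi * ln Y / Y) * (F_slope Y * (z - y)) + 16 * C / Y ^ 4"
proof -
  define X where "X = 7 * Y * ln Y"
  define \<eta> where "\<eta> = 56 * pi * ln Y / Y"
  define E where "E = (\<lambda>y. integral {0..X} (\<lambda>t. w t * exp (- (2 / y) * t)))"
  define D where "D = (\<lambda>t. 2 * t / Y\<^sup>2 * exp (- (2 / Y) * t))"
  have iw: "(\<lambda>t. w t * exp (- (2 / y) * t)) integrable_on {0..X}" for y
    by (intro integrable_continuous_real w_exp_cont order_refl)
  have cD: "continuous_on {0..X} (\<lambda>t. w t * (D t * (z - y)))"
    unfolding D_def using Y by (intro continuous_intros w_cont') auto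
  have dens: "integral {0..X} (\<lambda>t. w t * (D t * (z - y))) = F_slope Y * (z - y)"
    unfolding F_slope_def X_def[symmetric] D_def by (subst integral_mult_left[symmetric]) (simp add: mult_ac)
  have "E z - E y - F_slope Y * (z - y) =
     integral {0..X} (\<lambda>t. w t * exp (- (2 / z) * t) - w t * exp (- (2 / y) * t) - w t * (D t * (z - y)))"
    unfolding E_def dens[symmetric]
    by (subst integral_diff, (intro integrable_diff iw integrable_continuous_real cD)+, subst integral_diff) (intro iw refl)+
  moreover have "norm (integral {0..X} (\<lambda>t. w t * exp (- (2 / z) * t) - w t * exp (- (2 / y) * t) - w t * (D t * (z - y))))
      \<le> integral {0..X} (\<lambda>t. \<eta> * (w t * (D t * (z - y))))"
  proof (rule integral_norm_bound_integral)
    show "(\<lambda>t. w t * exp (- (2 / z) * t) - w t * exp (- (2 / y) * t) - w t * (D t * (z - y))) integrable_on {0..X}"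
      by (intro integrable_diff iw integrable_continuous_real cD)
    show "(\<lambda>t. \<eta> * (w t * (D t * (z - y)))) integrable_on {0..X}"
      by (intro integrable_continuous_real continuous_on_mult_left cD)
    fix t assume t: "t \<in> {0..X}"
    have "\<bar>exp (- (2 / z) * t) - exp (- (2 / y) * t) - D t * (z - y)\<bar> \<le> \<eta> * (D t * (z - y))"
      unfolding D_def \<eta>_def using Y yz t by (intro exp_difference_estimate) (auto simp: X_def)
    then have "w t * \<bar>exp (- (2 / z) * t) - exp (- (2 / y) * t) - D t * (z - y)\<bar> \<le> w t * (\<eta> * (D t * (z - y)))"
      using w_nonneg[of t] by (intro mult_left_mono) auto
    moreover have "w t * exp (- (2 / z) * t) - w t * exp (- (2 / y) * t) - w t * (D t * (z - y)) =
      w t * (exp (- (2 / z) * t) - exp (- (2 / y) * t) - D t * (z - y))" by (simp only: right_diff_distrib)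
    ultimately show "norm (w t * exp (- (2 / z) * t) - w t * exp (- (2 / y) * t) - w t * (D t * (z - y))) \<le> \<eta> * (w t * (D t * (z - y)))"
      using w_nonneg[of t] by (simp only: real_norm_def abs_mult abs_of_nonneg) (simp add: mult_ac)
  qed
  ultimately have 1: "\<bar>E z - E y - F_slope Y * (z - y)\<bar> \<le> \<eta> * (F_slope Y * (z - y))"
    using dens by simp
  have "0 \<le> F y - E y" "F y - E y \<le> 16 * C / Y ^ 4" "0 \<le> F z - E z" "F z - E z \<le> 16 * C / Y ^ 4"
    unfolding E_def X_def using Y yz by (intro F_tail; simp)+
  then show ?thesis using 1 unfolding \<eta>_def[symmetric] by linarith
qed

text \<open>P is chosen before \<alpha> and \<beta>, so it cancels in the quotient of integrals over
  two windows at the same T.\<close>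

lemma ladder_integral_asymptotics:
  fixes h :: "real \<Rightarrow> real" and L H :: real
  assumes hc: "\<And>A. continuous_on A h"
    and lip: "\<And>x y. \<bar>h x - h y\<bar> \<le> L * \<bar>x - y\<bar>"
    and bd: "\<And>x. \<bar>h x\<bar> \<le> H"
  obtains D where "\<forall>\<^sub>F T in at_top. \<exists>P>0. \<forall>\<alpha> \<beta>. 0 \<le> \<alpha> \<longrightarrow> \<alpha> \<le> \<beta> \<longrightarrow> \<beta> \<le> pi \<longrightarrow>
     \<bar>integral {inv_ladder (T + \<alpha>)..inv_ladder (T + \<beta>)} (\<lambda>t. h (\<phi> t / 2 - T) * w t) - P * integral {\<alpha>..\<beta>} h\<bar>
       \<le> D * (ln T / T) * P"
proof -
  have L0: "L \<ge> 0" using lip[of 0 1] by simp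
  have H0: "H \<ge> 0" using bd[of 0] by simp
  obtain \<kappa> where kap: "\<kappa> > 0" "\<And>Y. Y \<ge> 3 \<Longrightarrow> F_slope Y \<ge> \<kappa> / Y\<^sup>2" using F_slope_lower by blast
  \<comment> \<open>The summands stem, in this order, from freezing h on the pieces, from the
    product of that error with the tails, from the relative error of \<open>F_increment\<close>, and
    from the accumulated tails.\<close>
  define D where "D = 48 * L + 32 * L * C / \<kappa> + 224 * pi * H + 16 * C * H / \<kappa>"
  have main: "\<exists>P>0. \<forall>\<alpha> \<beta>. 0 \<le> \<alpha> \<longrightarrow> \<alpha> \<le> \<beta> \<longrightarrow> \<beta> \<le> pi \<longrightarrow>
     \<bar>integral {inv_ladder (T + \<alpha>)..inv_ladder (T + \<beta>)} (\<lambda>t. h (\<phi> t / 2 - T) * w t) - P * integral {\<alpha>..\<beta>} h\<bar>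
       \<le> D * (ln T / T) * P"
    if T: "T \<ge> 24" "2 * T \<ge> y0" "2 * T > \<phi> T0" "56 * pi * ln (2 * T) / (2 * T) \<le> 1" for T
  proof -
    define Y where "Y = 2 * T"
    define \<eta> where "\<eta> = 56 * pi * ln Y / Y"
    define P where "P = 2 * F_slope Y"
    define E where "E = 16 * C / Y ^ 4"
    have Y: "Y \<ge> 48" "Y \<ge> y0" "Y > \<phi> T0" "\<eta> \<le> 1" using T by (auto simp: Y_def \<eta>_def)
    have lnY: "ln Y \<ge> 1" using Y by (intro ln_ge_one) auto
    have eta0: "\<eta> \<ge> 0" using lnY Y by (simp add: \<eta>_def)
    have E0: "E \<ge> 0" using C_nonneg by (simp add: E_def)
    have "\<kappa> / Y\<^sup>2 > 0" using kap Y by (intro divide_pos_pos) auto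
    then have P: "P > 0" "P \<ge> 2 * (\<kappa> / Y\<^sup>2)" using kap(2)[of Y] Y by (auto simp: P_def)
    \<comment> \<open>The lower bound for P makes the additive tail relative: of Y^-4, two powers
      are spent on P and two remain, one of which the partition will consume.\<close>
    have EP: "E \<le> (8 * C / \<kappa>) * P / Y\<^sup>2"
    proof -
      have "1 / Y\<^sup>2 \<le> P / (2 * \<kappa>)" using P(2) kap(1) by (simp add: field_simps)
      then have "(16 * C) / Y\<^sup>2 * (1 / Y\<^sup>2) \<le> (16 * C) / Y\<^sup>2 * (P / (2 * \<kappa>))"
        using C_nonneg by (intro mult_left_mono) auto
      then show ?thesis using kap(1) by (simp add: E_def power4_eq_xxxx power2_eq_square field_simps)
    qed
    have iv: "inv_ladder (T + x) > T0" "\<phi> (inv_ladder (T + x)) = 2 * (T + x)" if "x \<ge> 0" for x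
    proof -
      have "2 * (T + x) > \<phi> T0" using Y that by (simp add: Y_def)
      then have *: "inv_ladder (T + x) \<ge> T0" "\<phi> (inv_ladder (T + x)) = 2 * (T + x)"
        using inv_ladder[of "T + x"] by auto
      moreover have "inv_ladder (T + x) \<noteq> T0" using * \<open>2 * (T + x) > \<phi> T0\<close> by auto
      ultimately show "inv_ladder (T + x) > T0" "\<phi> (inv_ladder (T + x)) = 2 * (T + x)" by auto
    qed
    define f where "f = (\<lambda>t. h (\<phi> t / 2 - T) * w t)"
    have cf: "continuous_on {p..q} f" if "p > T0" for p q
    proof -
      have "continuous_on {p..q} \<phi>" by (rule continuous_on_subset[OF phi_cont]) (use that in auto)
      then have "continuous_on {p..q} (\<lambda>t. \<phi> t / 2 - T)" by (intro continuous_intros) auto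
      then have "continuous_on {p..q} (\<lambda>t. h (\<phi> t / 2 - T))"
        by (rule continuous_on_compose2[OF hc[of UNIV]]) auto
      then show ?thesis unfolding f_def using that T0 by (intro continuous_on_mult w_cont') auto
    qed
    have ivm: "inv_ladder (T + x) \<le> inv_ladder (T + y)" if "0 \<le> x" "x \<le> y" for x y
      using that Y by (intro inv_ladder_mono) (auto simp: Y_def)
    \<comment> \<open>On one piece h is frozen at its left end x and three replacements are made:
      the integral of f by h(x) W, the mass W by P \<Delta>, and \<Delta> h(x) by the integral of h.
      The 3 in the bound is 2, from W <= 2 P \<Delta> + E, plus 1 from the last replacement.\<close>
    have piece: "\<bar>integral {inv_ladder (T + x)..inv_ladder (T + y)} f - P * integral {x..y} h\<bar>
        \<le> 3 * L * P * (y - x)\<^sup>2 + L * (y - x) * E + H * \<eta> * P * (y - x) + H * E"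
      if xy: "0 \<le> x" "x \<le> y" "y \<le> pi" for x y
    proof -
      define u v where "u = inv_ladder (T + x)" and "v = inv_ladder (T + y)"
      define \<Delta> where "\<Delta> = y - x"
      have D0: "\<Delta> \<ge> 0" using xy by (simp add: \<Delta>_def)
      have uv: "T0 < u" "u \<le> v" "\<phi> u = 2 * (T + x)" "\<phi> v = 2 * (T + y)"
        using iv xy ivm by (auto simp: u_def v_def)
      define W where "W = integral {u..v} w"
      have wint: "w integrable_on {u..v}" using uv T0 by (intro integrable_continuous_real w_cont') auto
      have W0: "W \<ge> 0" unfolding W_def using wint w_nonneg by (intro integral_nonneg) auto
      have WF: "W = F (2 * (T + y)) - F (2 * (T + x))"
        unfolding W_def u_def v_def using xy Y by (intro integral_w_ladder) (auto simp: Y_def)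
      have "\<bar>F (2 * (T + y)) - F (2 * (T + x)) - F_slope Y * (2 * (T + y) - 2 * (T + x))\<bar>
          \<le> (56 * pi * ln Y / Y) * (F_slope Y * (2 * (T + y) - 2 * (T + x))) + 16 * C / Y ^ 4"
        using Y xy by (intro F_increment) (auto simp: Y_def \<eta>_def)
      moreover have "F_slope Y * (2 * (T + y) - 2 * (T + x)) = P * \<Delta>" by (simp add: P_def \<Delta>_def algebra_simps)
      ultimately have WP: "\<bar>W - P * \<Delta>\<bar> \<le> \<eta> * (P * \<Delta>) + E" unfolding WF E_def \<eta>_def by simp
      have "\<eta> * (P * \<Delta>) \<le> 1 * (P * \<Delta>)" using Y P D0 by (intro mult_right_mono) auto
      then have WP2: "W \<le> 2 * (P * \<Delta>) + E" using WP by linarith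
      have fint: "f integrable_on {u..v}" using uv by (intro integrable_continuous_real cf) auto
      have a1: "\<bar>integral {u..v} f - h x * W\<bar> \<le> L * \<Delta> * W"
      proof -
        have "integral {u..v} f - h x * W = integral {u..v} (\<lambda>t. f t - h x * w t)"
          unfolding W_def by (subst integral_diff) (auto intro!: fint wint integrable_on_mult_right)
        moreover have "norm (integral {u..v} (\<lambda>t. f t - h x * w t)) \<le> integral {u..v} (\<lambda>t. L * \<Delta> * w t)"
        proof (rule integral_norm_bound_integral)
          show "(\<lambda>t. f t - h x * w t) integrable_on {u..v}" "(\<lambda>t. L * \<Delta> * w t) integrable_on {u..v}"
            by (intro integrable_diff fint integrable_on_mult_right wint)+
          fix t assume t: "t \<in> {u..v}"
          then have "2 * (T + x) \<le> \<phi> t" "\<phi> t \<le> 2 * (T + y)"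
            using phi_mono[of u t] phi_mono[of t v] uv by auto
          then have "\<bar>(\<phi> t / 2 - T) - x\<bar> \<le> \<Delta>" by (simp add: \<Delta>_def abs_le_iff)
          then have "L * \<bar>(\<phi> t / 2 - T) - x\<bar> \<le> L * \<Delta>" using L0 by (intro mult_left_mono)
          then have "\<bar>h (\<phi> t / 2 - T) - h x\<bar> \<le> L * \<Delta>" using lip[of "\<phi> t / 2 - T" x] by linarith
          then have "\<bar>h (\<phi> t / 2 - T) - h x\<bar> * w t \<le> L * \<Delta> * w t" using w_nonneg by (intro mult_right_mono)
          moreover have "f t - h x * w t = (h (\<phi> t / 2 - T) - h x) * w t" by (simp add: f_def algebra_simps)
          ultimately show "norm (f t - h x * w t) \<le> L * \<Delta> * w t" using w_nonneg[of t] by (simp add: abs_mult)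
        qed
        ultimately show ?thesis by (simp add: W_def)
      qed
      have a2: "\<bar>integral {x..y} h - h x * \<Delta>\<bar> \<le> L * \<Delta> * \<Delta>"
      proof -
        have hint: "h integrable_on {x..y}" by (intro integrable_continuous_real hc)
        have "integral {x..y} h - h x * \<Delta> = integral {x..y} (\<lambda>t. h t - h x)"
          using xy by (subst integral_diff) (auto intro!: hint simp: \<Delta>_def)
        moreover have "norm (integral {x..y} (\<lambda>t. h t - h x)) \<le> (L * \<Delta>) * (y - x)"
        proof (rule integral_bound)
          show "continuous_on {x..y} (\<lambda>t. h t - h x)" by (intro continuous_intros hc)
          fix t assume "t \<in> {x..y}"
          then have "L * \<bar>t - x\<bar> \<le> L * \<Delta>" using L0 by (intro mult_left_mono) (auto simp: \<Delta>_def)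
          then show "norm (h t - h x) \<le> L * \<Delta>" using lip[of t x] by simp
        qed (use xy in auto)
        ultimately show ?thesis by (simp add: \<Delta>_def)
      qed
      have a3: "\<bar>h x * W - h x * (P * \<Delta>)\<bar> \<le> H * (\<eta> * (P * \<Delta>) + E)"
      proof -
        have "\<bar>h x * W - h x * (P * \<Delta>)\<bar> = \<bar>h x\<bar> * \<bar>W - P * \<Delta>\<bar>"
          by (simp only: right_diff_distrib[symmetric] abs_mult)
        also have "\<dots> \<le> H * (\<eta> * (P * \<Delta>) + E)" using bd WP H0 by (intro mult_mono) auto
        finally show ?thesis .
      qed
      have a4: "\<bar>P * integral {x..y} h - P * (h x * \<Delta>)\<bar> \<le> P * (L * \<Delta> * \<Delta>)"
      proof -
        have "\<bar>P * integral {x..y} h - P * (h x * \<Delta>)\<bar> = P * \<bar>integral {x..y} h - h x * \<Delta>\<bar>"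
          using P by (simp only: right_diff_distrib[symmetric] abs_mult)
        then show ?thesis using a2 P by (simp add: mult_left_mono)
      qed
      have a5: "L * \<Delta> * W \<le> L * \<Delta> * (2 * (P * \<Delta>) + E)" using WP2 L0 D0 by (intro mult_left_mono) auto
      have "P * (h x * \<Delta>) = h x * (P * \<Delta>)" by simp
      then have "\<bar>integral {u..v} f - P * integral {x..y} h\<bar> \<le>
         L * \<Delta> * (2 * (P * \<Delta>) + E) + H * (\<eta> * (P * \<Delta>) + E) + P * (L * \<Delta> * \<Delta>)"
        using a1 a3 a4 a5 by linarith
      also have "\<dots> = 3 * L * P * \<Delta>\<^sup>2 + L * \<Delta> * E + H * \<eta> * P * \<Delta> + H * E"
        by (simp add: power2_eq_square algebra_simps)
      finally show ?thesis by (simp add: u_def v_def \<Delta>_def)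
    qed
    have "\<bar>integral {inv_ladder (T + \<alpha>)..inv_ladder (T + \<beta>)} f - P * integral {\<alpha>..\<beta>} h\<bar> \<le> D * (ln T / T) * P"
      if ab: "0 \<le> \<alpha>" "\<alpha> \<le> \<beta>" "\<beta> \<le> pi" for \<alpha> \<beta>
    proof -
      \<comment> \<open>Freezing costs P B^2 / n in total and the tails cost n E, where E is of
        order at most P / Y^2. With n about Y both are O(P / Y).\<close>
      define n where "n = nat \<lceil>Y\<rceil>"
      have n: "n > 0" "real n \<ge> Y" "real n \<le> Y + 1" using Y by (auto simp: n_def)
      define B where "B = \<beta> - \<alpha>"
      have B: "0 \<le> B" "B \<le> 4" using ab pi_less_4 by (auto simp: B_def)
      define K where "K = (\<lambda>\<sigma>. integral {inv_ladder (T + \<alpha>)..inv_ladder (T + \<sigma>)} f - P * integral {\<alpha>..\<sigma>} h)"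
      have "\<bar>K \<beta>\<bar> \<le> real n * (3 * L * P * (B / n)\<^sup>2 + L * (B / n) * E + H * \<eta> * P * (B / n) + H * E)"
      proof (rule telescoping_bound[OF n(1) ab(2)])
        show "K \<alpha> = 0" by (simp add: K_def)
        fix x y assume xy: "\<alpha> \<le> x" "x \<le> y" "y \<le> \<beta>" "y - x = (\<beta> - \<alpha>) / real n"
        have "integral {inv_ladder (T + \<alpha>)..inv_ladder (T + x)} f + integral {inv_ladder (T + x)..inv_ladder (T + y)} f
            = integral {inv_ladder (T + \<alpha>)..inv_ladder (T + y)} f"
          using xy ab iv ivm by (intro Henstock_Kurzweil_Integration.integral_combine integrable_continuous_real cf) auto
        moreover have "integral {\<alpha>..x} h + integral {x..y} h = integral {\<alpha>..y} h"
          using xy by (intro Henstock_Kurzweil_Integration.integral_combine integrable_continuous_real hc) auto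
        ultimately have "K y - K x = integral {inv_ladder (T + x)..inv_ladder (T + y)} f - P * integral {x..y} h"
          unfolding K_def by (simp add: algebra_simps flip: distrib_left)
        then show "\<bar>K y - K x\<bar> \<le> 3 * L * P * (B / n)\<^sup>2 + L * (B / n) * E + H * \<eta> * P * (B / n) + H * E"
          using piece[of x y] xy ab by (simp add: B_def)
      qed
      also have "\<dots> = 3 * L * P * (B\<^sup>2 / n) + L * B * E + H * \<eta> * P * B + real n * H * E"
        using n by (simp add: power2_eq_square field_simps)
      also have "\<dots> \<le> 3 * L * P * (16 / Y) + L * 4 * E + H * \<eta> * P * 4 + (2 * Y) * H * E"
      proof -
        have "B\<^sup>2 \<le> 4\<^sup>2" using B by (intro power_mono) auto
        then have "B\<^sup>2 / n \<le> 16 / Y" using n Y by (intro frac_le) auto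
        then have "3 * L * P * (B\<^sup>2 / n) \<le> 3 * L * P * (16 / Y)" using L0 P by (intro mult_left_mono) auto
        moreover have "L * B * E \<le> L * 4 * E" using B L0 E0 by (intro mult_right_mono mult_left_mono) auto
        moreover have "H * \<eta> * P * B \<le> H * \<eta> * P * 4" using B H0 P eta0 by (intro mult_left_mono) auto
        moreover have "real n * H * E \<le> (2 * Y) * H * E" using n Y H0 E0 by (intro mult_right_mono) auto
        ultimately show ?thesis by linarith
      qed
      also have "\<dots> \<le> D * (ln Y / Y) * P"
      proof -
        have i1: "1 / Y \<le> ln Y / Y" using lnY Y by (simp add: divide_right_mono)
        have i2: "1 / Y\<^sup>2 \<le> 1 / Y" using Y by (intro frac_le) (auto simp: power2_eq_square)
        have b1: "3 * L * P * (16 / Y) \<le> 48 * L * P * (ln Y / Y)"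
          using mult_left_mono[OF i1, of "48 * L * P"] L0 P by simp
        have b2: "L * 4 * E \<le> 32 * L * C / \<kappa> * P * (ln Y / Y)"
        proof -
          have "L * 4 * E \<le> L * 4 * ((8 * C / \<kappa>) * P / Y\<^sup>2)" using EP L0 by (intro mult_left_mono) auto
          also have "\<dots> = 32 * L * C / \<kappa> * P * (1 / Y\<^sup>2)" by simp
          also have "\<dots> \<le> 32 * L * C / \<kappa> * P * (ln Y / Y)"
            using i1 i2 L0 C_nonneg kap P by (intro mult_left_mono) auto
          finally show ?thesis .
        qed
        have b3: "H * \<eta> * P * 4 = 224 * pi * H * P * (ln Y / Y)" by (simp add: \<eta>_def)
        have b4: "(2 * Y) * H * E \<le> 16 * C * H / \<kappa> * P * (ln Y / Y)"
        proof -
          have "(2 * Y) * H * E \<le> (2 * Y) * H * ((8 * C / \<kappa>) * P / Y\<^sup>2)" using EP H0 Y by (intro mult_left_mono) auto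
          also have "\<dots> = 16 * C * H / \<kappa> * P * (1 / Y)" using Y by (simp add: power2_eq_square)
          also have "\<dots> \<le> 16 * C * H / \<kappa> * P * (ln Y / Y)"
            using i1 H0 C_nonneg kap P by (intro mult_left_mono) auto
          finally show ?thesis .
        qed
        have "D * (ln Y / Y) * P = 48 * L * P * (ln Y / Y) + 32 * L * C / \<kappa> * P * (ln Y / Y)
            + 224 * pi * H * P * (ln Y / Y) + 16 * C * H / \<kappa> * P * (ln Y / Y)"
          unfolding D_def by (simp only: distrib_right) (simp add: mult_ac)
        then show ?thesis using b1 b2 b3 b4 by linarith
      qed
      also have "\<dots> \<le> D * (ln T / T) * P"
      proof -
        have "ln Y = ln 2 + ln T" using T by (simp add: Y_def ln_mult)
        also have "\<dots> \<le> 2 * ln T" using T by simp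
        finally have "ln Y / Y \<le> (2 * ln T) / Y" using Y by (intro divide_right_mono) auto
        then have "ln Y / Y \<le> ln T / T" by (simp add: Y_def)
        moreover have "D \<ge> 0" using L0 H0 C_nonneg kap by (simp add: D_def)
        ultimately show ?thesis using P by (intro mult_right_mono mult_left_mono) auto
      qed
      finally show ?thesis by (simp add: K_def)
    qed
    then show ?thesis using P unfolding f_def by blast
  qed
  have "\<forall>\<^sub>F T in at_top. 56 * pi * ln (2 * T) / (2 * T) \<le> (1::real)" by real_asymp
  then have "\<forall>\<^sub>F T in at_top. \<exists>P>0. \<forall>\<alpha> \<beta>. 0 \<le> \<alpha> \<longrightarrow> \<alpha> \<le> \<beta> \<longrightarrow> \<beta> \<le> pi \<longrightarrow>
     \<bar>integral {inv_ladder (T + \<alpha>)..inv_ladder (T + \<beta>)} (\<lambda>t. h (\<phi> t / 2 - T) * w t) - P * integral {\<alpha>..\<beta>} h\<bar>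
       \<le> D * (ln T / T) * P"
    using eventually_ge_at_top[of 24] eventually_ge_at_top[of "y0 / 2"] eventually_gt_at_top[of "\<phi> T0 / 2"]
    by eventually_elim (rule main; simp)
  then show ?thesis by (rule that)
qed

end

section \<open>The quotient of the two windows\<close>

theorem mainTheorem1:
  fixes a \<tau> y0 T0 :: real and \<mu> \<phi> \<phi>\<^sub>1 \<phi>\<^sub>1_inv :: "real \<Rightarrow> real"
  assumes "admissible y0 \<mu>"
    and "jacob_solution y0 \<mu> T0 \<phi>"
    and "\<phi>\<^sub>1 = (\<lambda>t. \<phi> t / 2)"
    and "\<phi>\<^sub>1_inv = inv_into {T0..} \<phi>\<^sub>1"
    and "0 < a" and "a < 1"
    and "\<tau> = arccos (a / 2)"
  shows "(\<lambda>T. log_zeta_integral a \<phi>\<^sub>1 T (\<phi>\<^sub>1_inv (T + \<tau>)) (\<phi>\<^sub>1_inv (T + pi)) /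
             (- log_zeta_integral a \<phi>\<^sub>1 T (\<phi>\<^sub>1_inv T) (\<phi>\<^sub>1_inv (T + \<tau>))) - 1)
         \<in> O[at_top](\<lambda>T. ln (ln T) / ln T)"
proof -
  note a = \<open>0 < a\<close> \<open>a < 1\<close>
  define w where "w = (\<lambda>t. (norm (zeta_crit t))\<^sup>2)"
  obtain C where C: "C > 0" "\<And>t. t \<ge> 0 \<Longrightarrow> norm (zeta_crit t) \<le> C * (1 + t)"
    using zeta_crit_linear_bound by blast
  interpret ladder w \<mu> \<phi> y0 T0 "C\<^sup>2"
  proof
    show "continuous_on {0..} w" unfolding w_def by (intro continuous_intros zeta_crit_continuous)
    show "w t \<ge> 0" for t by (simp add: w_def)
    show "w t \<le> C\<^sup>2 * (1 + t)\<^sup>2" if "t \<ge> 0" for t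
      using power_mono[OF C(2)[OF that], of 2] by (simp add: w_def power_mult_distrib)
    show "\<exists>t\<in>{p<..<q}. w t > 0" if "p < q" for p q
      using zeta_crit_not_locally_zero[OF that] by (auto simp: w_def)
    show "\<exists>T\<ge>0. integral {0..T} w > A" for A
      unfolding w_def by (rule zeta_crit_mean_square_unbounded)
    show "y0 > 0" "mono_on {y0..} \<mu>" "\<And>y. y \<ge> y0 \<Longrightarrow> \<mu> y \<ge> 7 * y * ln y"
      using \<open>admissible y0 \<mu>\<close> by (auto simp: admissible_def)
    show "T0 > 0" "\<And>T. T \<ge> T0 \<Longrightarrow> \<phi> T \<ge> y0"
      using \<open>jacob_solution y0 \<mu> T0 \<phi>\<close> by (auto simp: jacob_solution_def)
    show "integral {0..\<mu> (\<phi> T)} (\<lambda>t. w t * exp (- (2 / \<phi> T) * t)) = integral {0..T} w" if "T \<ge> T0" for T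
      using \<open>jacob_solution y0 \<mu> T0 \<phi>\<close> that unfolding jacob_solution_def hardy_Z_squared w_def by blast
  qed
  define h where "h = (\<lambda>\<theta>. ln (1 + a\<^sup>2 - 2 * a * cos \<theta>))"
  have hc: "continuous_on A h" for A unfolding h_def by (rule log_kernel_continuous[OF a])
  obtain D where D: "\<forall>\<^sub>F T in at_top. \<exists>P>0. \<forall>\<alpha> \<beta>. 0 \<le> \<alpha> \<longrightarrow> \<alpha> \<le> \<beta> \<longrightarrow> \<beta> \<le> pi \<longrightarrow>
     \<bar>integral {inv_ladder (T + \<alpha>)..inv_ladder (T + \<beta>)} (\<lambda>t. h (\<phi> t / 2 - T) * w t) - P * integral {\<alpha>..\<beta>} h\<bar>
       \<le> D * (ln T / T) * P"
    using ladder_integral_asymptotics[OF hc, of "2 * a / (1 - a)\<^sup>2" "\<bar>ln ((1 - a)\<^sup>2)\<bar> + \<bar>ln ((1 + a)\<^sup>2)\<bar>"]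
      log_kernel_Lipschitz[OF a] log_kernel_bounded[OF a] unfolding h_def by blast
  have lz: "log_zeta_integral a \<phi>\<^sub>1 T (\<phi>\<^sub>1_inv x) (\<phi>\<^sub>1_inv y) =
      integral {inv_ladder x..inv_ladder y} (\<lambda>t. h (\<phi> t / 2 - T) * w t)" for T x y
    by (simp add: log_zeta_integral_def h_def w_def inv_ladder_def assms(3,4))
  \<comment> \<open>Since the kernel has integral 0 over [0, pi], the main term is P J in the
    numerator as well as in the denominator.\<close>
  define J where "J = - integral {0..\<tau>} h"
  have J: "J > 0" using integral_log_kernel_neg[OF a] by (simp add: J_def h_def assms(7))
  have tau: "0 \<le> \<tau>" "\<tau> \<le> pi" using a by (auto simp: assms(7) arccos_lbound arccos_ubound)
  have J': "integral {\<tau>..pi} h = J"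
    using Henstock_Kurzweil_Integration.integral_combine[OF tau, of h] integral_log_kernel[OF a]
    by (simp add: J_def h_def[symmetric] integrable_continuous_real hc)
  define R where "R = (\<lambda>T. log_zeta_integral a \<phi>\<^sub>1 T (\<phi>\<^sub>1_inv (T + \<tau>)) (\<phi>\<^sub>1_inv (T + pi)) /
             (- log_zeta_integral a \<phi>\<^sub>1 T (\<phi>\<^sub>1_inv T) (\<phi>\<^sub>1_inv (T + \<tau>))) - 1)"
  \<comment> \<open>Once the relative error is below J/2, the denominator is at least P J / 2;
    dividing by it then also removes the factor P from the errors.\<close>
  have "((\<lambda>T. D * (ln T / T)) \<longlongrightarrow> 0) at_top" by real_asymp
  then have small: "\<forall>\<^sub>F T in at_top. D * (ln T / T) < J / 2" using J by (intro order_tendstoD(2)) auto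
  have "\<forall>\<^sub>F T in at_top. \<bar>R T\<bar> \<le> (4 * \<bar>D\<bar> / J) * \<bar>ln T / T\<bar>"
    using D small
  proof eventually_elim
    fix T
    assume "\<exists>P>0. \<forall>\<alpha> \<beta>. 0 \<le> \<alpha> \<longrightarrow> \<alpha> \<le> \<beta> \<longrightarrow> \<beta> \<le> pi \<longrightarrow>
     \<bar>integral {inv_ladder (T + \<alpha>)..inv_ladder (T + \<beta>)} (\<lambda>t. h (\<phi> t / 2 - T) * w t) - P * integral {\<alpha>..\<beta>} h\<bar>
       \<le> D * (ln T / T) * P" and s: "D * (ln T / T) < J / 2"
    then obtain P where P: "P > 0"
      and e: "\<And>\<alpha> \<beta>. 0 \<le> \<alpha> \<Longrightarrow> \<alpha> \<le> \<beta> \<Longrightarrow> \<beta> \<le> pi \<Longrightarrow>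
     \<bar>integral {inv_ladder (T + \<alpha>)..inv_ladder (T + \<beta>)} (\<lambda>t. h (\<phi> t / 2 - T) * w t) - P * integral {\<alpha>..\<beta>} h\<bar>
       \<le> D * (ln T / T) * P" by blast
    define N1 where "N1 = log_zeta_integral a \<phi>\<^sub>1 T (\<phi>\<^sub>1_inv (T + \<tau>)) (\<phi>\<^sub>1_inv (T + pi))"
    define N2 where "N2 = - log_zeta_integral a \<phi>\<^sub>1 T (\<phi>\<^sub>1_inv T) (\<phi>\<^sub>1_inv (T + \<tau>))"
    have e1: "\<bar>N1 - P * J\<bar> \<le> D * (ln T / T) * P"
      using e[of \<tau> pi] tau by (simp add: N1_def lz J')
    have e2: "\<bar>N2 - P * J\<bar> \<le> D * (ln T / T) * P"
      using e[of 0 \<tau>] tau unfolding N2_def lz J_def by (simp add: abs_le_iff)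
    have "D * (ln T / T) * P \<le> J / 2 * P" using s P by (intro mult_right_mono) auto
    then have N2: "N2 \<ge> P * J / 2" using e2 by (simp add: abs_le_iff mult.commute)
    have PJ: "P * J / 2 > 0" using P J by simp
    have "R T = N1 / N2 - 1" by (simp only: R_def N1_def N2_def)
    then have "R T = (N1 - N2) / N2" using N2 PJ by (simp add: diff_divide_distrib)
    then have "\<bar>R T\<bar> = \<bar>N1 - N2\<bar> / N2" using N2 PJ by simp
    also have "\<dots> \<le> (2 * (D * (ln T / T) * P)) / (P * J / 2)"
      using e1 e2 N2 PJ by (intro frac_le) auto
    also have "\<dots> = (4 * D / J) * (ln T / T)" using P J by (simp add: field_simps)
    also have "\<dots> \<le> \<bar>(4 * D / J) * (ln T / T)\<bar>" by (rule abs_ge_self)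
    also have "\<dots> = (4 * \<bar>D\<bar> / J) * \<bar>ln T / T\<bar>" using J by (simp add: abs_mult)
    finally show "\<bar>R T\<bar> \<le> (4 * \<bar>D\<bar> / J) * \<bar>ln T / T\<bar>" .
  qed
  then have "R \<in> O[at_top](\<lambda>T. ln T / T)" by (intro bigoI[where c = "4 * \<bar>D\<bar> / J"]) simp
  also have "(\<lambda>T::real. ln T / T) \<in> O[at_top](\<lambda>T. ln (ln T) / ln T)" by real_asymp
  finally show ?thesis unfolding R_def .
qed

end
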